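(* Let $A,B,C\in\mathbb{H}_{11}$ be polynomials such that $AC\in\mathbb{H}_{11}$. If a surface in $\mathbb{R}^3$ is a Möbius transformation of the surface $$\Phi(u,v)=A(u,v)^{-1}B(u,v)C(u,v)^{-1}$$ in $\mathbb{R}^4$, then the former surface is a Möbius transformation of a subset of either a Darboux cyclide, or a Euclidean translational surface, or a Clifford translational surface (in $\mathbb{R}^3$).
   Context: $\mathbb{R}^4$ is identified with the skew field $\mathbb{H}$ of quaternions, $\mathbb{R}^3$ with the set $\mathrm{Im}\,\mathbb{H}\subset\mathbb{H}$ of purely imaginary quaternions, and $S^3$ with the set of unit quaternions. $\mathbb{H}_{mn}\subset\mathbb{H}[u,v]$ is the set of polynomials with quaternionic coefficients of degree at most $m$ in $u$ and at most $n$ in $v$; the variables commute with each other and with the coefficients, and polynomials are evaluated at real $u,v$ only. A surface is an analytic surface: the image of an injective real analytic map of a planar domain into $\mathbb{R}^n$ with nondegenerate differential at each point (for $\Phi$, a domain where $A$ and $C$ do not vanish). A Möbius transformation is a composition of inversions (including reflections in hyperplanes). In $\mathbb{R}^4$ these are precisely the nondegenerate maps $q\mapsto(aq+b)(cq+d)^{-1}$ and $q\mapsto(a\bar q+b)(c\bar q+d)^{-1}$ with $a,b,c,d\in\mathbb{H}$. A circle is either an ordinary circle or a straight line. A Darboux cyclide is a subset of $\mathbb{R}^3$ given by an equation $$a(x^2+y^2+z^2)^2+(x^2+y^2+z^2)(bx+cy+dz)+Q(x,y,z)=0,$$ where $a,b,c,d\in\mathbb{R}$ and $Q\in\mathbb{R}[x,y,z]$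 of degree $\le 2$ do not vanish simultaneously. A Euclidean translational surface is a set $\{p+q: p\in\alpha, q\in\beta\}$, where $\alpha,\beta$ are two fixed circles in $\mathbb{R}^3$. A Clifford translational surface in $\mathbb{R}^3$ is the stereographic projection to $\mathbb{R}^3$ of a set $\{p\cdot q: p\in\alpha,q\in\beta\}\subset S^3$ (quaternionic product), where $\alpha,\beta$ are two fixed circles in $S^3$. *)

theory Defs
  imports "HOL-Analysis.Analysis" "HOL-Library.Poly_Mapping"
begin

section \<open>The skew field of quaternions\<close>

codatatype quat = Quat (qre: real) (qi: real) (qj: real) (qk: real)

lemma quat_eq_iff:
  "x = y \<longleftrightarrow> qre x = qre y \<and> qi x = qi y \<and> qj x = qj y \<and> qk x = qk y"
  by (auto intro: quat.expand)

instantiation quat :: ab_group_add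
begin

primcorec zero_quat where
  "qre 0 = 0" | "qi 0 = 0" | "qj 0 = 0" | "qk 0 = 0"

primcorec plus_quat where
  "qre (x + y) = qre x + qre y"
| "qi (x + y) = qi x + qi y"
| "qj (x + y) = qj x + qj y"
| "qk (x + y) = qk x + qk y"

primcorec uminus_quat where
  "qre (- x) = - qre x"
| "qi (- x) = - qi x"
| "qj (- x) = - qj x"
| "qk (- x) = - qk x"

primcorec minus_quat where
  "qre (x - y) = qre x - qre y"
| "qi (x - y) = qi x - qi y"
| "qj (x - y) = qj x - qj y"
| "qk (x - y) = qk x - qk y"

instance
  by standard (simp_all add: quat_eq_iff)

end

instantiation quat :: ring_1
begin

primcorec one_quat where
  "qre 1 = 1" | "qi 1 = 0" | "qj 1 = 0" | "qk 1 = 0"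

primcorec times_quat where
  "qre (x * y) = qre x * qre y - qi x * qi y - qj x * qj y - qk x * qk y"
| "qi (x * y) = qre x * qi y + qi x * qre y + qj x * qk y - qk x * qj y"
| "qj (x * y) = qre x * qj y - qi x * qk y + qj x * qre y + qk x * qi y"
| "qk (x * y) = qre x * qk y + qi x * qj y - qj x * qi y + qk x * qre y"

instance
  by standard (simp_all add: quat_eq_iff algebra_simps)

end

instantiation quat :: real_algebra_1
begin

primcorec scaleR_quat where
  "qre (scaleR r x) = r * qre x"
| "qi (scaleR r x) = r * qi x"
| "qj (scaleR r x) = r * qj x"
| "qk (scaleR r x) = r * qk x"

instance
  by standard (simp_all add: quat_eq_iff algebra_simps)

end

lemma quat_sum_squares_eq_0_iff:
  "(qre x)\<^sup>2 + (qi x)\<^sup>2 + (qj x)\<^sup>2 + (qk x)\<^sup>2 = 0 \<longleftrightarrow> x = 0"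
  by (auto simp: quat_eq_iff add_nonneg_eq_0_iff)

instantiation quat :: real_div_algebra
begin

definition inverse_quat :: "quat \<Rightarrow> quat" where
  "inverse x = (1 / ((qre x)\<^sup>2 + (qi x)\<^sup>2 + (qj x)\<^sup>2 + (qk x)\<^sup>2)) *\<^sub>R
     Quat (qre x) (- qi x) (- qj x) (- qk x)"

definition divide_quat :: "quat \<Rightarrow> quat \<Rightarrow> quat" where
  "x div y = x * inverse y" for x y :: quat

instance
proof
  fix x y :: quat
  show "inverse x * x = 1" "x * inverse x = 1" if "x \<noteq> 0"
  proof -
    have n: "(qre x)\<^sup>2 + (qi x)\<^sup>2 + (qj x)\<^sup>2 + (qk x)\<^sup>2 \<noteq> 0"
      using that by (simp add: quat_sum_squares_eq_0_iff)
    show "inverse x * x = 1"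
      using n by (simp add: quat_eq_iff inverse_quat_def field_simps power2_eq_square)
    show "x * inverse x = 1"
      using n by (simp add: quat_eq_iff inverse_quat_def field_simps power2_eq_square)
  qed
  show "x div y = x * inverse y"
    by (rule divide_quat_def)
  show "inverse (0 :: quat) = 0"
    by (simp add: quat_eq_iff inverse_quat_def)
qed

end

instantiation quat :: real_inner
begin

definition inner_quat :: "quat \<Rightarrow> quat \<Rightarrow> real" where
  "inner_quat x y = qre x * qre y + qi x * qi y + qj x * qj y + qk x * qk y"

definition norm_quat :: "quat \<Rightarrow> real" where
  "norm_quat x = sqrt (inner x x)"

definition dist_quat :: "quat \<Rightarrow> quat \<Rightarrow> real" where
  "dist_quat x y = norm (x - y)"

definition sgn_quat :: "quat \<Rightarrow> quat" where
  "sgn_quat x = x /\<^sub>R norm x"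

definition uniformity_quat :: "(quat \<times> quat) filter" where
  "uniformity_quat = (INF e\<in>{0 <..}. principal {(x, y). dist x y < e})"

definition open_quat :: "quat set \<Rightarrow> bool" where
  "open_quat U \<longleftrightarrow> (\<forall>x\<in>U. eventually (\<lambda>(x', y). x' = x \<longrightarrow> y \<in> U) uniformity)"

instance
proof
  fix x y z :: quat and r :: real and U :: "quat set"
  show "inner x x = 0 \<longleftrightarrow> x = 0"
    unfolding inner_quat_def by (simp only: quat_sum_squares_eq_0_iff[symmetric] power2_eq_square)
  show "inner x y = inner y x"
    by (simp add: inner_quat_def mult.commute)
  show "inner (x + y) z = inner x z + inner y z"
    by (simp add: inner_quat_def distrib_right)
  show "inner (r *\<^sub>R x) y = r * inner x y"
    by (simp add: inner_quat_def algebra_simps)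
  show "0 \<le> inner x x"
    by (simp add: inner_quat_def)
  show "norm x = sqrt (inner x x)"
    by (rule norm_quat_def)
  show "dist x y = norm (x - y)"
    by (rule dist_quat_def)
  show "sgn x = x /\<^sub>R norm x"
    by (rule sgn_quat_def)
  show "(uniformity :: (quat \<times> quat) filter) = (INF e\<in>{0 <..}. principal {(x, y). dist x y < e})"
    by (rule uniformity_quat_def)
  show "open U \<longleftrightarrow> (\<forall>x\<in>U. eventually (\<lambda>(x', y). x' = x \<longrightarrow> y \<in> U) uniformity)"
    by (rule open_quat_def)
qed

end

definition quat_cnj :: "quat \<Rightarrow> quat" where
  "quat_cnj x = Quat (qre x) (- qi x) (- qj x) (- qk x)"

lemma quat_mult_cnj: "x * quat_cnj x = inner x x *\<^sub>R 1"
  by (simp add: quat_eq_iff quat_cnj_def inner_quat_def)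

lemma quat_cnj_mult: "quat_cnj (x * y) = quat_cnj y * quat_cnj x"
  by (simp add: quat_eq_iff quat_cnj_def mult.commute)

instance quat :: real_normed_div_algebra
proof
  fix x y :: quat
  have "inner (x * y) (x * y) *\<^sub>R 1 = x * (y * quat_cnj y) * quat_cnj x"
    by (simp only: quat_mult_cnj[symmetric] quat_cnj_mult mult.assoc)
  also have "\<dots> = inner y y *\<^sub>R (x * quat_cnj x)"
    by (simp only: quat_mult_cnj mult_scaleR_left mult_scaleR_right mult_1_right)
  also have "\<dots> = (inner x x * inner y y) *\<^sub>R 1"
    by (simp only: quat_mult_cnj scaleR_scaleR mult.commute)
  finally have "inner (x * y) (x * y) = inner x x * inner y y"
    by (simp only: scaleR_cancel_right one_neq_zero simp_thms)
  then show "norm (x * y) = norm x * norm y"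
    by (simp only: norm_quat_def real_sqrt_mult)
qed

instantiation quat :: euclidean_space
begin

definition Basis_quat :: "quat set" where
  "Basis_quat = {Quat 1 0 0 0, Quat 0 1 0 0, Quat 0 0 1 0, Quat 0 0 0 1}"

instance
proof
  fix u v x :: quat
  show "(Basis :: quat set) \<noteq> {}" and "finite (Basis :: quat set)"
    by (simp_all add: Basis_quat_def)
  show "(\<forall>u\<in>Basis. inner x u = 0) \<longleftrightarrow> x = 0"
    by (simp add: Basis_quat_def inner_quat_def) (simp add: quat_eq_iff)
  assume "u \<in> Basis" "v \<in> Basis"
  then show "inner u v = (if u = v then 1 else 0)"
    unfolding Basis_quat_def by (elim insertE emptyE) (simp_all add: inner_quat_def)
qed

end

lemma DIM_quat [simp]: "DIM(quat) = 4"
  by (simp add: Basis_quat_def)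

text \<open>\<open>\<real>\<^sup>3\<close> is identified with the purely imaginary quaternions via \<open>im_quat\<close>.\<close>

definition im_quat :: "real ^ 3 \<Rightarrow> quat" where
  "im_quat x = Quat 0 (x $ 1) (x $ 2) (x $ 3)"

definition im_part :: "quat \<Rightarrow> real ^ 3" where
  "im_part q = vector [qi q, qj q, qk q]"


section \<open>Quaternionic polynomials in two commuting variables\<close>

text \<open>
  \<open>Poly_Mapping.lookup P (i, j)\<close> is the coefficient of \<open>u\<^sup>i v\<^sup>j\<close>. The convolution product of
  \<^theory>\<open>HOL-Library.Poly_Mapping\<close> adds exponents and multiplies coefficients in the given
  order, so the variables commute with each other and with the coefficients.
\<close>

type_synonym quat_poly = "(nat \<times> nat) \<Rightarrow>\<^sub>0 quat"

definition quat_polys :: "nat \<Rightarrow> nat \<Rightarrow> quat_poly set" where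
  "quat_polys m n = {P. \<forall>(i, j)\<in>Poly_Mapping.keys P. i \<le> m \<and> j \<le> n}"

definition quat_eval :: "quat_poly \<Rightarrow> real \<times> real \<Rightarrow> quat" where
  "quat_eval P = (\<lambda>(u, v).
     \<Sum>(i, j)\<in>Poly_Mapping.keys P. (u ^ i * v ^ j) *\<^sub>R Poly_Mapping.lookup P (i, j))"

lemma quat_eval_superset:
  assumes "finite K" and "Poly_Mapping.keys P \<subseteq> K"
  shows "quat_eval P (u, v) = (\<Sum>(i, j)\<in>K. (u ^ i * v ^ j) *\<^sub>R Poly_Mapping.lookup P (i, j))"
  unfolding quat_eval_def prod.case using assms
  by (intro sum.mono_neutral_left) (auto simp: in_keys_iff)

lemma quat_eval_add: "quat_eval (P + Q) p = quat_eval P p + quat_eval Q p"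
proof (cases p)
  case (Pair u v)
  let ?K = "Poly_Mapping.keys P \<union> Poly_Mapping.keys Q"
  have "Poly_Mapping.keys (P + Q) \<subseteq> ?K"
    by (rule Poly_Mapping.keys_add)
  then show ?thesis
    unfolding Pair
    by (subst (1 2 3) quat_eval_superset[of ?K])
       (auto simp: lookup_add scaleR_add_right sum.distrib[symmetric] intro!: sum.cong)
qed

lemma quat_eval_0 [simp]: "quat_eval 0 p = 0"
  by (simp add: quat_eval_def split: prod.split)

lemma quat_eval_single:
  "quat_eval (Poly_Mapping.single (i, j) a) (u, v) = (u ^ i * v ^ j) *\<^sub>R a"
  by (subst quat_eval_superset[of "{(i, j)}"]) (auto simp: in_keys_iff lookup_single)

lemma quat_poly_induct [case_names zero single add]:
  fixes P :: quat_poly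
  assumes "Pr 0" and "\<And>m a. Pr (Poly_Mapping.single m a)"
    and "\<And>P Q. Pr P \<Longrightarrow> Pr Q \<Longrightarrow> Pr (P + Q)"
  shows "Pr P"
proof (induction P rule: update_induct)
  case const
  show ?case by (rule assms(1))
next
  case (update f a b)
  have "Poly_Mapping.update a b f = f + Poly_Mapping.single a b"
    using update(1)
    by (intro poly_mapping_eqI) (auto simp: lookup_update lookup_add lookup_single in_keys_iff)
  then show ?case
    using assms(2,3) update by metis
qed

lemma quat_eval_mult: "quat_eval (P * Q) p = quat_eval P p * quat_eval Q p"
proof (cases p)
  case (Pair u v)
  have single: "quat_eval (Poly_Mapping.single m a * R) (u, v)
      = quat_eval (Poly_Mapping.single m a) (u, v) * quat_eval R (u, v)" for m a R
  proof (induction R rule: quat_poly_induct)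
    case zero
    show ?case by simp
  next
    case (single n b)
    show ?case
      by (cases m; cases n) (simp add: mult_single quat_eval_single power_add mult_ac)
  next
    case (add R1 R2)
    then show ?case
      by (simp add: distrib_left quat_eval_add)
  qed
  show ?thesis
    unfolding Pair
    by (induction P rule: quat_poly_induct)
       (simp_all add: single distrib_right quat_eval_add)
qed

definition Phi :: "quat_poly \<Rightarrow> quat_poly \<Rightarrow> quat_poly \<Rightarrow> real \<times> real \<Rightarrow> quat" where
  "Phi A B C p = inverse (quat_eval A p) * quat_eval B p * inverse (quat_eval C p)"


section \<open>Analytic surfaces\<close>

definition real_analytic_on ::
    "(real \<times> real \<Rightarrow> 'a::real_normed_vector) \<Rightarrow> (real \<times> real) set \<Rightarrow> bool" where
  "real_analytic_on f D \<longleftrightarrow>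
     (\<forall>p\<in>D. \<exists>r>0. \<exists>c. \<forall>q\<in>ball p r.
        ((\<lambda>(i, j). ((fst q - fst p) ^ i * (snd q - snd p) ^ j) *\<^sub>R c i j) has_sum f q)
          (UNIV :: (nat \<times> nat) set))"

definition surface_param ::
    "(real \<times> real) set \<Rightarrow> (real \<times> real \<Rightarrow> 'a::euclidean_space) \<Rightarrow> bool" where
  "surface_param D f \<longleftrightarrow>
     open D \<and> connected D \<and> D \<noteq> {} \<and>
     real_analytic_on f D \<and> inj_on f D \<and>
     (\<forall>p\<in>D. \<exists>f'. (f has_derivative f') (at p) \<and> inj f')"

definition surface :: "'a::euclidean_space set \<Rightarrow> bool" where
  "surface S \<longleftrightarrow> (\<exists>D f. surface_param D f \<and> S = f ` D)"


section \<open>Moebius transformations\<close>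

text \<open>
  Moebius transformations act on the one-point compactification of a Euclidean space, modelled
  by the option type with \<^const>\<open>None\<close> as the point at infinity.
\<close>

definition sphere_inversion ::
    "'a::euclidean_space \<Rightarrow> real \<Rightarrow> 'a option \<Rightarrow> 'a option" where
  "sphere_inversion c r x =
     (case x of
        None \<Rightarrow> Some c
      | Some y \<Rightarrow> if y = c then None else Some (c + (r / dist y c)\<^sup>2 *\<^sub>R (y - c)))"

text \<open>Reflection in the hyperplane \<open>{y. a \<bullet> y = b}\<close>, where \<open>a \<noteq> 0\<close>.\<close>

definition hyperplane_reflection ::
    "'a::euclidean_space \<Rightarrow> real \<Rightarrow> 'a option \<Rightarrow> 'a option" where
  "hyperplane_reflection a b = map_option (\<lambda>y. y - (2 * (a \<bullet> y - b) / (a \<bullet> a)) *\<^sub>R a)"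

inductive moebius :: "('a::euclidean_space option \<Rightarrow> 'a option) \<Rightarrow> bool" where
  moebius_id: "moebius id"
| moebius_inversion: "moebius f \<Longrightarrow> r > 0 \<Longrightarrow> moebius (sphere_inversion c r \<circ> f)"
| moebius_reflection: "moebius f \<Longrightarrow> a \<noteq> 0 \<Longrightarrow> moebius (hyperplane_reflection a b \<circ> f)"

definition moebius_image_of :: "'a::euclidean_space set \<Rightarrow> 'a set \<Rightarrow> bool" where
  "moebius_image_of T S \<longleftrightarrow> (\<exists>M. moebius M \<and> Some ` T = M ` Some ` S)"


section \<open>Circles and the three classes of surfaces\<close>

definition circle :: "'a::euclidean_space set \<Rightarrow> bool" where
  "circle K \<longleftrightarrow>
     (\<exists>P c r. affine P \<and> aff_dim P = 2 \<and> c \<in> P \<and> r > 0 \<and> K = P \<inter> sphere c r) \<or>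
     (affine K \<and> aff_dim K = 1)"

definition eval3 :: "((nat \<times> nat \<times> nat) \<Rightarrow>\<^sub>0 real) \<Rightarrow> real \<Rightarrow> real \<Rightarrow> real \<Rightarrow> real" where
  "eval3 Q x y z =
     (\<Sum>(i, j, k)\<in>Poly_Mapping.keys Q. Poly_Mapping.lookup Q (i, j, k) * x ^ i * y ^ j * z ^ k)"

definition darboux_cyclide :: "(real ^ 3) set \<Rightarrow> bool" where
  "darboux_cyclide Y \<longleftrightarrow>
     (\<exists>a b c d Q.
        \<not> (a = 0 \<and> b = 0 \<and> c = 0 \<and> d = 0 \<and> Q = 0) \<and>
        (\<forall>(i, j, k)\<in>Poly_Mapping.keys Q. i + j + k \<le> 2) \<and>
        Y = {p. let x = p $ 1; y = p $ 2; z = p $ 3 in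
               a * (x\<^sup>2 + y\<^sup>2 + z\<^sup>2)\<^sup>2 + (x\<^sup>2 + y\<^sup>2 + z\<^sup>2) * (b * x + c * y + d * z)
                 + eval3 Q x y z = 0})"

definition euclidean_translational :: "(real ^ 3) set \<Rightarrow> bool" where
  "euclidean_translational Y \<longleftrightarrow>
     (\<exists>\<alpha> \<beta>. circle \<alpha> \<and> circle \<beta> \<and> Y = {p + q | p q. p \<in> \<alpha> \<and> q \<in> \<beta>})"

text \<open>Stereographic projection of the unit sphere from the pole \<open>1\<close> to the purely imaginary
  quaternions. The pole itself has no image in \<open>\<real>\<^sup>3\<close> and is removed before projecting.\<close>

definition stereographic :: "quat \<Rightarrow> real ^ 3" where
  "stereographic q = (1 / (1 - qre q)) *\<^sub>R im_part q"

definition clifford_translational :: "(real ^ 3) set \<Rightarrow> bool" where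
  "clifford_translational Y \<longleftrightarrow>
     (\<exists>\<alpha> \<beta> :: quat set. circle \<alpha> \<and> \<alpha> \<subseteq> sphere 0 1 \<and> circle \<beta> \<and> \<beta> \<subseteq> sphere 0 1 \<and>
        Y = stereographic ` ({p * q | p q. p \<in> \<alpha> \<and> q \<in> \<beta>} - {1}))"

end

theory Submission
  imports Defs
begin

text \<open>
  Moebius transformations are replaced by conformal equivalence: two parametrisations \<open>f\<close>, \<open>h\<close> over
  the same set are equivalent if \<open>\<bar>h s - h t\<bar> = \<rho> s \<rho> t \<bar>f s - f t\<bar>\<close> for a positive function \<open>\<rho>\<close>.
  Equivalent subsets of \<open>\<real>\<^sup>3\<close> are Moebius images of each other, since inversions at two corresponding
  points turn the equivalence into a similarity, which extends to the whole space. So it suffices to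
  find, for \<open>\<Phi>\<close> lying on a sphere or hyperplane of \<open>\<real>\<^sup>4\<close>, an equivalent parametrisation of a subset of
  one of the three model surfaces. As \<open>A C\<close> has bidegree \<open>(1, 1)\<close>, either \<open>A\<close> or \<open>C\<close> is constant, or the two
  depend on one variable each, on different ones.

  If \<open>C\<close> is constant, a Cayley transformation makes \<open>\<Phi> = A\<^sup>-\<^sup>1 B\<close> imaginary. Viewing \<open>A\<close>, \<open>B\<close> as linear in
  \<open>t = (1, u, v, u v)\<close>, one gets \<open>A t \<bullet> B t = l (t\<^sub>0 t\<^sub>3 - t\<^sub>1 t\<^sub>2)\<close> for all \<open>t\<close>. The linear system \<open>A t q = B t\<close>
  is solvable for every \<open>q = \<Phi> (u, v)\<close>, and its determinant is an equation of a Darboux cyclide. If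
  \<open>l \<noteq> 0\<close>, it does not vanish on all of \<open>\<real>\<^sup>3\<close>, because the solutions lie on the Segre quadric and so yield
  a null set only. If \<open>l = 0\<close>, the form \<open>A t \<bullet> B s\<close> is skew, and linear algebra shows that, up to a
  Moebius transformation of \<open>\<real>\<^sup>3\<close>, \<open>\<Phi>\<close> is a real projective image of the Segre quadric or planar.

  If \<open>A\<close> depends on \<open>u\<close> and \<open>C\<close> on \<open>v\<close> only, partial fractions turn \<open>\<Phi>\<close> into a sum or a product of two
  circles (or reduce it to the previous case). Comparing Fourier coefficients in the equation of the
  sphere leaves Euclidean and Clifford translational surfaces, and surfaces on a second quadric,
  which are again Darboux cyclides.
\<close>

section \<open>Conformal equivalence of parametrised sets\<close>

text \<open>The invariant is useful because its factor splits: inversions, Cayley transformations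
  and similarities all change the distance of two points by a product of one factor per point. The
  two sides of \<open>conf_eq\<close> may live in different spaces, so R^4 is left for R^3 without
  extending any map, and infinity never enters the classification. The recurring obstacle is
  nontriviality. A Darboux cyclide needs an equation that is not identically zero, so each equation
  is carried along with a point at which it fails; null sets, a neighbourhood of 1, or a few points
  of the sphere provide that point. A second obstacle is the pole of the Cayley transformation,
  which must avoid the surface; a pole exists because the cone over a surface is a null set in R^4.
  Coefficients are compared on an open set of parameters. Injectivity of \<open>Phi A B C\<close>
  excludes that one of the two circles shrinks to a point.\<close>

definition conf_eq :: "'p set \<Rightarrow> ('p \<Rightarrow> 'a::metric_space) \<Rightarrow> ('p \<Rightarrow> 'b::metric_space) \<Rightarrow> bool" where
  "conf_eq D f h \<longleftrightarrow>
     (\<exists>\<rho>. (\<forall>s\<in>D. \<rho> s > 0) \<and>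
          (\<forall>s\<in>D. \<forall>t\<in>D. dist (h s) (h t) = \<rho> s * \<rho> t * dist (f s) (f t)))"

lemma conf_eqI:
  assumes "\<And>s. s \<in> D \<Longrightarrow> \<rho> s > 0"
    and "\<And>s t. s \<in> D \<Longrightarrow> t \<in> D \<Longrightarrow> dist (h s) (h t) = \<rho> s * \<rho> t * dist (f s) (f t)"
  shows "conf_eq D f h"
  using assms unfolding conf_eq_def by blast

lemma conf_eq_sym:
  assumes "conf_eq D f h" shows "conf_eq D h f"
proof -
  obtain \<rho> where r: "\<And>s. s \<in> D \<Longrightarrow> \<rho> s > 0"
    "\<And>s t. s \<in> D \<Longrightarrow> t \<in> D \<Longrightarrow> dist (h s) (h t) = \<rho> s * \<rho> t * dist (f s) (f t)"
    using assms unfolding conf_eq_def by blast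
  show ?thesis
  proof (rule conf_eqI[where \<rho> = "\<lambda>s. inverse (\<rho> s)"])
    fix s t assume st: "s \<in> D" "t \<in> D"
    show "dist (f s) (f t) = inverse (\<rho> s) * inverse (\<rho> t) * dist (h s) (h t)"
      using r(1)[OF st(1)] r(1)[OF st(2)] by (simp add: r(2)[OF st] field_simps)
  qed (use r in auto)
qed

lemma conf_eq_trans:
  assumes "conf_eq D f g" "conf_eq D g h" shows "conf_eq D f h"
proof -
  obtain \<rho> where r: "\<And>s. s \<in> D \<Longrightarrow> \<rho> s > 0"
    "\<And>s t. s \<in> D \<Longrightarrow> t \<in> D \<Longrightarrow> dist (g s) (g t) = \<rho> s * \<rho> t * dist (f s) (f t)"
    using assms(1) unfolding conf_eq_def by blast
  obtain \<sigma> where q: "\<And>s. s \<in> D \<Longrightarrow> \<sigma> s > 0"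
    "\<And>s t. s \<in> D \<Longrightarrow> t \<in> D \<Longrightarrow> dist (h s) (h t) = \<sigma> s * \<sigma> t * dist (g s) (g t)"
    using assms(2) unfolding conf_eq_def by blast
  show ?thesis
    by (rule conf_eqI[where \<rho> = "\<lambda>s. \<rho> s * \<sigma> s"]) (simp_all add: r q)
qed

text \<open>A constant factor \<open>k\<close> splits as \<open>sqrt k\<close> for each of the two
  points.\<close>

lemma conf_eq_similar:
  assumes "k > 0"
    and "\<And>s t. s \<in> D \<Longrightarrow> t \<in> D \<Longrightarrow> dist (h s) (h t) = k * dist (f s) (f t)"
  shows "conf_eq D f h"
  by (rule conf_eqI[where \<rho> = "\<lambda>_. sqrt k"]) (use assms in simp_all)

lemma conf_eq_cong:
  assumes "\<And>s. s \<in> D \<Longrightarrow> f s = f' s" "\<And>s. s \<in> D \<Longrightarrow> h s = h' s"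
  shows "conf_eq D f h \<longleftrightarrow> conf_eq D f' h'"
  using assms unfolding conf_eq_def by simp

lemma conf_eq_mult_add:
  fixes f :: "'p \<Rightarrow> 'a::real_normed_div_algebra"
  assumes "a \<noteq> 0" "b \<noteq> 0"
  shows "conf_eq D f (\<lambda>s. a * f s * b + c)"
proof (rule conf_eq_similar[where k = "norm a * norm b"])
  fix s t
  have "a * f s * b + c - (a * f t * b + c) = a * (f s - f t) * b"
    by (simp add: algebra_simps)
  then show "dist (a * f s * b + c) (a * f t * b + c) = norm a * norm b * dist (f s) (f t)"
    by (simp add: dist_norm norm_mult)
qed (use assms in simp)

text \<open>The difference of two inverses is \<open>inverse x * (y - x) * inverse y\<close> even
  without commutativity, and the norm is multiplicative. With \<open>conf_eq_mult_add\<close> this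
  covers fractional linear maps away from their poles.\<close>

lemma conf_eq_inverse:
  fixes f :: "'p \<Rightarrow> 'a::real_normed_div_algebra"
  assumes "\<And>s. s \<in> D \<Longrightarrow> f s \<noteq> 0"
  shows "conf_eq D f (\<lambda>s. inverse (f s))"
  by (rule conf_eqI[where \<rho> = "\<lambda>s. inverse (norm (f s))"])
     (simp_all add: assms dist_norm inverse_diff_inverse norm_mult norm_inverse)

section \<open>Moebius transformations\<close>

text \<open>With the value 1 for the distance from infinity to a finite point, the conformal factor of
  an inversion extends to its centre and to infinity.\<close>

fun odist :: "'a::metric_space option \<Rightarrow> 'a option \<Rightarrow> real" where
  "odist (Some x) (Some y) = dist x y"
| "odist None (Some y) = 1"
| "odist (Some x) None = 1"
| "odist None None = 0"

lemma dist_inversion: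
  fixes x y c :: "'a::real_inner"
  assumes "x \<noteq> c" "y \<noteq> c"
  shows "dist (c + (r / dist x c)\<^sup>2 *\<^sub>R (x - c)) (c + (r / dist y c)\<^sup>2 *\<^sub>R (y - c))
    = r\<^sup>2 / (dist x c * dist y c) * dist x y"
proof -
  define a b where ab: "a = x - c" "b = y - c"
  have n: "norm a \<noteq> 0" "norm b \<noteq> 0" using assms by (auto simp: ab)
  have e: "(norm (s *\<^sub>R a - t *\<^sub>R b))\<^sup>2 = s\<^sup>2 * (norm a)\<^sup>2 - 2 * s * t * (a \<bullet> b) + t\<^sup>2 * (norm b)\<^sup>2" for s t
    unfolding power2_norm_eq_inner
    by (simp add: inner_diff_left inner_diff_right inner_commute[of b a] power2_eq_square algebra_simps)
  have *: "((r / A)\<^sup>2)\<^sup>2 * A\<^sup>2 - 2 * (r / A)\<^sup>2 * (r / B)\<^sup>2 * k + ((r / B)\<^sup>2)\<^sup>2 * B\<^sup>2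
    = (r\<^sup>2 / (A * B))\<^sup>2 * (A\<^sup>2 - 2 * k + B\<^sup>2)" if "A \<noteq> 0" "B \<noteq> 0" for A B k :: real
    using that by (simp add: field_simps power2_eq_square)
  have "(norm (a - b))\<^sup>2 = (norm a)\<^sup>2 - 2 * (a \<bullet> b) + (norm b)\<^sup>2"
    using e[of 1 1] by simp
  then have "(norm ((r / norm a)\<^sup>2 *\<^sub>R a - (r / norm b)\<^sup>2 *\<^sub>R b))\<^sup>2
    = (r\<^sup>2 / (norm a * norm b))\<^sup>2 * (norm (a - b))\<^sup>2"
    unfolding e using *[OF n] by simp
  then have "(norm ((r / norm a)\<^sup>2 *\<^sub>R a - (r / norm b)\<^sup>2 *\<^sub>R b))\<^sup>2
    = (r\<^sup>2 / (norm a * norm b) * norm (a - b))\<^sup>2"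
    by (simp only: power_mult_distrib)
  then have "norm ((r / norm a)\<^sup>2 *\<^sub>R a - (r / norm b)\<^sup>2 *\<^sub>R b) = r\<^sup>2 / (norm a * norm b) * norm (a - b)"
    by (rule power2_eq_imp_eq) auto
  then show ?thesis by (simp add: ab dist_norm)
qed

text \<open>The values of the factor at the special points are forced: infinity goes to
  \<open>c\<close>, at distance \<open>r\<^sup>2 / dist y c\<close> from the image of
  \<open>y\<close>, which requires \<open>r\<close>; the centre goes to infinity, at
  \<open>odist\<close> 1 from finite points, which requires \<open>1 / r\<close>.\<close>

lemma odist_sphere_inversion:
  fixes c :: "'a::euclidean_space"
  assumes "r > 0"
  defines "\<rho> \<equiv> \<lambda>x. case x of None \<Rightarrow> r | Some y \<Rightarrow> if y = c then 1 / r else r / dist y c"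
  shows "\<rho> x > 0"
    and "odist (sphere_inversion c r x) (sphere_inversion c r y) = \<rho> x * \<rho> y * odist x y"
proof -
  show "\<rho> x > 0" using assms by (auto split: option.split)
  have c1: "dist (c + (r / dist y c)\<^sup>2 *\<^sub>R (y - c)) c = r\<^sup>2 / dist y c" if "y \<noteq> c" for y
    using that assms(1) by (simp add: dist_norm power_divide) (simp add: power2_eq_square)
  then have c2: "dist c (c + (r / dist y c)\<^sup>2 *\<^sub>R (y - c)) = r\<^sup>2 / dist y c" if "y \<noteq> c" for y
    using that by (subst dist_commute)
  show "odist (sphere_inversion c r x) (sphere_inversion c r y) = \<rho> x * \<rho> y * odist x y"
    using assms(1)
    by (cases x; cases y)
       (auto simp: sphere_inversion_def \<rho>_def dist_inversion c1 c2 dist_commute[of c]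
          power2_eq_square[of r] simp del: dist_add_cancel)
qed

lemma dist_reflection:
  fixes x y a :: "'a::real_inner"
  assumes "a \<noteq> 0"
  shows "dist (x - (2 * (a \<bullet> x - b) / (a \<bullet> a)) *\<^sub>R a) (y - (2 * (a \<bullet> y - b) / (a \<bullet> a)) *\<^sub>R a) = dist x y"
proof -
  define z where "z = x - y"
  define t where "t = 2 * (a \<bullet> z) / (a \<bullet> a)"
  have e: "x - (2 * (a \<bullet> x - b) / (a \<bullet> a)) *\<^sub>R a - (y - (2 * (a \<bullet> y - b) / (a \<bullet> a)) *\<^sub>R a)
     = z - t *\<^sub>R a"
    by (simp add: z_def t_def inner_diff_right algebra_simps diff_divide_distrib add_divide_distrib)
  have "t * (a \<bullet> a) = 2 * (a \<bullet> z)" using assms by (simp add: t_def)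
  then have "(z - t *\<^sub>R a) \<bullet> (z - t *\<^sub>R a) = z \<bullet> z"
    by (simp add: inner_diff_left inner_diff_right inner_commute[of z a] algebra_simps)
  then show ?thesis
    unfolding dist_norm e by (simp add: norm_eq_sqrt_inner z_def)
qed

text \<open>Factors multiply along a composition. The induction runs on the compactified space,
  since a partial composition may send points to infinity even if the whole transformation does
  not.\<close>

lemma odist_moebius:
  assumes "moebius M"
  shows "\<exists>\<rho>. (\<forall>x. \<rho> x > 0) \<and> (\<forall>x y. odist (M x) (M y) = \<rho> x * \<rho> y * odist x y)"
  using assms
proof (induction rule: moebius.induct)
  case moebius_id
  show ?case by (rule exI[of _ "\<lambda>_. 1"]) simp
next
  case (moebius_inversion f r c)
  obtain \<rho> where r: "\<And>x. \<rho> x > 0" "\<And>x y. odist (f x) (f y) = \<rho> x * \<rho> y * odist x y"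
    using moebius_inversion.IH by blast
  obtain \<sigma> where s: "\<And>x. \<sigma> x > 0"
    "\<And>x y. odist (sphere_inversion c r x) (sphere_inversion c r y) = \<sigma> x * \<sigma> y * odist x y"
    using odist_sphere_inversion[OF moebius_inversion.hyps(2), of c] that by blast
  show ?case
    by (rule exI[of _ "\<lambda>x. \<sigma> (f x) * \<rho> x"]) (simp add: r s)
next
  case (moebius_reflection f a b)
  have "odist (hyperplane_reflection a b x) (hyperplane_reflection a b y) = odist x y" for x y
    using moebius_reflection.hyps
    by (cases x; cases y) (simp_all add: hyperplane_reflection_def dist_reflection del: right_diff_distrib_numeral)
  then show ?case using moebius_reflection.IH by simp
qed

lemma moebius_comp:
  assumes "moebius g" "moebius f" shows "moebius (g \<circ> f)"
  using assms(1)
proof (induction g rule: moebius.induct)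
  case moebius_id
  show ?case using assms(2) by simp
next
  case (moebius_inversion g r c)
  then show ?case unfolding comp_assoc by (intro moebius.moebius_inversion)
next
  case (moebius_reflection g a b)
  then show ?case unfolding comp_assoc by (intro moebius.moebius_reflection)
qed

section \<open>Spheres and hyperplanes under Moebius transformations\<close>

text \<open>One equation covers hyperplanes (\<open>\<kappa> = 0\<close>) and spheres, whose squared
  radius is \<open>(n \<bullet> n - 4 * \<kappa> * m) / (4 * \<kappa>\<^sup>2)\<close>. Positivity
  of \<open>n \<bullet> n - 4 * \<kappa> * m\<close> is nondegeneracy in both cases: a nonzero
  normal, or a positive radius.\<close>

definition on_sphere :: "real \<Rightarrow> 'a::real_inner \<Rightarrow> real \<Rightarrow> 'a \<Rightarrow> bool" where
  "on_sphere \<kappa> n m x \<longleftrightarrow> \<kappa> * (x \<bullet> x) + n \<bullet> x + m = 0"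

definition on_osphere :: "real \<Rightarrow> 'a::real_inner \<Rightarrow> real \<Rightarrow> 'a option \<Rightarrow> bool" where
  "on_osphere \<kappa> n m x \<longleftrightarrow> (case x of None \<Rightarrow> \<kappa> = 0 | Some y \<Rightarrow> on_sphere \<kappa> n m y)"

lemma on_sphere_shift:
  "on_sphere \<kappa> n m (c + z) \<longleftrightarrow> on_sphere \<kappa> (n + (2 * \<kappa>) *\<^sub>R c) (\<kappa> * (c \<bullet> c) + n \<bullet> c + m) z"
proof -
  have "\<kappa> * ((c + z) \<bullet> (c + z)) + n \<bullet> (c + z) + m
    = \<kappa> * (z \<bullet> z) + (n + (2 * \<kappa>) *\<^sub>R c) \<bullet> z + (\<kappa> * (c \<bullet> c) + n \<bullet> c + m)"
    by (simp add: inner_add_left inner_add_right inner_commute[of z c] algebra_simps)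
  then show ?thesis by (simp only: on_sphere_def)
qed

lemma disc_shift:
  fixes n c :: "'a::real_inner"
  shows "(n + (2 * \<kappa>) *\<^sub>R c) \<bullet> (n + (2 * \<kappa>) *\<^sub>R c) - 4 * \<kappa> * (\<kappa> * (c \<bullet> c) + n \<bullet> c + m)
    = n \<bullet> n - 4 * \<kappa> * m"
  by (simp add: inner_add_left inner_add_right inner_commute[of c n] algebra_simps)

text \<open>With the centre moved to the origin, substituting the inversion and clearing the
  denominator exchanges the quadratic and the constant coefficient, up to powers of
  \<open>r\<close>. The discriminant is multiplied by \<open>r ^ 4\<close> and is invariant under
  translations.\<close>

lemma on_osphere_inversion:
  fixes n c :: "'a::euclidean_space"
  assumes "r > 0" "n \<bullet> n - 4 * \<kappa> * m > 0"
  shows "\<exists>\<kappa>' n' m'. n' \<bullet> n' - 4 * \<kappa>' * m' > 0 \<and>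
    (\<forall>x. on_osphere \<kappa> n m (sphere_inversion c r x) \<longrightarrow> on_osphere \<kappa>' n' m' x)"
proof -
  define n' m' where nm: "n' = n + (2 * \<kappa>) *\<^sub>R c" "m' = \<kappa> * (c \<bullet> c) + n \<bullet> c + m"
  define N where "N = r\<^sup>2 *\<^sub>R n'"
  define Mm where "Mm = \<kappa> * r ^ 4"
  have d: "N \<bullet> N - 4 * m' * Mm = r ^ 4 * (n \<bullet> n - 4 * \<kappa> * m)"
    unfolding disc_shift[of n \<kappa> c m, symmetric] nm[symmetric] N_def Mm_def
    by (simp add: algebra_simps power2_eq_square power4_eq_xxxx)
  \<comment> \<open>The coefficients \<open>m'\<close>, \<open>N\<close>, \<open>Mm\<close> refer to
    \<open>c\<close> as origin; the shift by \<open>-c\<close> returns to the original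
    coordinates.\<close>
  have *: "on_osphere m' (N + (2 * m') *\<^sub>R (-c)) (m' * (-c \<bullet> -c) + N \<bullet> (-c) + Mm) x"
    if h: "on_osphere \<kappa> n m (sphere_inversion c r x)" for x
  proof (cases x)
    case None
    then show ?thesis using h by (simp add: on_osphere_def sphere_inversion_def on_sphere_def nm)
  next
    case (Some y)
    show ?thesis
    proof (cases "y = c")
      case True
      then show ?thesis using h Some
        by (simp add: on_osphere_def sphere_inversion_def on_sphere_def Mm_def algebra_simps inner_add_left)
    next
      case False
      define z where "z = y - c"
      define q where "q = z \<bullet> z"
      have q: "q \<noteq> 0" using False by (simp add: z_def q_def)
      have rq: "(r / dist y c)\<^sup>2 = r\<^sup>2 / q"
        by (simp add: q_def z_def dist_norm power_divide power2_norm_eq_inner)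
      have "on_sphere \<kappa> n' m' ((r\<^sup>2 / q) *\<^sub>R z)"
        using h Some False
        by (simp add: on_osphere_def sphere_inversion_def on_sphere_shift nm z_def rq)
      then have "\<kappa> * ((r\<^sup>2 / q)\<^sup>2 * q) + r\<^sup>2 / q * (n' \<bullet> z) + m' = 0"
        by (simp add: on_sphere_def q_def[symmetric] power2_eq_square mult_ac del: times_divide_eq_right times_divide_eq_left)
      then have "m' * q + r\<^sup>2 * (n' \<bullet> z) + \<kappa> * r ^ 4 = 0"
        using q by (simp add: field_simps power2_eq_square power4_eq_xxxx)
      then have "on_sphere m' N Mm (-c + y)"
        by (simp add: on_sphere_def N_def Mm_def z_def q_def)
      then show ?thesis unfolding Some on_osphere_def option.case on_sphere_shift .
    qed
  qed
  show ?thesis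
    using * assms d disc_shift[of N m' "-c" Mm]
    by (intro exI[of _ m'] exI[of _ "N + (2 * m') *\<^sub>R (-c)"]
          exI[of _ "m' * (-c \<bullet> -c) + N \<bullet> (-c) + Mm"]) simp
qed

lemma on_osphere_reflection:
  fixes n a :: "'a::euclidean_space"
  assumes "a \<noteq> 0" "n \<bullet> n - 4 * \<kappa> * m > 0"
  shows "\<exists>\<kappa>' n' m'. n' \<bullet> n' - 4 * \<kappa>' * m' > 0 \<and>
    (\<forall>x. on_osphere \<kappa> n m (hyperplane_reflection a b x) \<longrightarrow> on_osphere \<kappa>' n' m' x)"
proof -
  \<comment> \<open>Chosen so that the change
    \<open>\<tau> * (2 * b * \<kappa> + n \<bullet> a)\<close> of the equation under the reflection
    equals \<open>\<mu> * (a \<bullet> y - b)\<close>, which is affine in \<open>y\<close> and is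
    absorbed by \<open>n\<close> and \<open>m\<close>.\<close>
  define \<mu> where "\<mu> = (4 * b * \<kappa> + 2 * (n \<bullet> a)) / (a \<bullet> a)"
  have aa: "a \<bullet> a \<noteq> 0" using assms by simp
  have \<mu>: "\<mu> * (a \<bullet> a) = 4 * b * \<kappa> + 2 * (n \<bullet> a)" using aa by (simp add: \<mu>_def)
  have "(n - \<mu> *\<^sub>R a) \<bullet> (n - \<mu> *\<^sub>R a) - 4 * \<kappa> * (m + b * \<mu>)
     = n \<bullet> n + \<mu> * (\<mu> * (a \<bullet> a) - 2 * (n \<bullet> a)) - 4 * \<kappa> * (m + b * \<mu>)"
    by (simp add: inner_diff_left inner_diff_right inner_commute[of a n] algebra_simps)
  also have "\<dots> = n \<bullet> n - 4 * \<kappa> * m" unfolding \<mu> by (simp add: algebra_simps)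
  finally have d: "(n - \<mu> *\<^sub>R a) \<bullet> (n - \<mu> *\<^sub>R a) - 4 * \<kappa> * (m + b * \<mu>) = n \<bullet> n - 4 * \<kappa> * m" .
  have *: "on_osphere \<kappa> (n - \<mu> *\<^sub>R a) (m + b * \<mu>) x"
    if h: "on_osphere \<kappa> n m (hyperplane_reflection a b x)" for x
  proof (cases x)
    case None
    then show ?thesis using h by (simp add: on_osphere_def hyperplane_reflection_def)
  next
    case (Some y)
    define \<tau> where "\<tau> = 2 * (a \<bullet> y - b) / (a \<bullet> a)"
    have \<tau>: "\<tau> * (a \<bullet> a) = 2 * (a \<bullet> y - b)" using aa by (simp add: \<tau>_def)
    have yy: "(y - \<tau> *\<^sub>R a) \<bullet> (y - \<tau> *\<^sub>R a) = y \<bullet> y + \<tau> * (\<tau> * (a \<bullet> a) - 2 * (a \<bullet> y))"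
      by (simp add: inner_diff_left inner_diff_right inner_commute[of y a] algebra_simps)
    have "on_sphere \<kappa> n m (y - \<tau> *\<^sub>R a)"
      using h Some by (simp add: on_osphere_def hyperplane_reflection_def \<tau>_def)
    then have "\<kappa> * (y \<bullet> y + \<tau> * (- 2 * b)) + n \<bullet> y - \<tau> * (n \<bullet> a) + m = 0"
      unfolding on_sphere_def yy \<tau> by (simp add: inner_diff_right)
    moreover have "\<tau> * (2 * b * \<kappa> + n \<bullet> a) = \<mu> * (a \<bullet> y - b)"
      by (simp add: \<tau>_def \<mu>_def algebra_simps add_divide_distrib diff_divide_distrib)
    ultimately show ?thesis
      by (simp add: Some on_osphere_def on_sphere_def inner_diff_left algebra_simps)
  qed
  show ?thesis
    using * d assms(2) by (intro exI[of _ \<kappa>] exI[of _ "n - \<mu> *\<^sub>R a"] exI[of _ "m + b * \<mu>"]) simp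
qed

text \<open>Meant for the hyperplane of imaginary quaternions: a transformation that moves
  \<open>Phi A B C\<close> into it forces this surface onto a sphere or hyperplane.\<close>

lemma on_osphere_moebius:
  fixes M :: "'a::euclidean_space option \<Rightarrow> 'a option"
  assumes "moebius M" "n \<bullet> n - 4 * \<kappa> * m > 0"
  shows "\<exists>\<kappa>' n' m'. n' \<bullet> n' - 4 * \<kappa>' * m' > 0 \<and>
    (\<forall>x. on_osphere \<kappa> n m (M x) \<longrightarrow> on_osphere \<kappa>' n' m' x)"
  using assms
proof (induction arbitrary: \<kappa> n m rule: moebius.induct)
  case moebius_id
  then show ?case by (metis id_apply)
next
  case (moebius_inversion f r c)
  obtain \<kappa>' n' m' where 1: "n' \<bullet> n' - 4 * \<kappa>' * m' > 0"
    "\<And>x. on_osphere \<kappa> n m (sphere_inversion c r x) \<Longrightarrow> on_osphere \<kappa>' n' m' x"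
    using on_osphere_inversion[OF moebius_inversion.hyps(2) moebius_inversion.prems] by metis
  show ?case using moebius_inversion.IH[OF 1(1)] 1(2) unfolding comp_apply by blast
next
  case (moebius_reflection f a b)
  obtain \<kappa>' n' m' where 1: "n' \<bullet> n' - 4 * \<kappa>' * m' > 0"
    "\<And>x. on_osphere \<kappa> n m (hyperplane_reflection a b x) \<Longrightarrow> on_osphere \<kappa>' n' m' x"
    using on_osphere_reflection[OF moebius_reflection.hyps(2) moebius_reflection.prems] by metis
  show ?case using moebius_reflection.IH[OF 1(1)] 1(2) unfolding comp_apply by blast
qed

section \<open>Extension of partial isometries\<close>

text \<open>Points are matched one at a time. If the isometry so far misses the next target, it is
  followed by the reflection in the perpendicular bisector of its value and the target; earlier
  targets are equidistant from both and stay fixed. Linearity of \<open>L\<close> is recorded for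
  \<open>affine_equidistant\<close>.\<close>

lemma isometry_extension_finite:
  fixes f g :: "'p \<Rightarrow> 'a::euclidean_space"
  assumes "finite F" "\<And>s t. s \<in> F \<Longrightarrow> t \<in> F \<Longrightarrow> dist (g s) (g t) = dist (f s) (f t)"
  shows "\<exists>L b. linear L \<and> (\<forall>x y. dist (L x + b) (L y + b) = dist x y) \<and>
           moebius (map_option (\<lambda>x. L x + b)) \<and> (\<forall>t\<in>F. L (f t) + b = g t)"
  using assms
proof (induction F rule: finite_induct)
  case empty
  have "map_option (\<lambda>x::'a. x) = id" by (simp add: fun_eq_iff option.map_ident)
  then have "moebius (map_option (\<lambda>x::'a. x))" using moebius_id by simp
  then show ?case by (intro exI[of _ "\<lambda>x. x"] exI[of _ 0]) (simp add: linear_id[unfolded id_def])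
next
  case (insert t F)
  obtain L b where L: "linear L" and iso: "\<And>x y. dist (L x + b) (L y + b) = dist x y"
    and mo: "moebius (map_option (\<lambda>x. L x + b))" and ag: "\<And>u. u \<in> F \<Longrightarrow> L (f u) + b = g u"
    using insert.IH insert.prems by auto
  show ?case
  proof (cases "L (f t) + b = g t")
    case True
    then show ?thesis using L iso mo ag by blast
  next
    case False
    define y z where yz: "y = L (f t) + b" "z = g t"
    define a where "a = y - z"
    \<comment> \<open>The hyperplane \<open>a \<bullet> x = k\<close> is the perpendicular bisector
      of \<open>y\<close> and \<open>z\<close>.\<close>
    define k where "k = (y \<bullet> y - z \<bullet> z) / 2"
    define R where "R x = x - (2 * (a \<bullet> x - k) / (a \<bullet> a)) *\<^sub>R a" for x
    have a: "a \<noteq> 0" using False by (simp add: a_def yz)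
    have k2: "2 * k = y \<bullet> y - z \<bullet> z" by (simp add: k_def)
    define L' where "L' x = L x - (2 * (a \<bullet> L x) / (a \<bullet> a)) *\<^sub>R a" for x
    have RL: "R (L x + b) = L' x + R b" for x
      by (simp add: R_def L'_def inner_add_right algebra_simps diff_divide_distrib add_divide_distrib)
    have "linear L'"
      unfolding L'_def
      by (intro linearI)
         (simp_all add: linear_add[OF L] linear_scale[OF L] inner_add_right algebra_simps add_divide_distrib)
    moreover have "dist (L' x + R b) (L' x' + R b) = dist x x'" for x x'
      unfolding RL[symmetric] unfolding R_def dist_reflection[OF a] iso ..
    moreover have "moebius (map_option (\<lambda>x. L' x + R b))"
    proof -
      have "hyperplane_reflection a k = map_option R"
        by (simp only: hyperplane_reflection_def R_def[abs_def])
      then have "map_option (\<lambda>x. L' x + R b) = hyperplane_reflection a k \<circ> map_option (\<lambda>x. L x + b)"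
        by (simp add: RL[symmetric] fun_eq_iff option.map_comp comp_def)
      then show ?thesis using moebius_reflection[OF mo a] by simp
    qed
    moreover have "L' (f t) + R b = g t"
    proof -
      have "2 * (a \<bullet> y - k) = a \<bullet> a"
        using k2 by (simp add: a_def inner_diff_left inner_diff_right inner_commute[of z y])
      then have "R y = g t"
        using a by (simp add: R_def) (simp add: a_def yz)
      then show ?thesis by (simp add: RL[symmetric] yz)
    qed
    moreover have "L' (f u) + R b = g u" if "u \<in> F" for u
    proof -
      have "dist (g u) y = dist (g u) z"
        using iso[of "f u" "f t"] insert.prems[of u t] ag[OF that] that by (simp add: yz)
      then have "(g u - y) \<bullet> (g u - y) = (g u - z) \<bullet> (g u - z)"
        by (simp add: dist_norm norm_eq)
      then have "a \<bullet> g u - k = 0"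
        using k2 by (simp add: a_def inner_diff_left inner_diff_right inner_commute[of y "g u"] inner_commute[of z "g u"])
      then have "R (g u) = g u" by (simp add: R_def)
      then show ?thesis using ag[OF that] RL by metis
    qed
    ultimately show ?thesis
      by (intro exI[of _ L'] exI[of _ "R b"]) auto
  qed
qed

lemma affine_equidistant:
  fixes y z :: "'a::euclidean_space"
  assumes L: "linear L"
  shows "affine {x. dist (L x + b) y = dist (L x + b) z}"
proof -
  have e: "dist w y = dist w z \<longleftrightarrow> w \<bullet> (z - y) = (z \<bullet> z - y \<bullet> y) / 2" for w :: 'a
    by (auto simp: dist_norm norm_eq inner_diff_left inner_diff_right inner_commute[of y w] inner_commute[of z w])
  show ?thesis
    unfolding affine_def e
  proof (intro ballI allI impI)
    fix p q u v
    assume *: "p \<in> {x. (L x + b) \<bullet> (z - y) = (z \<bullet> z - y \<bullet> y) / 2}"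
      "q \<in> {x. (L x + b) \<bullet> (z - y) = (z \<bullet> z - y \<bullet> y) / 2}" "u + v = (1::real)"
    have "L (u *\<^sub>R p + v *\<^sub>R q) + b = u *\<^sub>R (L p + b) + v *\<^sub>R (L q + b)"
      using *(3) by (simp add: linear_add[OF L] linear_scale[OF L] scaleR_add_right scaleR_add_left[symmetric])
    then have "(L (u *\<^sub>R p + v *\<^sub>R q) + b) \<bullet> (z - y) = u * ((z \<bullet> z - y \<bullet> y) / 2) + v * ((z \<bullet> z - y \<bullet> y) / 2)"
      using * by (simp only: inner_add_left inner_scaleR_left mem_Collect_eq)
    also have "\<dots> = (z \<bullet> z - y \<bullet> y) / 2"
      using *(3) by (simp only: distrib_right[symmetric] mult_1)
    finally show "u *\<^sub>R p + v *\<^sub>R q \<in> {x. (L x + b) \<bullet> (z - y) = (z \<bullet> z - y \<bullet> y) / 2}" by simp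
  qed
qed

text \<open>An affine basis of the image is finite, so the finite case applies to it. The points
  whose images are equidistant from the two candidate values at \<open>t\<close> form an affine set
  containing this basis, hence also \<open>f t\<close>; there one distance is 0, so the candidates
  coincide.\<close>

lemma isometry_extension:
  fixes f g :: "'p \<Rightarrow> 'a::euclidean_space"
  assumes iso: "\<And>s t. s \<in> T \<Longrightarrow> t \<in> T \<Longrightarrow> dist (g s) (g t) = dist (f s) (f t)"
  shows "\<exists>L b. moebius (map_option (\<lambda>x. L x + b)) \<and> (\<forall>t\<in>T. L (f t) + b = g t)"
proof -
  obtain B where B: "B \<subseteq> f ` T" "\<not> affine_dependent B" "affine hull (f ` T) = affine hull B"
    using affine_basis_exists by blast
  obtain F where F: "F \<subseteq> T" "finite F" "B = f ` F"
    using B aff_independent_finite finite_subset_image by metis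
  obtain L b where L: "linear L" and d: "\<And>x y. dist (L x + b) (L y + b) = dist x y"
    and mo: "moebius (map_option (\<lambda>x. L x + b))" and ag: "\<And>u. u \<in> F \<Longrightarrow> L (f u) + b = g u"
    using isometry_extension_finite[OF F(2), of g f] iso F(1) by blast
  have "L (f t) + b = g t" if t: "t \<in> T" for t
  proof -
    let ?E = "{x. dist (L x + b) (L (f t) + b) = dist (L x + b) (g t)}"
    have "f ` F \<subseteq> ?E"
    proof clarsimp
      fix u assume u: "u \<in> F"
      have "dist (g u) (g t) = dist (f u) (f t)" using u t F(1) iso by blast
      moreover have "dist (L (f u)) (L (f t)) = dist (f u) (f t)"
        using d[of "f u" "f t"] by (simp only: dist_add_cancel2)
      ultimately show "dist (L (f u)) (L (f t)) = dist (L (f u) + b) (g t)"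
        using ag[OF u] by simp
    qed
    then have "affine hull B \<subseteq> ?E"
      unfolding F(3) by (intro hull_minimal affine_equidistant L)
    moreover have "f t \<in> affine hull B"
      using t B(3) hull_subset[of "f ` T" affine] by auto
    ultimately show ?thesis by (auto simp: dist_commute)
  qed
  then show ?thesis using mo by blast
qed

lemma moebius_scaling:
  fixes \<sigma> :: real
  assumes "\<sigma> > 0"
  shows "moebius (map_option (\<lambda>x::'a::euclidean_space. \<sigma> *\<^sub>R x))"
proof -
  have "map_option (\<lambda>x::'a. \<sigma> *\<^sub>R x) = sphere_inversion 0 (sqrt \<sigma>) \<circ> (sphere_inversion 0 1 \<circ> id)"
  proof
    fix x :: "'a option"
    show "map_option (\<lambda>x. \<sigma> *\<^sub>R x) x = (sphere_inversion 0 (sqrt \<sigma>) \<circ> (sphere_inversion 0 1 \<circ> id)) x"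
      using assms by (cases x) (auto simp: sphere_inversion_def power_divide power_mult_distrib power2_eq_square)
  qed
  moreover have "moebius (sphere_inversion 0 (sqrt \<sigma>) \<circ> (sphere_inversion (0::'a) 1 \<circ> id))"
    using assms by (intro moebius_inversion moebius_id) simp_all
  ultimately show ?thesis by simp
qed

lemma sphere_inversion_involution:
  "y \<noteq> c \<Longrightarrow> sphere_inversion c 1 (sphere_inversion c 1 (Some y)) = Some y"
  by (simp add: sphere_inversion_def dist_norm power_divide power2_eq_square)

text \<open>After inversions centred at two corresponding points, a conformal equivalence becomes a
  similarity.\<close>

lemma moebius_image_of_conf_eq:
  fixes g h :: "'p \<Rightarrow> 'a::euclidean_space"
  assumes "conf_eq D h g"
  shows "moebius_image_of (g ` D) (h ` D)"
proof (cases "D = {}")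
  case True
  then show ?thesis unfolding moebius_image_of_def using moebius_id by auto
next
  case False
  then obtain c where c: "c \<in> D" by blast
  obtain \<rho> where r: "\<And>s. s \<in> D \<Longrightarrow> \<rho> s > 0"
    and d: "\<And>s t. s \<in> D \<Longrightarrow> t \<in> D \<Longrightarrow> dist (g s) (g t) = \<rho> s * \<rho> t * dist (h s) (h t)"
    using assms unfolding conf_eq_def by blast
  \<comment> \<open>The image of \<open>f p\<close> under the unit inversion at \<open>f c\<close>,
    meaningful where \<open>f p\<close> differs from \<open>f c\<close>.\<close>
  define J where "J f p = f c + (1 / dist (f p) (f c))\<^sup>2 *\<^sub>R (f p - f c)" for f :: "'p \<Rightarrow> 'a" and p
  define T where "T = {p \<in> D. h p \<noteq> h c}"
  \<comment> \<open>Dividing \<open>\<rho> s * \<rho> t\<close> by the factors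
    \<open>\<rho> s * \<rho> c\<close> and \<open>\<rho> t * \<rho> c\<close> from the inversion
    formula leaves this constant.\<close>
  define \<sigma> where "\<sigma> = 1 / (\<rho> c)\<^sup>2"
  have \<sigma>: "\<sigma> > 0" using r[OF c] by (simp add: \<sigma>_def)
  have g_eq: "g p = g c \<longleftrightarrow> h p = h c" if "p \<in> D" for p
  proof -
    have "dist (g p) (g c) = 0 \<longleftrightarrow> dist (h p) (h c) = 0"
      using d[OF that c] r[OF that] r[OF c] by auto
    then show ?thesis by simp
  qed
  have "dist (J g s) (J g t) = dist (\<sigma> *\<^sub>R J h s) (\<sigma> *\<^sub>R J h t)" if st: "s \<in> T" "t \<in> T" for s t
  proof -
    have D: "s \<in> D" "t \<in> D" "h s \<noteq> h c" "h t \<noteq> h c" "g s \<noteq> g c" "g t \<noteq> g c"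
      using st g_eq by (auto simp: T_def)
    have *: "dist (J f s) (J f t) = 1 / (dist (f s) (f c) * dist (f t) (f c)) * dist (f s) (f t)"
      if "f s \<noteq> f c" "f t \<noteq> f c" for f
      using dist_inversion[OF that, of 1] by (simp only: J_def one_power2)
    have d0: "dist (h s) (h c) \<noteq> 0" "dist (h t) (h c) \<noteq> 0" using D by auto
    have ds: "dist (\<sigma> *\<^sub>R x) (\<sigma> *\<^sub>R y) = \<sigma> * dist x y" for x y :: 'a
      using \<sigma> by (simp add: dist_norm scaleR_diff_right[symmetric])
    show ?thesis
      using r[OF D(1)] r[OF D(2)] r[OF c] d0
      unfolding *[of g, OF D(5,6)] ds *[of h, OF D(3,4)] d[OF D(1,2)] d[OF D(1) c] d[OF D(2) c]
      by (simp add: \<sigma>_def field_simps power2_eq_square)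
  qed
  then obtain L b where mo: "moebius (map_option (\<lambda>x. L x + b))"
    and ag: "\<And>t. t \<in> T \<Longrightarrow> L (\<sigma> *\<^sub>R J h t) + b = J g t"
    using isometry_extension[of T "J g" "\<lambda>t. \<sigma> *\<^sub>R J h t"] by blast
  \<comment> \<open>Inversion at \<open>h c\<close>, scaling, isometry, inversion at
    \<open>g c\<close>; points with \<open>h p = h c\<close> travel through infinity.\<close>
  define M where "M = (sphere_inversion (g c) 1 \<circ> id) \<circ> (map_option (\<lambda>x. L x + b) \<circ>
    (map_option (\<lambda>x. \<sigma> *\<^sub>R x) \<circ> (sphere_inversion (h c) 1 \<circ> id)))"
  have "moebius M"
    unfolding M_def by (intro moebius_comp mo moebius_scaling \<sigma> moebius_inversion moebius_id) auto
  moreover have "M (Some (h p)) = Some (g p)" if p: "p \<in> D" for p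
  proof (cases "h p = h c")
    case True
    then show ?thesis using g_eq[OF p] by (simp add: M_def sphere_inversion_def)
  next
    case False
    have *: "sphere_inversion (f c) 1 (Some (f p)) = Some (J f p)" if "f p \<noteq> f c" for f
      using that by (simp add: sphere_inversion_def J_def)
    have pT: "p \<in> T" using p False by (simp add: T_def)
    have gp: "g p \<noteq> g c" using False g_eq[OF p] by simp
    have "M (Some (h p)) = sphere_inversion (g c) 1 (Some (J g p))"
      using *[of h, OF False] ag[OF pT] by (simp add: M_def)
    also have "\<dots> = Some (g p)"
      unfolding *[of g, OF gp, symmetric] using sphere_inversion_involution[OF gp] .
    finally show ?thesis .
  qed
  then have "Some ` g ` D = M ` Some ` h ` D"
    unfolding image_image by (intro image_cong) auto
  ultimately show ?thesis unfolding moebius_image_of_def by blast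
qed

section \<open>Quaternions, circles and generic directions\<close>

lemma im_part_nth [simp]: "im_part q $ 1 = qi q" "im_part q $ 2 = qj q" "im_part q $ 3 = qk q"
  by (simp_all add: im_part_def)

lemma im_quat_im_part: "qre q = 0 \<Longrightarrow> im_quat (im_part q) = q"
  by (simp add: im_quat_def quat_eq_iff)

lemma im_part_im_quat [simp]: "im_part (im_quat x) = x"
  by (simp add: vec_eq_iff forall_3 im_quat_def)

lemma qre_im_quat [simp]: "qre (im_quat x) = 0"
  by (simp add: im_quat_def)

lemma linear_im_part: "linear im_part"
  by (rule linearI) (simp_all add: vec_eq_iff forall_3)

lemma linear_im_quat: "linear im_quat"
  by (rule linearI) (simp_all add: im_quat_def quat_eq_iff)

lemma inner_im_part: "im_part x \<bullet> im_part y = x \<bullet> y - qre x * qre y"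
  by (simp add: inner_vec_def sum_3 inner_quat_def)

lemma inner_im_quat: "im_quat x \<bullet> im_quat y = x \<bullet> y"
  by (simp add: inner_vec_def sum_3 inner_quat_def im_quat_def)

lemma dist_im_part: "qre x = qre y \<Longrightarrow> dist (im_part x) (im_part y) = dist x y"
  by (simp add: dist_norm norm_eq linear_diff[OF linear_im_part, symmetric] inner_im_part)

lemma dist_im_quat: "dist (im_quat x) (im_quat y) = dist x y"
  by (simp add: dist_norm norm_eq linear_diff[OF linear_im_quat, symmetric] inner_im_quat)

lemma conf_eq_im_part:
  assumes "\<And>s. s \<in> D \<Longrightarrow> qre (f s) = 0"
  shows "conf_eq D f (\<lambda>s. im_part (f s))"
  by (rule conf_eq_similar[of 1]) (simp_all add: dist_im_part assms)

lemma linear_quat_cnj: "linear quat_cnj"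
  by (rule linearI) (simp_all add: quat_cnj_def quat_eq_iff)

lemma inner_quat_cnj: "quat_cnj x \<bullet> quat_cnj y = x \<bullet> y"
  by (simp add: quat_cnj_def inner_quat_def)

lemma quat_cnj_0 [simp]: "quat_cnj x = 0 \<longleftrightarrow> x = 0"
  by (auto simp: quat_cnj_def quat_eq_iff)

lemma conf_eq_quat_cnj: "conf_eq D f (\<lambda>s. quat_cnj (f s))"
  by (rule conf_eq_similar[of 1])
     (simp_all add: dist_norm norm_eq linear_diff[OF linear_quat_cnj, symmetric] inner_quat_cnj)

lemma quat_cnj_inverse: "quat_cnj (inverse x) = inverse (quat_cnj x)"
  by (simp add: quat_cnj_def inverse_quat_def quat_eq_iff)

lemma circle_param:
  fixes c v w :: "'a::euclidean_space"
  assumes "v \<bullet> w = 0" "norm v = r" "norm w = r" "r > 0"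
  shows "circle {c + a *\<^sub>R v + b *\<^sub>R w | a b. a\<^sup>2 + b\<^sup>2 = 1}"
proof -
  have vw: "v \<noteq> 0" "w \<noteq> 0" "v \<bullet> v = r\<^sup>2" "w \<bullet> w = r\<^sup>2"
    using assms by (auto simp: dot_square_norm)
  have "v \<noteq> w" using vw assms by auto
  have "pairwise orthogonal {v, w}"
    using assms(1) by (auto simp: pairwise_def orthogonal_def inner_commute)
  then have "independent {v, w}" by (rule pairwise_orthogonal_independent) (use vw in auto)
  then have dim: "dim (span {v, w}) = 2"
    using \<open>v \<noteq> w\<close> by (simp add: dim_eq_card_independent)
  let ?P = "(+) c ` span {v, w}"
  have P: "?P = {c + (a *\<^sub>R v + b *\<^sub>R w) | a b. True}"
    by (auto simp: span_insert span_singleton image_iff) (metis add_diff_cancel_left' diff_add_cancel)+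
  have n: "norm (a *\<^sub>R v + b *\<^sub>R w) = r \<longleftrightarrow> a\<^sup>2 + b\<^sup>2 = 1" for a b
  proof -
    have "(norm (a *\<^sub>R v + b *\<^sub>R w))\<^sup>2 = (a\<^sup>2 + b\<^sup>2) * r\<^sup>2"
      unfolding power2_norm_eq_inner using assms(1) vw
      by (simp add: inner_add_left inner_add_right inner_commute[of w v] algebra_simps power2_eq_square)
    moreover have "norm (a *\<^sub>R v + b *\<^sub>R w) = r \<longleftrightarrow> (norm (a *\<^sub>R v + b *\<^sub>R w))\<^sup>2 = r\<^sup>2"
      using assms(4) by (simp add: power2_eq_iff_nonneg)
    ultimately show ?thesis using assms(4) by auto
  qed
  have "{c + a *\<^sub>R v + b *\<^sub>R w | a b. a\<^sup>2 + b\<^sup>2 = 1} = ?P \<inter> sphere c r"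
  proof -
    have "dist c (c + x) = norm x" for x by (simp add: dist_norm)
    then show ?thesis unfolding P by (auto simp: n add.assoc ) blast
  qed
  moreover have "affine ?P"
    using affine_translation subspace_imp_affine subspace_span by blast
  moreover have "aff_dim ?P = 2"
    by (simp only: aff_dim_translation_eq aff_dim_subspace[OF subspace_span] dim of_nat_numeral)
  moreover have "c \<in> ?P" using span_0 by force
  ultimately show ?thesis unfolding circle_def using assms(4) by blast
qed

text \<open>Two parameters cannot fill R^3; this later refutes a determinant that vanishes
  identically.\<close>

lemma negligible_fraction:
  fixes f g :: "real \<times> real \<Rightarrow> quat"
  assumes "f differentiable_on UNIV" "g differentiable_on UNIV"
  shows "negligible ((\<lambda>p. im_part (inverse (f p) * g p)) ` {p. f p \<noteq> 0})"
proof (rule negligible_differentiable_image_lowdim)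
  show "(\<lambda>p. im_part (inverse (f p) * g p)) differentiable_on {p. f p \<noteq> 0}"
    unfolding differentiable_on_def
  proof
    fix p assume p: "p \<in> {p. f p \<noteq> 0}"
    obtain f' g' where d: "(f has_derivative f') (at p)" "(g has_derivative g') (at p)"
      using assms unfolding differentiable_on_def differentiable_def by blast
    have "\<exists>d. ((\<lambda>p. inverse (f p) * g p) has_derivative d) (at p)"
      using p has_derivative_mult[OF Deriv.has_derivative_inverse[OF _ d(1)] d(2)] by blast
    then have "(\<lambda>p. inverse (f p) * g p) differentiable (at p)" by (simp add: differentiable_def)
    then have "(im_part \<circ> (\<lambda>p. inverse (f p) * g p)) differentiable (at p)"
      by (rule differentiable_chain_at[OF _ linear_imp_differentiable[OF linear_im_part]])
    then show "(\<lambda>p. im_part (inverse (f p) * g p)) differentiable (at p within {p. f p \<noteq> 0})"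
      by (simp add: comp_def differentiable_at_withinI)
  qed
qed simp

text \<open>The cone over the surface is the image of a three-dimensional domain and the line
  through \<open>z\<close> of a one-dimensional one, so together they form a null set in R^4 and
  miss some direction. It will be the pole of a stereographic projection.\<close>

lemma exists_missed_direction:
  fixes f :: "real \<times> real \<Rightarrow> quat" and z :: quat
  assumes "f differentiable_on D" "open D"
  obtains e where "norm e = 1" "\<And>p r. p \<in> D \<Longrightarrow> r > 0 \<Longrightarrow> f p \<noteq> r *\<^sub>R e"
    "\<And>r. r > 0 \<Longrightarrow> z \<noteq> r *\<^sub>R e"
proof -
  let ?F = "\<lambda>(t::real, p). t *\<^sub>R f p"
  let ?G = "\<lambda>t::real. t *\<^sub>R z"
  have "?F differentiable_on (UNIV \<times> D)"
    unfolding differentiable_on_def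
  proof
    fix x assume x: "x \<in> (UNIV :: real set) \<times> D"
    then have D: "snd x \<in> D" by (simp add: mem_Times_iff)
    then have "f differentiable (at (snd x) within D)"
      using assms(1) unfolding differentiable_on_def by blast
    then have "f differentiable (at (snd x))"
      using at_within_open[OF D assms(2)] by simp
    then have "(f \<circ> snd) differentiable (at x)"
      by (rule differentiable_chain_at[OF bounded_linear_imp_differentiable[OF bounded_linear_snd]])
    then have "(\<lambda>x. fst x *\<^sub>R (f \<circ> snd) x) differentiable (at x)"
      by (rule differentiable_scaleR[OF bounded_linear_imp_differentiable[OF bounded_linear_fst]])
    then show "?F differentiable (at x within UNIV \<times> D)"
      by (simp add: case_prod_unfold differentiable_at_withinI)
  qed
  then have "negligible (?F ` (UNIV \<times> D))"
    by (intro negligible_differentiable_image_lowdim) simp_all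
  moreover have "negligible (?G ` UNIV)"
    by (intro negligible_differentiable_image_lowdim linear_imp_differentiable_on)
       (simp_all add: linear_iff scaleR_add_left)
  ultimately have "negligible (?F ` (UNIV \<times> D) \<union> ?G ` UNIV)" by (rule negligible_Un)
  then obtain y where y: "y \<notin> ?F ` (UNIV \<times> D)" "y \<notin> ?G ` UNIV"
    using non_negligible_UNIV by (metis UNIV_eq_I UnI1 UnI2)
  have y0: "y \<noteq> 0" using y(2) by (metis rangeI scaleR_zero_left)
  show ?thesis
  proof (rule that[of "y /\<^sub>R norm y"])
    show "norm (y /\<^sub>R norm y) = 1" using y0 by simp
    have *: "y = (norm y / r) *\<^sub>R w" if "w = r *\<^sub>R (y /\<^sub>R norm y)" "r > 0" for w r
      using that y0 by simp
    show "f p \<noteq> r *\<^sub>R (y /\<^sub>R norm y)" if "p \<in> D" "r > 0" for p r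
    proof
      assume "f p = r *\<^sub>R (y /\<^sub>R norm y)"
      then have "y = ?F (norm y / r, p)" using *[of "f p" r] that by simp
      then show False using y(1) that(1) by blast
    qed
    show "z \<noteq> r *\<^sub>R (y /\<^sub>R norm y)" if "r > 0" for r
      using *[of z r] that y(2) by blast
  qed
qed

section \<open>Darboux forms\<close>

text \<open>Darboux cyclides are the quadric sections of the paraboloid \<open>x \<mapsto> (x, \<bar>x\<bar>\<^sup>2)\<close>, so their
  equations are the quadratic forms in the vector \<open>(1, x, \<bar>x\<bar>\<^sup>2)\<close>.\<close>

definition lift3 :: "real ^ 3 \<Rightarrow> real \<times> (real ^ 3) \<times> real" where
  "lift3 x = (1, x, x \<bullet> x)"

text \<open>Existence of a linear map replaces a list of coefficients, so that closure under linear
  operations needs no coordinates; these appear in \<open>darboux_cyclide_form\<close>.\<close>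

definition lin_lift :: "(real ^ 3 \<Rightarrow> 'a::real_vector) \<Rightarrow> bool" where
  "lin_lift f \<longleftrightarrow> (\<exists>\<Lambda>. linear \<Lambda> \<and> (\<forall>x. f x = \<Lambda> (lift3 x)))"

definition darboux_form :: "(real ^ 3 \<Rightarrow> real) \<Rightarrow> bool" where
  "darboux_form G \<longleftrightarrow> (\<exists>B. bilinear B \<and> (\<forall>x. G x = B (lift3 x) (lift3 x)))"

lemma lin_lift_const: "lin_lift (\<lambda>x. c)"
  unfolding lin_lift_def
  by (rule exI[of _ "\<lambda>(s, y, t). s *\<^sub>R c"]) (auto simp: lift3_def linear_iff scaleR_add_left)

lemma lin_lift_linear:
  assumes "linear L" shows "lin_lift (\<lambda>x. L x)"
  unfolding lin_lift_def
  by (rule exI[of _ "\<lambda>(s, y, t). L y"])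
     (auto simp: lift3_def linear_iff linear_add[OF assms] linear_scale[OF assms])

lemma lin_lift_sq: "lin_lift (\<lambda>x. x \<bullet> x)"
  unfolding lin_lift_def
  by (rule exI[of _ "\<lambda>(s, y, t). t"]) (auto simp: lift3_def linear_iff)

lemma lin_lift_compose:
  assumes "linear L" "lin_lift f" shows "lin_lift (\<lambda>x. L (f x))"
proof -
  obtain \<Lambda> where L: "linear \<Lambda>" "\<And>x. f x = \<Lambda> (lift3 x)"
    using assms(2) unfolding lin_lift_def by blast
  show ?thesis
    unfolding lin_lift_def L(2)
    by (rule exI[of _ "L \<circ> \<Lambda>"]) (simp add: linear_compose[OF L(1) assms(1)])
qed

lemma lin_lift_add:
  assumes "lin_lift f" "lin_lift g" shows "lin_lift (\<lambda>x. f x + g x)"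
proof -
  obtain \<Lambda> \<Lambda>' where L: "linear \<Lambda>" "\<And>x. f x = \<Lambda> (lift3 x)" "linear \<Lambda>'" "\<And>x. g x = \<Lambda>' (lift3 x)"
    using assms unfolding lin_lift_def by blast
  show ?thesis
    unfolding lin_lift_def L(2,4)
    by (rule exI[of _ "\<lambda>x. \<Lambda> x + \<Lambda>' x"]) (simp add: linear_compose_add[OF L(1,3)])
qed

lemma lin_lift_minus: "lin_lift f \<Longrightarrow> lin_lift (\<lambda>x. - f x)"
  by (rule lin_lift_compose[of uminus]) (simp_all add: linear_iff)

lemma lin_lift_diff:
  "lin_lift f \<Longrightarrow> lin_lift g \<Longrightarrow> lin_lift (\<lambda>x. f x - g x)"
  using lin_lift_add[of f "\<lambda>x. - g x"] lin_lift_minus[of g] by simp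

lemma lin_lift_scaleR: "lin_lift f \<Longrightarrow> lin_lift (\<lambda>x. f x *\<^sub>R c)"
  by (rule lin_lift_compose[of "\<lambda>t. t *\<^sub>R c"]) (simp_all add: linear_iff scaleR_add_left)

lemma lin_lift_mult:
  fixes f :: "real ^ 3 \<Rightarrow> 'a::real_algebra"
  shows "lin_lift f \<Longrightarrow> lin_lift (\<lambda>x. a * f x * b)"
  by (rule lin_lift_compose[of "\<lambda>y. a * y * b"]) (simp_all add: linear_iff algebra_simps)

lemma darboux_form_bilinear:
  assumes "bilinear \<beta>" "lin_lift f" "lin_lift g"
  shows "darboux_form (\<lambda>x. \<beta> (f x) (g x))"
proof -
  obtain \<Lambda> \<Lambda>' where L: "linear \<Lambda>" "\<And>x. f x = \<Lambda> (lift3 x)" "linear \<Lambda>'" "\<And>x. g x = \<Lambda>' (lift3 x)"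
    using assms unfolding lin_lift_def by blast
  have "bilinear (\<lambda>y z. \<beta> (\<Lambda> y) (\<Lambda>' z))"
    unfolding bilinear_def linear_iff
    using assms(1) L(1,3)
    by (simp add: linear_add linear_scale bilinear_ladd bilinear_radd bilinear_lmul bilinear_rmul)
  then show ?thesis unfolding darboux_form_def L(2,4) by blast
qed

lemma darboux_form_add:
  assumes "darboux_form f" "darboux_form g" shows "darboux_form (\<lambda>x. f x + g x)"
proof -
  obtain B B' where L: "bilinear B" "\<And>x. f x = B (lift3 x) (lift3 x)"
    "bilinear B'" "\<And>x. g x = B' (lift3 x) (lift3 x)"
    using assms unfolding darboux_form_def by blast
  have "bilinear (\<lambda>y z. B y z + B' y z)"
    using L(1,3) unfolding bilinear_def by (simp add: linear_compose_add)
  then show ?thesis unfolding darboux_form_def L(2,4) by blast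
qed

lemma darboux_form_minus:
  assumes "darboux_form f" shows "darboux_form (\<lambda>x. - f x)"
proof -
  obtain B where L: "bilinear B" "\<And>x. f x = B (lift3 x) (lift3 x)"
    using assms unfolding darboux_form_def by blast
  have "bilinear (\<lambda>y z. - B y z)"
    using L(1) unfolding bilinear_def by (simp add: linear_compose_neg)
  then show ?thesis unfolding darboux_form_def L(2) by blast
qed

lemma darboux_form_diff:
  "darboux_form f \<Longrightarrow> darboux_form g \<Longrightarrow> darboux_form (\<lambda>x. f x - g x)"
  using darboux_form_add[of f "\<lambda>x. - g x"] darboux_form_minus[of g] by simp

lemma bilinear_inner: "bilinear (\<lambda>x y :: 'a::real_inner. x \<bullet> y)"
  by (simp add: bilinear_def linear_iff inner_add_left inner_add_right)

lemma bilinear_times: "bilinear (\<lambda>x y :: 'a::real_algebra. x * y)"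
  by (simp add: bilinear_def linear_iff algebra_simps)

lemma darboux_form_lin_lift:
  assumes "lin_lift f" shows "darboux_form f"
  using darboux_form_bilinear[OF bilinear_times assms lin_lift_const[of "1::real"]] by simp

section \<open>Coefficients of the equation of a Darboux cyclide\<close>

lemma eval3_superset:
  assumes "finite K" "Poly_Mapping.keys Q \<subseteq> K"
  shows "eval3 Q x y z = (\<Sum>(i, j, k)\<in>K. Poly_Mapping.lookup Q (i, j, k) * x ^ i * y ^ j * z ^ k)"
  unfolding eval3_def using assms
  by (intro sum.mono_neutral_left) (auto simp: in_keys_iff)

lemma eval3_add: "eval3 (P + Q) x y z = eval3 P x y z + eval3 Q x y z"
proof -
  let ?K = "Poly_Mapping.keys P \<union> Poly_Mapping.keys Q"
  have "Poly_Mapping.keys (P + Q) \<subseteq> ?K" by (rule Poly_Mapping.keys_add)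
  then show ?thesis
    by (subst (1 2 3) eval3_superset[of ?K])
       (auto simp: lookup_add algebra_simps sum.distrib[symmetric] intro!: sum.cong)
qed

lemma eval3_single: "eval3 (Poly_Mapping.single (i, j, k) a) x y z = a * x ^ i * y ^ j * z ^ k"
  by (subst eval3_superset[of "{(i, j, k)}"]) (auto simp: in_keys_iff lookup_single)

lemma eval3_0: "eval3 0 x y z = 0"
  by (simp add: eval3_def)

definition deg_le2 :: "((nat \<times> nat \<times> nat) \<Rightarrow>\<^sub>0 real) \<Rightarrow> bool" where
  "deg_le2 Q \<longleftrightarrow> (\<forall>(i, j, k)\<in>Poly_Mapping.keys Q. i + j + k \<le> 2)"

lemma deg_le2_add: "deg_le2 P \<Longrightarrow> deg_le2 Q \<Longrightarrow> deg_le2 (P + Q)"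
  unfolding deg_le2_def using Poly_Mapping.keys_add[of P Q] by blast

lemma deg_le2_single: "i + j + k \<le> 2 \<Longrightarrow> deg_le2 (Poly_Mapping.single (i, j, k) a)"
  unfolding deg_le2_def by simp

lemma lift3_expand:
  "lift3 x = (1, 0, 0) + (x $ 1) *\<^sub>R (0, axis 1 1, 0) + (x $ 2) *\<^sub>R (0, axis 2 1, 0)
     + (x $ 3) *\<^sub>R (0, axis 3 1, 0) + (x \<bullet> x) *\<^sub>R (0, 0, 1)"
  by (simp add: lift3_def vec_eq_iff forall_3 axis_def)

lemma darboux_cyclide_form:
  assumes "darboux_form G" "G x0 \<noteq> 0"
  shows "darboux_cyclide {x. G x = 0}"
proof -
  obtain B where B: "bilinear B" and G: "\<And>x. G x = B (lift3 x) (lift3 x)"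
    using assms(1) unfolding darboux_form_def by blast
  define e0 e1 e2 e3 e4 :: "real \<times> (real ^ 3) \<times> real" where
    e: "e0 = (1, 0, 0)" "e1 = (0, axis 1 1, 0)" "e2 = (0, axis 2 1, 0)"
      "e3 = (0, axis 3 1, 0)" "e4 = (0, 0, 1)"
  let ?s = "Poly_Mapping.single :: nat \<times> nat \<times> nat \<Rightarrow> real \<Rightarrow> _"
  define S where "S u v = B u v + B v u" for u v
  \<comment> \<open>The product of the first and the last coordinate of \<open>lift3\<close> is
    \<open>x \<bullet> x\<close>, of degree 2; hence \<open>S e0 e4\<close> at each of the three
    squares.\<close>
  define Q where "Q = ?s (0, 0, 0) (B e0 e0) + ?s (1, 0, 0) (S e0 e1) + ?s (0, 1, 0) (S e0 e2)
    + ?s (0, 0, 1) (S e0 e3) + ?s (2, 0, 0) (B e1 e1 + S e0 e4) + ?s (0, 2, 0) (B e2 e2 + S e0 e4)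
    + ?s (0, 0, 2) (B e3 e3 + S e0 e4) + ?s (1, 1, 0) (S e1 e2) + ?s (1, 0, 1) (S e1 e3)
    + ?s (0, 1, 1) (S e2 e3)"
  have deg: "deg_le2 Q"
    unfolding Q_def by (intro deg_le2_add deg_le2_single) simp_all
  have xx: "x \<bullet> x = (x $ 1)\<^sup>2 + (x $ 2)\<^sup>2 + (x $ 3)\<^sup>2" for x :: "real ^ 3"
    by (simp add: inner_vec_def sum_3 power2_eq_square)
  have key: "G p = B e4 e4 * ((p $ 1)\<^sup>2 + (p $ 2)\<^sup>2 + (p $ 3)\<^sup>2)\<^sup>2
     + ((p $ 1)\<^sup>2 + (p $ 2)\<^sup>2 + (p $ 3)\<^sup>2) * (S e1 e4 * p $ 1 + S e2 e4 * p $ 2 + S e3 e4 * p $ 3)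
     + eval3 Q (p $ 1) (p $ 2) (p $ 3)" for p
    unfolding G lift3_expand[of p] e[symmetric] xx[symmetric]
    unfolding bilinear_ladd[OF B] bilinear_radd[OF B] bilinear_lmul[OF B] bilinear_rmul[OF B]
    unfolding Q_def eval3_add eval3_single S_def real_scaleR_def
    by (simp add: power2_eq_square algebra_simps) (simp add: xx power2_eq_square algebra_simps)
  show ?thesis
    unfolding darboux_cyclide_def
  proof (intro exI conjI)
    show "{x. G x = 0} = {p. let x = p $ 1; y = p $ 2; z = p $ 3 in
               B e4 e4 * (x\<^sup>2 + y\<^sup>2 + z\<^sup>2)\<^sup>2 + (x\<^sup>2 + y\<^sup>2 + z\<^sup>2) * (S e1 e4 * x + S e2 e4 * y + S e3 e4 * z)
                 + eval3 Q x y z = 0}"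
      unfolding key Let_def ..
    show "\<not> (B e4 e4 = 0 \<and> S e1 e4 = 0 \<and> S e2 e4 = 0 \<and> S e3 e4 = 0 \<and> Q = 0)"
      using assms(2) key[of x0] by (auto simp: eval3_0)
    show "\<forall>(i, j, k)\<in>Poly_Mapping.keys Q. i + j + k \<le> 2" using deg by (simp add: deg_le2_def)
  qed
qed

text \<open>The invariant form of the conclusion: \<open>f\<close> may take values in any metric
  space, in particular in R^4, and \<open>h\<close> may cover just a part of \<open>Y\<close>, so
  charts can be changed freely.\<close>

definition classified :: "'p set \<Rightarrow> ('p \<Rightarrow> 'a::metric_space) \<Rightarrow> bool" where
  "classified D f \<longleftrightarrow> (\<exists>(h :: 'p \<Rightarrow> real ^ 3) Y.
     (darboux_cyclide Y \<or> euclidean_translational Y \<or> clifford_translational Y) \<and>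
     h ` D \<subseteq> Y \<and> conf_eq D f h)"

lemma classified_conf_eq: "conf_eq D f g \<Longrightarrow> classified D g \<Longrightarrow> classified D f"
  unfolding classified_def by (metis conf_eq_trans)

lemma classified_darboux:
  assumes "\<And>p. p \<in> D \<Longrightarrow> qre (f p) = 0" "darboux_form G" "G y \<noteq> 0"
    and "\<And>p. p \<in> D \<Longrightarrow> G (im_part (f p)) = 0"
  shows "classified D f"
  unfolding classified_def
  using darboux_cyclide_form[OF assms(2,3)] conf_eq_im_part[of D f, OF assms(1)] assms(4)
  by (intro exI[of _ "\<lambda>p. im_part (f p)"] exI[of _ "{x. G x = 0}"]) auto

section \<open>Quaternion identities\<close>

lemma inner_eq_qre_mult_cnj: "x \<bullet> y = qre (x * quat_cnj y)"
  by (simp add: inner_quat_def quat_cnj_def)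

lemma inner_mult_right: "(x * y) \<bullet> w = x \<bullet> (w * quat_cnj y)" for x y w :: quat
  by (simp add: inner_quat_def quat_cnj_def algebra_simps)

lemma inner_mult_same_left: "(c * x) \<bullet> (c * y) = (c \<bullet> c) * (x \<bullet> y)" for c x y :: quat
  by (simp add: inner_quat_def algebra_simps)

lemma inner_mult_same_right: "(x * c) \<bullet> (y * c) = (c \<bullet> c) * (x \<bullet> y)" for c x y :: quat
  by (simp add: inner_quat_def algebra_simps)

lemma quat_cnj_mult_self: "quat_cnj x * x = (x \<bullet> x) *\<^sub>R 1"
  by (simp add: quat_eq_iff quat_cnj_def inner_quat_def)

lemma quat_inverse: "inverse x = (1 / (x \<bullet> x)) *\<^sub>R quat_cnj x"
  by (simp add: inverse_quat_def quat_cnj_def inner_quat_def power2_eq_square)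

lemma quat_cnj_imag: "qre q = 0 \<Longrightarrow> quat_cnj q = - q"
  by (simp add: quat_eq_iff quat_cnj_def)

lemma quat_imag_sq: "qre q = 0 \<Longrightarrow> q * q = - ((q \<bullet> q) *\<^sub>R 1)"
  by (simp add: quat_eq_iff inner_quat_def)

lemma qre_inverse_mult: "qre (inverse a * b) = (a \<bullet> b) / (a \<bullet> a)"
  by (simp add: quat_inverse inner_quat_def quat_cnj_def)

text \<open>\<open>triple x y z \<bullet> w\<close> is, up to a constant factor, the determinant of the four quaternions.\<close>

definition triple :: "quat \<Rightarrow> quat \<Rightarrow> quat \<Rightarrow> quat" where
  "triple x y z = x * quat_cnj y * z - z * quat_cnj y * x"

lemma triple_orth: "triple x y z \<bullet> x = 0" "triple x y z \<bullet> y = 0" "triple x y z \<bullet> z = 0"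
proof -
  have 1: "(x * y) \<bullet> x = (x \<bullet> x) * qre y" "(y * x) \<bullet> x = (x \<bullet> x) * qre y" for x y :: quat
    by (simp_all add: inner_quat_def algebra_simps)
  have 2: "(x * (quat_cnj y * z)) \<bullet> y = (z * (quat_cnj y * x)) \<bullet> y" for x y z :: quat
    by (simp add: inner_quat_def quat_cnj_def algebra_simps)
  have 3: "(x * quat_cnj y * z) \<bullet> x = (z * quat_cnj y * x) \<bullet> x" for x y z :: quat
  proof -
    have "(x * quat_cnj y * z) \<bullet> x = (x \<bullet> x) * qre (quat_cnj y * z)" unfolding mult.assoc 1 ..
    also have "qre (quat_cnj y * z) = qre (z * quat_cnj y)" by (simp add: mult.commute)
    finally show ?thesis unfolding 1 .
  qed
  show "triple x y z \<bullet> x = 0" "triple x y z \<bullet> z = 0"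
    using 3[of x y z] 3[of z y x] by (simp_all add: triple_def inner_diff_left)
  show "triple x y z \<bullet> y = 0"
    by (simp add: triple_def inner_diff_left mult.assoc 2)
qed

text \<open>The commutator is twice the cross product of the imaginary parts, so commuting
  quaternions have parallel imaginary parts.\<close>

lemma commuting_dependent:
  fixes p q :: quat
  assumes "p * q = q * p"
  obtains a b c where "(a, b, c) \<noteq> (0, 0, 0)" "a *\<^sub>R 1 + b *\<^sub>R p + c *\<^sub>R q = 0"
proof -
  \<comment> \<open>\<open>N\<close> is the squared length of the imaginary part of
    \<open>p\<close>, and \<open>s\<close> the inner product of both imaginary parts; parallelism
    reads \<open>N\<close> times one equals \<open>s\<close> times the other.\<close>
  define N where "N = (qi p)\<^sup>2 + (qj p)\<^sup>2 + (qk p)\<^sup>2"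
  define s where "s = qi p * qi q + qj p * qj q + qk p * qk q"
  have c: "qj p * qk q = qk p * qj q" "qk p * qi q = qi p * qk q" "qi p * qj q = qj p * qi q"
    using arg_cong[OF assms, of qi] arg_cong[OF assms, of qj] arg_cong[OF assms, of qk]
    by (simp_all add: mult.commute)
  show ?thesis
  proof (cases "N = 0")
    case True
    then have "qi p = 0" "qj p = 0" "qk p = 0"
      by (auto simp: N_def add_nonneg_eq_0_iff)
    then show ?thesis
      by (intro that[of "- qre p" 1 0]) (auto simp: quat_eq_iff)
  next
    case False
    have "N * qi q = s * qi p" "N * qj q = s * qj p" "N * qk q = s * qk p"
      unfolding N_def s_def using c by algebra+
    then show ?thesis using False
      by (intro that[of "s * qre p - N * qre q" "- s" N]) (auto simp: quat_eq_iff)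
  qed
qed

text \<open>Factoring out \<open>x\<close> on the left turns the condition into commutation of
  \<open>inverse x * y\<close> and \<open>inverse x * z\<close>; the resulting dependence with 1 is
  multiplied back by \<open>x\<close>.\<close>

lemma triple_eq_0_dependent:
  assumes "triple x y z = 0"
  obtains a b c where "(a, b, c) \<noteq> (0, 0, 0)" "a *\<^sub>R x + b *\<^sub>R y + c *\<^sub>R z = 0"
proof (cases "x = 0")
  case True
  then show ?thesis by (intro that[of 1 0 0]) auto
next
  case False
  define y' z' where "y' = inverse x * y" "z' = inverse x * z"
  have yz: "y = x * y'" "z = x * z'"
    using False by (simp_all add: y'_z'_def mult.assoc[symmetric])
  have "triple x y z = (x \<bullet> x) *\<^sub>R (x * (quat_cnj y' * z' - z' * quat_cnj y'))"
  proof -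
    have "triple x y z = x * (quat_cnj y' * (quat_cnj x * x) * z') - x * z' * (quat_cnj y' * (quat_cnj x * x))"
      unfolding triple_def yz quat_cnj_mult by (simp add: mult.assoc)
    then show ?thesis unfolding quat_cnj_mult_self by (simp add: algebra_simps)
  qed
  then have "quat_cnj y' * z' = z' * quat_cnj y'" using assms False by simp
  moreover have "quat_cnj y' = (2 * qre y') *\<^sub>R 1 - y'"
    by (simp add: quat_eq_iff quat_cnj_def)
  ultimately have "y' * z' = z' * y'" by (simp add: left_diff_distrib right_diff_distrib)
  then obtain a b c where abc: "(a, b, c) \<noteq> (0, 0, 0)" "a *\<^sub>R 1 + b *\<^sub>R y' + c *\<^sub>R z' = 0"
    using commuting_dependent by blast
  have "a *\<^sub>R x + b *\<^sub>R y + c *\<^sub>R z = x * (a *\<^sub>R 1 + b *\<^sub>R y' + c *\<^sub>R z')"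
    by (simp add: yz distrib_left)
  then show ?thesis using abc by (intro that[of a b c]) auto
qed

definition comb4 :: "quat \<Rightarrow> quat \<Rightarrow> quat \<Rightarrow> quat \<Rightarrow> quat \<Rightarrow> quat" where
  "comb4 x y z w t = qre t *\<^sub>R x + qi t *\<^sub>R y + qj t *\<^sub>R z + qk t *\<^sub>R w"

lemma linear_comb4: "linear (comb4 x y z w)"
  by (rule linearI) (simp_all add: comb4_def algebra_simps)

lemma linear_eq_comb4:
  assumes "linear A"
  shows "A = comb4 (A (Quat 1 0 0 0)) (A (Quat 0 1 0 0)) (A (Quat 0 0 1 0)) (A (Quat 0 0 0 1))"
proof
  fix t
  have "t = qre t *\<^sub>R Quat 1 0 0 0 + qi t *\<^sub>R Quat 0 1 0 0 + qj t *\<^sub>R Quat 0 0 1 0 + qk t *\<^sub>R Quat 0 0 0 1"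
    by (simp add: quat_eq_iff)
  then have "A t = A (qre t *\<^sub>R Quat 1 0 0 0 + qi t *\<^sub>R Quat 0 1 0 0 + qj t *\<^sub>R Quat 0 0 1 0 + qk t *\<^sub>R Quat 0 0 0 1)"
    by simp
  then show "A t = comb4 (A (Quat 1 0 0 0)) (A (Quat 0 1 0 0)) (A (Quat 0 0 1 0)) (A (Quat 0 0 0 1)) t"
    by (simp add: comb4_def linear_add[OF assms] linear_scale[OF assms])
qed

text \<open>A nonzero \<open>triple x y z\<close> is orthogonal to the whole range of
  \<open>comb4 x y z w\<close>, which is then not surjective and, in equal dimensions, not
  injective.\<close>

lemma det_eq_0_dependent:
  assumes "triple x y z \<bullet> w = 0"
  obtains t where "t \<noteq> 0" "comb4 x y z w t = 0"
proof (cases "triple x y z = 0")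
  case True
  then obtain a b c where "(a, b, c) \<noteq> (0, 0, 0)" "a *\<^sub>R x + b *\<^sub>R y + c *\<^sub>R z = 0"
    using triple_eq_0_dependent by blast
  then show ?thesis by (intro that[of "Quat a b c 0"]) (auto simp: comb4_def quat_eq_iff)
next
  case False
  have "triple x y z \<bullet> comb4 x y z w t = 0" for t
    by (simp add: comb4_def inner_add_right assms triple_orth)
  then have "triple x y z \<notin> range (comb4 x y z w)" using False by (metis inner_eq_zero_iff rangeE)
  then have "\<not> surj (comb4 x y z w)" by blast
  then have "\<not> inj (comb4 x y z w)"
    using linear_injective_imp_surjective[OF linear_comb4] by blast
  then show ?thesis using that linear_injective_0[OF linear_comb4] by blast
qed

lemma dependent_det_eq_0:
  assumes "x = a *\<^sub>R y + b *\<^sub>R z + c *\<^sub>R w"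
  shows "triple x y z \<bullet> w = 0"
proof -
  have "triple y y z = 0" "triple z y z = 0"
    by (simp_all add: triple_def mult.assoc quat_cnj_mult_self) (simp add: mult.assoc[symmetric] quat_mult_cnj)
  moreover have "triple x y z = a *\<^sub>R triple y y z + b *\<^sub>R triple z y z + c *\<^sub>R triple w y z"
    unfolding assms triple_def by (simp add: algebra_simps)
  ultimately show ?thesis by (simp add: triple_orth)
qed

section \<open>Surfaces of the form \<open>A\<^sup>-\<^sup>1 B\<close>\<close>

text \<open>A polynomial of bidegree \<open>(1, 1)\<close> is a linear map composed with \<open>uv\<close>; the quaternions serve
  here only as a model of \<open>\<real>\<^sup>4\<close>.\<close>

definition uv :: "real \<times> real \<Rightarrow> quat" where
  "uv p = Quat 1 (fst p) (snd p) (fst p * snd p)"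

text \<open>The equation of the quadric traced by \<open>uv\<close> in projective space.\<close>

definition segre :: "quat \<Rightarrow> real" where
  "segre t = qre t * qk t - qi t * qj t"

lemma segre_uv [simp]: "segre (uv p) = 0"
  by (simp add: segre_def uv_def)

lemma comb4_uv: "comb4 x y z w (uv (u, v)) = x + u *\<^sub>R y + v *\<^sub>R z + (u * v) *\<^sub>R w"
  by (simp add: comb4_def uv_def)

section \<open>Polynomial identities on open sets\<close>

lemma quadratic_eq_0:
  fixes c0 c1 c2 :: real
  assumes "open U" "x \<in> U" "\<And>u. u \<in> U \<Longrightarrow> c0 + c1 * u + c2 * u\<^sup>2 = 0"
  shows "c0 = 0" "c1 = 0" "c2 = 0"
proof -
  obtain e where e: "e > 0" "ball x e \<subseteq> U" using assms(1,2) openE by blast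
  define d where "d = e / 2"
  have d: "d > 0" "x + d \<in> U" "x - d \<in> U" using e by (auto simp: d_def dist_norm subset_iff)
  have f: "c0 + c1 * x + c2 * x\<^sup>2 = 0" "c0 + c1 * (x + d) + c2 * (x + d)\<^sup>2 = 0"
    "c0 + c1 * (x - d) + c2 * (x - d)\<^sup>2 = 0" using assms d by auto
  \<comment> \<open>The second difference with step \<open>d\<close> isolates the leading
    coefficient.\<close>
  have "2 * d\<^sup>2 * c2 = (c0 + c1 * (x + d) + c2 * (x + d)\<^sup>2) + (c0 + c1 * (x - d) + c2 * (x - d)\<^sup>2)
    - 2 * (c0 + c1 * x + c2 * x\<^sup>2)"
    by (simp add: power2_eq_square algebra_simps)
  then have "2 * d\<^sup>2 * c2 = 0" unfolding f by simp
  then show c2: "c2 = 0" using d by simp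
  then have "d * c1 = 0" using f by (simp add: algebra_simps)
  then show "c1 = 0" using d by simp
  then show "c0 = 0" using f c2 by simp
qed

lemma biquadratic_eq_0:
  fixes c :: "nat \<Rightarrow> nat \<Rightarrow> real"
  assumes "open D" "p \<in> D"
    and z: "\<And>u v. (u, v) \<in> D \<Longrightarrow>
      (c 0 0 + c 0 1 * v + c 0 2 * v\<^sup>2) + (c 1 0 + c 1 1 * v + c 1 2 * v\<^sup>2) * u
      + (c 2 0 + c 2 1 * v + c 2 2 * v\<^sup>2) * u\<^sup>2 = 0"
    and "i \<le> 2" "j \<le> 2"
  shows "c i j = 0"
proof -
  obtain U V where UV: "open U" "open V" "p \<in> U \<times> V" "U \<times> V \<subseteq> D"
    using assms(1,2) open_prod_elim by blast
  have z': "c 0 0 + c 0 1 * v + c 0 2 * v\<^sup>2 = 0" "c 1 0 + c 1 1 * v + c 1 2 * v\<^sup>2 = 0"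
    "c 2 0 + c 2 1 * v + c 2 2 * v\<^sup>2 = 0" if v: "v \<in> V" for v
    using quadratic_eq_0[OF UV(1) _ z, of "fst p" v] UV(3,4) v by (auto simp: mem_Times_iff)
  have V: "snd p \<in> V" using UV(3) by (simp add: mem_Times_iff)
  note quadratic_eq_0[OF UV(2) V z'(1)] quadratic_eq_0[OF UV(2) V z'(2)] quadratic_eq_0[OF UV(2) V z'(3)]
  moreover have "i = 0 \<or> i = 1 \<or> i = 2" "j = 0 \<or> j = 1 \<or> j = 2" using assms(4,5) by auto
  ultimately show ?thesis by auto
qed

text \<open>Among the products of two coordinates of \<open>uv\<close>, only the monomial u v arises
  twice, from \<open>qre t * qk t\<close> and \<open>qi t * qj t\<close>. The nine vanishing
  coefficients thus leave a one-parameter family of quadratic forms.\<close>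

lemma segre_multiple:
  fixes A B :: "quat \<Rightarrow> quat"
  assumes "linear A" "linear B" "open D" "D \<noteq> {}"
    and "\<And>p. p \<in> D \<Longrightarrow> A (uv p) \<bullet> B (uv p) = 0"
  obtains l where "\<And>t. A t \<bullet> B t = l * segre t"
proof -
  obtain a0 a1 a2 a3 where A: "A = comb4 a0 a1 a2 a3" using linear_eq_comb4[OF assms(1)] by blast
  obtain b0 b1 b2 b3 where B: "B = comb4 b0 b1 b2 b3" using linear_eq_comb4[OF assms(2)] by blast
  obtain p where p: "p \<in> D" using assms(4) by blast
  define c where "c i j = (if i = 0 then
      (if j = 0 then a0 \<bullet> b0 else if j = 1 then a0 \<bullet> b2 + a2 \<bullet> b0 else a2 \<bullet> b2)
    else if i = 1 then
      (if j = 0 then a0 \<bullet> b1 + a1 \<bullet> b0 else if j = 1 then a0 \<bullet> b3 + a3 \<bullet> b0 + a1 \<bullet> b2 + a2 \<bullet> b1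
       else a2 \<bullet> b3 + a3 \<bullet> b2)
    else (if j = 0 then a1 \<bullet> b1 else if j = 1 then a1 \<bullet> b3 + a3 \<bullet> b1 else a3 \<bullet> b3))"
    for i j :: nat
  have "c i j = 0" if "i \<le> 2" "j \<le> 2" for i j
  proof (rule biquadratic_eq_0[OF assms(3) p _ that])
    fix u v assume uv: "(u, v) \<in> D"
    have "A (uv (u, v)) \<bullet> B (uv (u, v)) = (c 0 0 + c 0 1 * v + c 0 2 * v\<^sup>2)
      + (c 1 0 + c 1 1 * v + c 1 2 * v\<^sup>2) * u + (c 2 0 + c 2 1 * v + c 2 2 * v\<^sup>2) * u\<^sup>2"
      unfolding A B comb4_uv c_def
      by (simp add: inner_add_left inner_add_right algebra_simps power2_eq_square)
    then show "(c 0 0 + c 0 1 * v + c 0 2 * v\<^sup>2) + (c 1 0 + c 1 1 * v + c 1 2 * v\<^sup>2) * u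
      + (c 2 0 + c 2 1 * v + c 2 2 * v\<^sup>2) * u\<^sup>2 = 0"
      using assms(5)[OF uv] by simp
  qed
  note z = this[of 0 0] this[of 0 1] this[of 0 2] this[of 1 0] this[of 1 1] this[of 1 2]
    this[of 2 0] this[of 2 1] this[of 2 2]
  have z': "a0 \<bullet> b0 = 0" "a1 \<bullet> b1 = 0" "a2 \<bullet> b2 = 0" "a3 \<bullet> b3 = 0"
    "a2 \<bullet> b0 = - (a0 \<bullet> b2)" "a1 \<bullet> b0 = - (a0 \<bullet> b1)" "a3 \<bullet> b2 = - (a2 \<bullet> b3)" "a3 \<bullet> b1 = - (a1 \<bullet> b3)"
    "a2 \<bullet> b1 = - (a0 \<bullet> b3 + a3 \<bullet> b0) - a1 \<bullet> b2"
    using z by (simp_all add: c_def)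
  have "A t \<bullet> B t = (a0 \<bullet> b3 + a3 \<bullet> b0) * segre t" for t
    unfolding A B comb4_def segre_def by (simp add: inner_add_left inner_add_right z' algebra_simps)
  then show ?thesis using that by blast
qed

section \<open>The determinant equation and the nondegenerate case\<close>

lemma lin_lift_im_quat: "lin_lift im_quat"
  using lin_lift_linear[OF linear_im_quat] .

text \<open>An imaginary quaternion times its conjugate is real, so the quadratic term is a multiple
  of \<open>x \<bullet> x\<close>. This keeps the determinant, of degree four in \<open>x\<close>,
  among the Darboux forms.\<close>

lemma lin_lift_mult_cnj:
  "lin_lift (\<lambda>x. (a * im_quat x - b) * quat_cnj (a' * im_quat x - b'))"
proof -
  have "(a * im_quat x - b) * quat_cnj (a' * im_quat x - b')
    = (x \<bullet> x) *\<^sub>R (a * quat_cnj a') - a * im_quat x * quat_cnj b' + b * im_quat x * quat_cnj a'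
      + b * quat_cnj b'" for x
  proof -
    have "a * im_quat x * (im_quat x * quat_cnj a') = - ((x \<bullet> x) *\<^sub>R (a * quat_cnj a'))"
      using quat_imag_sq[of "im_quat x"] by (simp add: mult.assoc[symmetric] inner_im_quat)
        (simp add: mult.assoc inner_im_quat)
    then show ?thesis
      by (simp add: linear_diff[OF linear_quat_cnj] quat_cnj_mult quat_cnj_imag algebra_simps)
  qed
  then show ?thesis
    by (simp only:) (intro lin_lift_add lin_lift_diff lin_lift_mult lin_lift_scaleR lin_lift_sq
      lin_lift_const lin_lift_im_quat)
qed

text \<open>The quaternion \<open>q\<close> is a value of \<open>A\<^sup>-\<^sup>1 B\<close> only if the columns \<open>a\<^sub>i q - b\<^sub>i\<close> are linearly
  dependent.\<close>

lemma darboux_form_det: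
  "darboux_form (\<lambda>x. triple (a0 * im_quat x - b0) (a1 * im_quat x - b1) (a2 * im_quat x - b2)
     \<bullet> (a3 * im_quat x - b3))"
proof -
  have "triple x y z \<bullet> w = (x * quat_cnj y) \<bullet> (w * quat_cnj z) - (z * quat_cnj y) \<bullet> (w * quat_cnj x)"
    for x y z w by (simp add: triple_def inner_diff_left inner_mult_right[symmetric])
  then show ?thesis
    by (simp only:) (intro darboux_form_diff darboux_form_bilinear[OF bilinear_inner] lin_lift_mult_cnj)
qed

lemma negligible_chart:
  fixes A B :: "quat \<Rightarrow> quat" and c :: "real \<times> real \<Rightarrow> quat"
  assumes "linear A" "linear B" "c differentiable_on UNIV"
  shows "negligible ((\<lambda>p. im_part (inverse (A (c p)) * B (c p))) ` {p. A (c p) \<noteq> 0})"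
proof (rule negligible_fraction)
  have "(\<lambda>p. L (c p)) differentiable_on UNIV" if "linear L" for L :: "quat \<Rightarrow> quat"
    using differentiable_chain_at[OF _ linear_imp_differentiable[OF that], of c] assms(3)
    by (simp add: differentiable_on_def comp_def)
  then show "(\<lambda>p. A (c p)) differentiable_on UNIV" "(\<lambda>p. B (c p)) differentiable_on UNIV"
    using assms(1,2) by blast+
qed

lemma differentiable_on_Quat:
  fixes f g h k :: "'a::real_normed_vector \<Rightarrow> real"
  assumes "f differentiable_on S" "g differentiable_on S" "h differentiable_on S" "k differentiable_on S"
  shows "(\<lambda>p. Quat (f p) (g p) (h p) (k p)) differentiable_on S"
proof -
  have "(\<lambda>p. Quat (f p) (g p) (h p) (k p)) = (\<lambda>p. f p *\<^sub>R Quat 1 0 0 0 + g p *\<^sub>R Quat 0 1 0 0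
    + h p *\<^sub>R Quat 0 0 1 0 + k p *\<^sub>R Quat 0 0 0 1)"
    by (simp add: fun_eq_iff quat_eq_iff)
  then show ?thesis
    using assms unfolding differentiable_on_def
    by (auto intro!: differentiable_add differentiable_scaleR)
qed

lemma imaginary_left_fraction_nondegenerate:
  assumes "linear A" "linear B" and AB: "\<And>t. A t \<bullet> B t = l * segre t" and "l \<noteq> 0"
    and D: "\<And>p. p \<in> D \<Longrightarrow> A (uv p) \<noteq> 0"
    and im: "\<And>p. p \<in> D \<Longrightarrow> qre (inverse (A (uv p)) * B (uv p)) = 0"
  shows "classified D (\<lambda>p. inverse (A (uv p)) * B (uv p))"
proof -
  obtain a0 a1 a2 a3 where A: "A = comb4 a0 a1 a2 a3" using linear_eq_comb4[OF assms(1)] by blast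
  obtain b0 b1 b2 b3 where B: "B = comb4 b0 b1 b2 b3" using linear_eq_comb4[OF assms(2)] by blast
  define F where "F x = triple (a0 * im_quat x - b0) (a1 * im_quat x - b1) (a2 * im_quat x - b2)
     \<bullet> (a3 * im_quat x - b3)" for x
  have comb: "comb4 (a0 * q - b0) (a1 * q - b1) (a2 * q - b2) (a3 * q - b3) t = A t * q - B t" for q t
    by (simp add: A B comb4_def algebra_simps)
  have "\<exists>y. F y \<noteq> 0"
  proof (rule ccontr)
    assume F0: "\<not> (\<exists>y. F y \<noteq> 0)"
    \<comment> \<open>Up to scaling, a point of the Segre quadric with
      \<open>qre t \<noteq> 0\<close> is a value of \<open>uv\<close>; if \<open>qre t = 0\<close>,
      then \<open>qi t\<close> or \<open>qj t\<close> vanishes. Each of the three charts has two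
      parameters.\<close>
    define c1 c2 c3 where c: "c1 = uv" "c2 = (\<lambda>p. Quat 0 0 (fst p) (snd p))"
      "c3 = (\<lambda>p. Quat 0 (fst p) 0 (snd p))" 
    define im where "im c = (\<lambda>p. im_part (inverse (A (c p)) * B (c p))) ` {p. A (c p) \<noteq> 0}"
      for c :: "real \<times> real \<Rightarrow> quat"
    have "x \<in> im c1 \<union> im c2 \<union> im c3" for x
    proof -
      obtain t where t: "t \<noteq> 0" "A t * im_quat x = B t"
        using det_eq_0_dependent F0 comb unfolding F_def by (metis eq_iff_diff_eq_0)
      \<comment> \<open>\<open>A t\<close> is orthogonal to \<open>A t * im_quat x\<close>, because
        the right factor is imaginary.\<close>
      have "l * segre t = 0"
        unfolding AB[symmetric] t(2)[symmetric]
        using inner_mult_same_left[of "A t" 1 "im_quat x"] by (simp add: inner_quat_def)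
      then have s: "segre t = 0" using \<open>l \<noteq> 0\<close> by simp
      \<comment> \<open>Otherwise \<open>B t = 0\<close> as well, and shifts by \<open>t\<close>
        would preserve \<open>segre\<close>, contrary to its nondegeneracy.\<close>
      have "A t \<noteq> 0"
      proof
        assume A0: "A t = 0"
        then have B0: "B t = 0" using t(2) by simp
        have *: "segre (t + t') = segre t'" for t'
        proof -
          have "l * segre (t + t') = l * segre t'"
            unfolding AB[symmetric] by (simp add: linear_add[OF assms(1)] linear_add[OF assms(2)] A0 B0)
          then show ?thesis using \<open>l \<noteq> 0\<close> by simp
        qed
        have "t = 0"
          using *[of "Quat 1 0 0 0"] *[of "Quat 0 1 0 0"] *[of "Quat 0 0 1 0"] *[of "Quat 0 0 0 1"] s
          by (simp add: segre_def quat_eq_iff algebra_simps)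
        then show False using t(1) by simp
      qed
      then have x: "im_part (inverse (A t) * B t) = x"
        by (simp add: t(2)[symmetric] mult.assoc[symmetric])
      have in_im: "x \<in> im c" if "t = r *\<^sub>R c p" "r \<noteq> 0" for c r p
      proof -
        have e: "A t = r *\<^sub>R A (c p)" "B t = r *\<^sub>R B (c p)"
          by (simp_all add: that(1) linear_scale[OF assms(1)] linear_scale[OF assms(2)])
        then have "A (c p) \<noteq> 0" using \<open>A t \<noteq> 0\<close> by auto
        moreover have "inverse (A t) * B t = inverse (A (c p)) * B (c p)"
          unfolding e using that(2) \<open>A (c p) \<noteq> 0\<close> by (simp add: inverse_scaleR_distrib)
        ultimately show ?thesis unfolding im_def x[symmetric] by auto
      qed
      show ?thesis
      proof (cases "qre t = 0")
        case True
        then have "qi t = 0 \<or> qj t = 0" using s by (simp add: segre_def)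
        then have "t = 1 *\<^sub>R c2 (qj t, qk t) \<or> t = 1 *\<^sub>R c3 (qi t, qk t)"
          using True by (auto simp: c quat_eq_iff)
        then show ?thesis using in_im by (metis UnI1 UnI2 zero_neq_one)
      next
        case False
        have "t = qre t *\<^sub>R c1 (qi t / qre t, qj t / qre t)"
          using False s by (simp add: c uv_def quat_eq_iff segre_def field_simps)
        then show ?thesis using in_im False by blast
      qed
    qed
    then have "im c1 \<union> im c2 \<union> im c3 = UNIV" by blast
    moreover have "negligible (im c1 \<union> im c2 \<union> im c3)"
      unfolding im_def c uv_def[abs_def]
      by (intro negligible_Un negligible_chart assms(1,2) differentiable_on_Quat differentiable_on_const
        differentiable_on_mult bounded_linear_imp_differentiable_on bounded_linear_fst bounded_linear_snd)
    ultimately show False using non_negligible_UNIV by simp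
  qed
  then obtain y where y: "F y \<noteq> 0" by blast
  show ?thesis
  proof (rule classified_darboux[where G = F and y = y])
    show "F y \<noteq> 0" by (rule y)
    show "qre (inverse (A (uv p)) * B (uv p)) = 0" if "p \<in> D" for p by (rule im[OF that])
    show "darboux_form F" unfolding F_def[abs_def] by (rule darboux_form_det)
    fix p assume p: "p \<in> D"
    define q where "q = inverse (A (uv p)) * B (uv p)"
    have "A (uv p) * q - B (uv p) = 0"
      using D[OF p] by (simp add: q_def mult.assoc[symmetric])
    \<comment> \<open>The first column is a combination of the others because the first entry of
      \<open>uv p\<close> is 1.\<close>
    then have "(a0 * q - b0) = (- fst p) *\<^sub>R (a1 * q - b1) + (- snd p) *\<^sub>R (a2 * q - b2)
      + (- (fst p * snd p)) *\<^sub>R (a3 * q - b3)"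
      unfolding comb[symmetric] by (simp add: comb4_def uv_def algebra_simps eq_neg_iff_add_eq_0)
    then have "triple (a0 * q - b0) (a1 * q - b1) (a2 * q - b2) \<bullet> (a3 * q - b3) = 0"
      by (rule dependent_det_eq_0)
    then show "F (im_part (inverse (A (uv p)) * B (uv p))) = 0"
      unfolding F_def im_quat_im_part[OF im[OF p]] q_def .
  qed
qed

section \<open>The skew case: quadratic forms on projective images of the Segre quadric\<close>

text \<open>Even a singular projective image satisfies a nonzero quadratic equation: the square of a
  linear functional vanishing on the range replaces the transported \<open>segre\<close>.
  Nontriviality is stated on the diagonal, since a skew \<open>\<beta>\<close> defines the zero
  form.\<close>

lemma linear_image_segre:
  fixes L :: "quat \<Rightarrow> quat"
  assumes "linear L"
  obtains \<beta> :: "quat \<Rightarrow> quat \<Rightarrow> real" and y where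
    "bilinear \<beta>" "\<beta> y y \<noteq> 0" "\<And>t. segre t = 0 \<Longrightarrow> \<beta> (L t) (L t) = 0"
proof (cases "inj L")
  case True
  then obtain K where K: "linear K" "\<And>x. K (L x) = x" "\<And>x. L (K x) = x"
    using linear_injective_isomorphism[OF assms] by metis
  define \<beta> where "\<beta> x y = qre (K x) * qk (K y) - qi (K x) * qj (K y)" for x y
  have "bilinear \<beta>"
    unfolding bilinear_def linear_iff \<beta>_def
    by (simp add: linear_add[OF K(1)] linear_scale[OF K(1)] algebra_simps)
  moreover have "\<beta> (L t) (L t) = segre t" for t by (simp add: \<beta>_def segre_def K)
  moreover have "segre (Quat 1 0 0 1) \<noteq> 0" by (simp add: segre_def)
  ultimately show ?thesis using that by metis
next
  case False
  then have "\<not> surj L" using linear_surjective_imp_injective[OF assms] by blast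
  then have "span (range L) \<noteq> UNIV"
    using span_eq_iff subspace_UNIV linear_subspace_image[OF assms] by metis
  then obtain n where n: "n \<noteq> 0" "\<And>x. x \<in> span (range L) \<Longrightarrow> orthogonal n x"
    using orthogonal_to_subspace_exists_gen[of "range L" UNIV] by (auto simp: psubset_eq)
  have "bilinear (\<lambda>x y. (n \<bullet> x) * (n \<bullet> y))"
    by (simp add: bilinear_def linear_iff inner_add_right algebra_simps)
  moreover have "n \<bullet> L t = 0" for t
    using n(2)[OF span_base[OF rangeI], of t] by (simp add: orthogonal_def)
  ultimately show ?thesis using that[of "\<lambda>x y. (n \<bullet> x) * (n \<bullet> y)" n] n(1) by simp
qed

text \<open>On each ray from 1 the form is a quadratic polynomial in \<open>t\<close>, whose three
  coefficients determine it after splitting into real and imaginary part. The length of the piece of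
  the ray may depend on its direction.\<close>

lemma bilinear_eq_0_near_1:
  fixes \<beta> :: "quat \<Rightarrow> quat \<Rightarrow> real"
  assumes \<beta>: "bilinear \<beta>"
    and near: "\<And>y. qre y = 0 \<Longrightarrow> y \<noteq> 0 \<Longrightarrow> \<exists>d>0. \<forall>t\<in>{0<..<d}. \<beta> (1 + t *\<^sub>R y) (1 + t *\<^sub>R y) = 0"
  shows "\<beta> z z = 0"
proof -
  have *: "\<beta> 1 1 = 0" "\<beta> 1 y + \<beta> y 1 = 0" "\<beta> y y = 0" if y: "qre y = 0" "y \<noteq> 0" for y
  proof -
    obtain d where d: "d > 0" "\<And>t. t \<in> {0<..<d} \<Longrightarrow> \<beta> (1 + t *\<^sub>R y) (1 + t *\<^sub>R y) = 0"
      using near[OF y] by blast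
    have "\<beta> 1 1 + (\<beta> 1 y + \<beta> y 1) * t + \<beta> y y * t\<^sup>2 = 0" if "t \<in> {0<..<d}" for t
      using d(2)[OF that]
      by (simp add: bilinear_ladd[OF \<beta>] bilinear_radd[OF \<beta>] bilinear_lmul[OF \<beta>] bilinear_rmul[OF \<beta>]
        algebra_simps power2_eq_square)
    from quadratic_eq_0[OF _ _ this, of "{0<..<d}" "d / 2"] d(1)
    show "\<beta> 1 1 = 0" "\<beta> 1 y + \<beta> y 1 = 0" "\<beta> y y = 0" by auto
  qed
  define y where "y = z - qre z *\<^sub>R 1"
  have "\<beta> 1 y + \<beta> y 1 = 0" "\<beta> y y = 0"
    using *[of y] by (cases "y = 0", simp_all add: y_def bilinear_lzero[OF \<beta>] bilinear_rzero[OF \<beta>])+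
  moreover have "\<beta> 1 1 = 0" using *(1)[of "Quat 0 1 0 0"] by (simp add: quat_eq_iff)
  moreover have "\<beta> z z = qre z * (\<beta> 1 y + \<beta> y 1) + qre z * qre z * \<beta> 1 1 + \<beta> y y"
  proof -
    have "z = qre z *\<^sub>R 1 + y" by (simp add: y_def)
    then have "\<beta> z z = \<beta> (qre z *\<^sub>R 1 + y) (qre z *\<^sub>R 1 + y)" by (rule arg_cong2) (rule \<open>z = _\<close>)
    also have "\<dots> = qre z * (\<beta> 1 y + \<beta> y 1) + qre z * qre z * \<beta> 1 1 + \<beta> y y"
      by (simp add: bilinear_ladd[OF \<beta>] bilinear_radd[OF \<beta>] bilinear_lmul[OF \<beta>] bilinear_rmul[OF \<beta>]
        algebra_simps)
    finally show ?thesis .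
  qed
  ultimately show ?thesis by simp
qed

section \<open>The transformation of imaginary q to (q^-1 + K)^-1\<close>

lemma im_quat_mult: "im_quat x * im_quat y = im_quat (cross3 x y) - (x \<bullet> y) *\<^sub>R 1"
  by (simp add: quat_eq_iff im_quat_def cross3_def inner_vec_def sum_3)

text \<open>The numerator of \<open>inverse (inverse q + K) = inverse (1 + q * K) * q\<close> over
  the real denominator \<open>(1 + q * K) \<bullet> (1 + q * K)\<close>. For imaginary
  \<open>K\<close> this is a Moebius transformation of the imaginary quaternions.\<close>

lemma mult_cnj_shift:
  fixes q K :: quat
  assumes "qre q = 0" "qre K = 0"
  shows "quat_cnj (1 + q * K) * q = q - (q \<bullet> q) *\<^sub>R K"
proof -
  have "quat_cnj (1 + q * K) = 1 + K * q"
    using assms by (simp add: quat_eq_iff quat_cnj_def)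
  then show ?thesis using quat_imag_sq[OF assms(1)] by (simp add: distrib_right mult.assoc)
qed

text \<open>If \<open>q = inverse A * B\<close>, the transform of \<open>q\<close> is
  \<open>inverse m * B\<close>, and a good choice of \<open>K\<close> makes \<open>m\<close> simple.
  Denominators are cleared so that the identity survives \<open>m = 0\<close>.\<close>

lemma pole_shift:
  fixes A q K m :: quat
  assumes "qre q = 0" "qre K = 0" "A * (1 + q * K) = m"
  shows "((1 + q * K) \<bullet> (1 + q * K)) *\<^sub>R (A * q) = m * (q - (q \<bullet> q) *\<^sub>R K)"
proof -
  have "((1 + q * K) \<bullet> (1 + q * K)) *\<^sub>R A = m * quat_cnj (1 + q * K)"
    unfolding assms(3)[symmetric] mult.assoc quat_mult_cnj by simp
  then have "((1 + q * K) \<bullet> (1 + q * K)) *\<^sub>R A * q = m * (quat_cnj (1 + q * K) * q)"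
    by (simp add: mult.assoc)
  then show ?thesis unfolding mult_cnj_shift[OF assms(1,2)] by simp
qed

text \<open>At the pole of the transformation all homogeneous coordinates vanish together, so the
  pole satisfies every homogeneous equation in them.\<close>

lemma pole_shift_0:
  fixes q K :: quat
  assumes "qre q = 0" "1 + q * K = 0"
  shows "q - (q \<bullet> q) *\<^sub>R K = 0"
proof -
  have "q * (1 + q * K) = q - (q \<bullet> q) *\<^sub>R K"
    using quat_imag_sq[OF assms(1)] by (simp add: distrib_left mult.assoc[symmetric])
  then show ?thesis using assms(2) by simp
qed

text \<open>\<open>shift_lift k x\<close> consists of homogeneous coordinates of \<open>(x\<^sup>-\<^sup>1 + k)\<^sup>-\<^sup>1\<close>, with the real part in the
  role of the denominator.\<close>

definition shift_lift :: "real ^ 3 \<Rightarrow> real ^ 3 \<Rightarrow> quat" where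
  "shift_lift k x = 1 - (2 * (x \<bullet> k)) *\<^sub>R 1 + (x \<bullet> x) *\<^sub>R ((k \<bullet> k) *\<^sub>R 1 - im_quat k) + im_quat x"

lemma lin_lift_shift_lift: "lin_lift (shift_lift k)"
  unfolding shift_lift_def[abs_def]
  by (intro lin_lift_add lin_lift_diff lin_lift_const lin_lift_scaleR lin_lift_sq lin_lift_im_quat
    lin_lift_linear) (simp add: linear_iff inner_add_left)

lemma shift_lift_alt:
  "shift_lift k x = (1 - 2 * (x \<bullet> k) + (x \<bullet> x) * (k \<bullet> k)) *\<^sub>R 1 + (im_quat x - (x \<bullet> x) *\<^sub>R im_quat k)"
  by (simp add: shift_lift_def scaleR_diff_left scaleR_diff_right scaleR_add_left)

lemma shift_lift_eq:
  "shift_lift k x = ((1 + im_quat x * im_quat k) \<bullet> (1 + im_quat x * im_quat k)) *\<^sub>R 1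
     + (im_quat x - (im_quat x \<bullet> im_quat x) *\<^sub>R im_quat k)"
proof -
  have "(1 + im_quat x * im_quat k) \<bullet> (1 + im_quat x * im_quat k)
    = 1 - 2 * (x \<bullet> k) + (x \<bullet> x) * (k \<bullet> k)"
    using inner_mult_same_left[of "im_quat x" "im_quat k" "im_quat k"]
    by (simp add: inner_add_left inner_add_right inner_im_quat)
       (simp add: inner_quat_def im_quat_def inner_vec_def sum_3)
  then show ?thesis unfolding shift_lift_alt by (simp only: inner_im_quat)
qed

text \<open>The preimage is given by the inverse transformation, which has \<open>- k\<close> in
  place of \<open>k\<close> and \<open>N\<close> as its denominator.\<close>

lemma shift_lift_surj:
  fixes k y :: "real ^ 3"
  defines "N \<equiv> 1 + 2 * (y \<bullet> k) + (y \<bullet> y) * (k \<bullet> k)"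
  assumes "N \<noteq> 0"
  shows "shift_lift k ((1 / N) *\<^sub>R (y + (y \<bullet> y) *\<^sub>R k)) = (1 / N) *\<^sub>R (1 + im_quat y)"
proof -
  let ?x = "(1 / N) *\<^sub>R (y + (y \<bullet> y) *\<^sub>R k)"
  have "(y + (y \<bullet> y) *\<^sub>R k) \<bullet> (y + (y \<bullet> y) *\<^sub>R k) = (y \<bullet> y) * N"
    by (simp add: N_def inner_add_left inner_add_right inner_commute[of k y] algebra_simps)
  then have xx: "?x \<bullet> ?x = (y \<bullet> y) / N" using assms(2) by simp
  have xk: "?x \<bullet> k = (y \<bullet> k + (y \<bullet> y) * (k \<bullet> k)) / N" by (simp add: inner_add_left)
  have "1 - 2 * (?x \<bullet> k) + (?x \<bullet> ?x) * (k \<bullet> k) = 1 / N"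
    unfolding xx xk using assms(2) by (simp add: field_simps) (simp add: N_def)
  then have "shift_lift k ?x = (1 / N) *\<^sub>R 1 + (im_quat ?x - (?x \<bullet> ?x) *\<^sub>R im_quat k)"
    unfolding shift_lift_alt by simp
  also have "im_quat ?x - (?x \<bullet> ?x) *\<^sub>R im_quat k = (1 / N) *\<^sub>R im_quat y"
    unfolding xx by (simp add: linear_add[OF linear_im_quat] linear_scale[OF linear_im_quat] scaleR_add_right)
  finally show ?thesis by (simp add: scaleR_add_right)
qed

lemma shift_lift_nontrivial:
  assumes \<beta>: "bilinear \<beta>" and "\<And>x. \<beta> (shift_lift k x) (shift_lift k x) = 0"
  shows "\<beta> z z = (0::real)"
proof (rule bilinear_eq_0_near_1[OF \<beta>])
  fix y :: quat assume y: "qre y = 0"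
  define v where "v = im_part y"
  have v: "y = im_quat v" using y by (simp add: v_def im_quat_im_part)
  \<comment> \<open>By the Cauchy-Schwarz inequality this bound on \<open>t\<close> keeps
    \<open>2 * (t * (v \<bullet> k))\<close> above -1, so the denominator \<open>N\<close> is
    positive and \<open>shift_lift_surj\<close> applies.\<close>
  define d where "d = 1 / (2 * (norm v * norm k + 1))"
  have "d > 0" by (simp add: d_def add_nonneg_pos)
  moreover have "\<beta> (1 + t *\<^sub>R y) (1 + t *\<^sub>R y) = 0" if t: "t \<in> {0<..<d}" for t
  proof -
    define N where "N = 1 + 2 * ((t *\<^sub>R v) \<bullet> k) + ((t *\<^sub>R v) \<bullet> (t *\<^sub>R v)) * (k \<bullet> k)"
    have "\<bar>v \<bullet> k\<bar> \<le> norm v * norm k" by (rule Cauchy_Schwarz_ineq2)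
    then have "t * \<bar>v \<bullet> k\<bar> \<le> t * (norm v * norm k)" using t by (intro mult_left_mono) auto
    moreover have "t * (2 * (norm v * norm k + 1)) < 1"
    proof -
      have "0 < 2 * (norm v * norm k + 1)" by (simp add: add_nonneg_pos)
      then show ?thesis using t by (simp add: d_def pos_less_divide_eq)
    qed
    moreover have "t * (- \<bar>v \<bullet> k\<bar>) \<le> t * (v \<bullet> k)"
      using t by (intro mult_left_mono) auto
    moreover have "t * (2 * (norm v * norm k + 1)) = 2 * (t * (norm v * norm k)) + 2 * t"
      "t * (- \<bar>v \<bullet> k\<bar>) = - (t * \<bar>v \<bullet> k\<bar>)" by (simp_all add: algebra_simps)
    moreover have "t > 0" using t by simp
    ultimately have "2 * (t * (v \<bullet> k)) > -1" by linarith
    moreover have "((t *\<^sub>R v) \<bullet> (t *\<^sub>R v)) * (k \<bullet> k) \<ge> 0"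
      by (intro mult_nonneg_nonneg inner_ge_zero)
    ultimately have N: "N > 0" by (simp add: N_def)
    have "\<beta> ((1 / N) *\<^sub>R (1 + t *\<^sub>R y)) ((1 / N) *\<^sub>R (1 + t *\<^sub>R y)) = 0"
      using assms(2)[of "(1 / N) *\<^sub>R (t *\<^sub>R v + ((t *\<^sub>R v) \<bullet> (t *\<^sub>R v)) *\<^sub>R k)"]
        shift_lift_surj[of "t *\<^sub>R v" k] N
      by (simp only: N_def[symmetric] v linear_scale[OF linear_im_quat])
    then show ?thesis using N
      by (simp only: bilinear_lmul[OF \<beta>] bilinear_rmul[OF \<beta>]) auto
  qed
  ultimately show "\<exists>d>0. \<forall>t\<in>{0<..<d}. \<beta> (1 + t *\<^sub>R y) (1 + t *\<^sub>R y) = 0" by blast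
qed

section \<open>Skew pairings in R^3 and the fractions they describe\<close>

lemma cross_dual_basis:
  fixes b c d v :: "real ^ 3"
  shows "(b \<bullet> cross3 c d) *\<^sub>R v
    = (v \<bullet> b) *\<^sub>R cross3 c d + (v \<bullet> c) *\<^sub>R cross3 d b + (v \<bullet> d) *\<^sub>R cross3 b c"
  by (simp add: cross3_def vec_eq_iff forall_3 inner_vec_def sum_3 algebra_simps)

lemma cross_skew_inner: "cross3 k x \<bullet> y = - (cross3 k y \<bullet> x)"
  by (simp add: cross3_def inner_vec_def sum_3 algebra_simps)

lemma cross_self_inner: "cross3 k x \<bullet> x = 0"
  by (simp add: cross3_def inner_vec_def sum_3 algebra_simps)

text \<open>When the vectors \<open>b t\<close> span R^3, the pairing makes \<open>a t\<close>
  depend on \<open>b t\<close> through a skew-symmetric matrix, and in dimension three such matrices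
  are cross products.\<close>

lemma skew_family_cross:
  fixes a b :: "'t \<Rightarrow> real ^ 3"
  assumes skew: "\<And>s t. a s \<bullet> b t = - (a t \<bullet> b s)"
    and det: "b t1 \<bullet> cross3 (b t2) (b t3) \<noteq> 0"
  obtains k where "\<And>t. a t = cross3 k (b t)"
proof -
  define d where "d = b t1 \<bullet> cross3 (b t2) (b t3)"
  \<comment> \<open>Determined by
    \<open>k \<bullet> cross3 (b t1) (b t2) = a t1 \<bullet> b t2\<close> and its cyclic variants,
    using the dual basis.\<close>
  define k where "k = (1 / d) *\<^sub>R ((a t2 \<bullet> b t3) *\<^sub>R b t1 + (a t3 \<bullet> b t1) *\<^sub>R b t2 + (a t1 \<bullet> b t2) *\<^sub>R b t3)"
  have orth: "v = 0" if "v \<bullet> b t1 = 0" "v \<bullet> b t2 = 0" "v \<bullet> b t3 = 0" for v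
    using cross_dual_basis[of "b t1" "b t2" "b t3" v] det that by simp
  have self: "a s \<bullet> b s = 0" for s using skew[of s s] by simp
  have kk: "k \<bullet> cross3 (b t1) (b t2) = a t1 \<bullet> b t2" "k \<bullet> cross3 (b t2) (b t3) = a t2 \<bullet> b t3"
    "k \<bullet> cross3 (b t3) (b t1) = a t3 \<bullet> b t1"
  proof -
    have z: "x \<bullet> cross3 x y = 0" "y \<bullet> cross3 x y = 0" for x y :: "real ^ 3"
      by (simp_all add: cross3_def inner_vec_def sum_3 algebra_simps)
    have "b t3 \<bullet> cross3 (b t1) (b t2) = d" "b t2 \<bullet> cross3 (b t3) (b t1) = d"
      by (simp_all add: d_def cross3_def inner_vec_def sum_3 algebra_simps)
    then show "k \<bullet> cross3 (b t1) (b t2) = a t1 \<bullet> b t2" "k \<bullet> cross3 (b t2) (b t3) = a t2 \<bullet> b t3"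
      "k \<bullet> cross3 (b t3) (b t1) = a t3 \<bullet> b t1"
      using det by (simp_all add: k_def inner_add_left z d_def[symmetric])
  qed
  have ks: "cross3 k x \<bullet> y = k \<bullet> cross3 x y" "k \<bullet> cross3 x y = - (k \<bullet> cross3 y x)" for x y
    by (simp_all add: cross3_def inner_vec_def sum_3 algebra_simps)
  have base: "a t1 - cross3 k (b t1) = 0" "a t2 - cross3 k (b t2) = 0" "a t3 - cross3 k (b t3) = 0"
    by (rule orth; simp add: inner_diff_left ks(1) self kk skew[of t2 t1] skew[of t3 t2] skew[of t1 t3]
          ks(2)[of "b t2" "b t1"] ks(2)[of "b t3" "b t2"] ks(2)[of "b t1" "b t3"] cross_refl)+
  have "a t - cross3 k (b t) = 0" for t
  proof -
    have "(a t - cross3 k (b t)) \<bullet> b s = - ((a s - cross3 k (b s)) \<bullet> b t)" for s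
      by (simp add: inner_diff_left skew[of t s] cross_skew_inner[of k "b t" "b s"])
    then show ?thesis using base by (intro orth) simp_all
  qed
  then show ?thesis using that by simp
qed

text \<open>In a plane a skew-symmetric map is a multiple of the quarter turn given by the normal.
  The pairing does not restrict the normal component of \<open>a t\<close>, whence the free function
  \<open>\<mu>\<close>.\<close>

lemma skew_family_cross_plane:
  fixes a b :: "'t \<Rightarrow> real ^ 3"
  assumes skew: "\<And>s t. a s \<bullet> b t = - (a t \<bullet> b s)"
    and plane: "\<And>t. b t \<bullet> cross3 (b t1) (b t2) = 0" and n0: "cross3 (b t1) (b t2) \<noteq> 0"
  obtains \<kappa> \<mu> where "\<And>t. a t = \<kappa> *\<^sub>R cross3 (cross3 (b t1) (b t2)) (b t) + \<mu> t *\<^sub>R cross3 (b t1) (b t2)"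
proof -
  define n where "n = cross3 (b t1) (b t2)"
  define \<kappa> where "\<kappa> = (a t1 \<bullet> b t2) / (n \<bullet> n)"
  have nn: "n \<bullet> n \<noteq> 0" using n0 by (simp add: n_def)
  have det: "b t1 \<bullet> cross3 (b t2) n = n \<bullet> n"
    by (simp add: n_def cross3_def inner_vec_def sum_3 algebra_simps)
  have ks: "cross3 n x \<bullet> y = n \<bullet> cross3 x y" "n \<bullet> cross3 x y = - (n \<bullet> cross3 y x)" for x y
    by (simp_all add: cross3_def inner_vec_def sum_3 algebra_simps)
  have self: "a s \<bullet> b s = 0" for s using skew[of s s] by simp
  define v where "v t = a t - \<kappa> *\<^sub>R cross3 n (b t)" for t
  have vs: "v s \<bullet> b t = - (v t \<bullet> b s)" for s t
    by (simp add: v_def inner_diff_left skew[of s t] cross_skew_inner[of n "b s" "b t"])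
  have v12: "v t1 \<bullet> b t2 = 0" "v t1 \<bullet> b t1 = 0" "v t2 \<bullet> b t2 = 0" "v t2 \<bullet> b t1 = 0"
  proof -
    show 1: "v t1 \<bullet> b t2 = 0"
      using nn by (simp add: v_def inner_diff_left ks n_def[symmetric] \<kappa>_def)
    show "v t2 \<bullet> b t1 = 0" using 1 vs[of t2 t1] by simp
    show "v t1 \<bullet> b t1 = 0" "v t2 \<bullet> b t2 = 0"
      by (simp_all add: v_def inner_diff_left self cross_self_inner)
  qed
  have in_plane: "(n \<bullet> n) *\<^sub>R b t = (b t \<bullet> cross3 (b t2) n) *\<^sub>R b t1 + (b t \<bullet> cross3 n (b t1)) *\<^sub>R b t2" for t
  proof -
    have "(n \<bullet> n) *\<^sub>R x = (x \<bullet> cross3 (b t2) n) *\<^sub>R b t1 + (x \<bullet> cross3 n (b t1)) *\<^sub>R b t2 + (x \<bullet> n) *\<^sub>R n" for x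
      by (simp add: n_def cross3_def vec_eq_iff forall_3 inner_vec_def sum_3 algebra_simps)
    then show ?thesis using plane[of t] by (simp add: n_def)
  qed
  have key: "a t = \<kappa> *\<^sub>R cross3 n (b t) + ((v t \<bullet> n) / (n \<bullet> n)) *\<^sub>R n" for t
  proof -
    have "v s \<bullet> ((n \<bullet> n) *\<^sub>R b t) = 0" if "s = t1 \<or> s = t2" for s
      unfolding in_plane using that v12 by (auto simp: inner_add_right)
    then have "v t1 \<bullet> b t = 0" "v t2 \<bullet> b t = 0" using nn by auto
    then have "v t \<bullet> b t1 = 0" "v t \<bullet> b t2 = 0" using vs[of t t1] vs[of t t2] by simp_all
    then have "(n \<bullet> n) *\<^sub>R v t = (v t \<bullet> n) *\<^sub>R n"
      using cross_dual_basis[of "b t1" "b t2" n "v t"] by (simp add: det n_def[symmetric])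
    then have "(1 / (n \<bullet> n)) *\<^sub>R ((v t \<bullet> n) *\<^sub>R n) = (1 / (n \<bullet> n)) *\<^sub>R ((n \<bullet> n) *\<^sub>R v t)" by simp
    then have 2: "((v t \<bullet> n) / (n \<bullet> n)) *\<^sub>R n = v t" using nn by simp
    show ?thesis unfolding 2 by (simp add: v_def)
  qed
  show ?thesis by (rule that[folded n_def, OF key])
qed

text \<open>Polarisation with the base point \<open>t0\<close> makes \<open>B\<close> imaginary, so
  the imaginary parts of \<open>A\<close> and \<open>B\<close> form a skew pairing. The rank of the
  vectors \<open>b t\<close> decides which Moebius transformation simplifies the fraction.\<close>

lemma degenerate_darboux_form:
  fixes A B :: "quat \<Rightarrow> quat"
  assumes A: "linear A" and B: "linear B" and AB: "\<And>t. A t \<bullet> B t = 0" and t0: "A t0 = 1" "B t0 = 0"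
  obtains G y where "darboux_form G" "G y \<noteq> 0"
    "\<And>t. segre t = 0 \<Longrightarrow> A t \<noteq> 0 \<Longrightarrow> qre (inverse (A t) * B t) = 0 \<Longrightarrow>
       G (im_part (inverse (A t) * B t)) = 0"
proof -
  define a b where ab: "a t = im_part (A t)" "b t = im_part (B t)" for t
  have pol: "A s \<bullet> B t + A t \<bullet> B s = 0" for s t
    using AB[of "s + t"] AB[of s] AB[of t]
    by (simp add: linear_add[OF A] linear_add[OF B] inner_add_left inner_add_right)
  have reB: "qre (B t) = 0" for t
    using pol[of t0 t] by (simp add: t0 inner_quat_def)
  have Bb: "B t = im_quat (b t)" for t by (simp add: ab im_quat_im_part reB)
  have Aa: "A t = qre (A t) *\<^sub>R 1 + im_quat (a t)" for t
    by (simp add: ab quat_eq_iff im_quat_def)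
  have skew: "a s \<bullet> b t = - (a t \<bullet> b s)" for s t
    using pol[of s t] by (simp add: ab inner_im_part reB)
  have quot: "A t * (inverse (A t) * B t) = B t" if "A t \<noteq> 0" for t
    using that by (simp add: mult.assoc[symmetric])
  consider (full) t1 t2 t3 where "b t1 \<bullet> cross3 (b t2) (b t3) \<noteq> 0"
    | (plane) t1 t2 where "cross3 (b t1) (b t2) \<noteq> 0" "\<And>t. b t \<bullet> cross3 (b t1) (b t2) = 0"
    | (line) t1 where "b t1 \<noteq> 0" "\<And>s t. cross3 (b s) (b t) = 0"
    | (zero) "\<And>t. b t = 0"
    by blast
  then show thesis
  proof cases
    case full
    have "\<exists>k. \<forall>t. a t = cross3 k (b t)" by (rule skew_family_cross[OF skew full]) metis
    then obtain k where k: "\<And>t. a t = cross3 k (b t)" by blast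
    \<comment> \<open>Since \<open>a t = cross3 k (b t)\<close>, the product
      \<open>A t * (1 + q * im_quat k)\<close> is the real number
      \<open>qre (A t) - k \<bullet> b t\<close>. The transform of \<open>q\<close> is thus
      \<open>B t\<close> over a real linear form, a point of a projective image of the Segre
      quadric.\<close>
    define L where "L t = (qre (A t) - k \<bullet> b t) *\<^sub>R 1 + B t" for t
    have "linear L"
      unfolding L_def ab
      by (intro linearI) (simp_all add: linear_add[OF A] linear_add[OF B] linear_scale[OF A]
        linear_scale[OF B] linear_add[OF linear_im_part] linear_scale[OF linear_im_part]
        inner_add_right algebra_simps)
    then obtain \<beta> :: "quat \<Rightarrow> quat \<Rightarrow> real" and y where \<beta>: "bilinear \<beta>" "\<beta> y y \<noteq> 0" "\<And>t. segre t = 0 \<Longrightarrow> \<beta> (L t) (L t) = 0"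
      using linear_image_segre by blast
    define G where "G x = \<beta> (shift_lift k x) (shift_lift k x)" for x
    have "darboux_form G" unfolding G_def[abs_def]
      by (intro darboux_form_bilinear \<beta> lin_lift_shift_lift)
    moreover obtain x where "G x \<noteq> 0"
      using shift_lift_nontrivial[OF \<beta>(1)] \<beta>(2) unfolding G_def by blast
    moreover have "G (im_part (inverse (A t) * B t)) = 0"
      if t: "segre t = 0" "A t \<noteq> 0" "qre (inverse (A t) * B t) = 0" for t
    proof -
      define q where "q = inverse (A t) * B t"
      define l where "l = qre (A t) - k \<bullet> b t"
      define N where "N = (1 + q * im_quat k) \<bullet> (1 + q * im_quat k)"
      have q: "im_quat (im_part q) = q" using t(3) by (simp add: q_def im_quat_im_part)
      have Aq: "A t * q = B t" using quot[OF t(2)] by (simp add: q_def)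
      have "A t * (1 + q * im_quat k) = A t + B t * im_quat k"
        by (simp add: distrib_left mult.assoc[symmetric] Aq)
      also have "\<dots> = (qre (A t) *\<^sub>R 1 + im_quat (a t)) + im_quat (b t) * im_quat k"
        by (simp only: Bb[symmetric] Aa[symmetric])
      also have "\<dots> = l *\<^sub>R 1"
        unfolding im_quat_mult k l_def
        by (simp add: quat_eq_iff im_quat_def cross3_def inner_commute algebra_simps)
      finally have Al: "A t * (1 + q * im_quat k) = l *\<^sub>R 1" .
      from pole_shift[OF _ _ this] have sh: "N *\<^sub>R B t = l *\<^sub>R (q - (q \<bullet> q) *\<^sub>R im_quat k)"
        using t(3) by (simp add: q_def[symmetric] Aq N_def)
      have V: "shift_lift k (im_part q) = N *\<^sub>R 1 + (q - (q \<bullet> q) *\<^sub>R im_quat k)"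
        unfolding shift_lift_eq q N_def ..
      obtain r where "shift_lift k (im_part q) = r *\<^sub>R L t"
      proof (cases "l = 0")
        case True
        then have z: "1 + q * im_quat k = 0" using Al t(2) by simp
        then have "shift_lift k (im_part q) = 0 *\<^sub>R L t"
          unfolding V N_def using pole_shift_0[OF _ z] t(3) by (simp add: q_def[symmetric])
        then show ?thesis using that by blast
      next
        case False
        have "(N / l) *\<^sub>R B t = (1 / l) *\<^sub>R (N *\<^sub>R B t)" by simp
        then have "shift_lift k (im_part q) = (N / l) *\<^sub>R L t"
          unfolding V L_def l_def[symmetric] scaleR_add_right sh using False by simp
        then show ?thesis using that by blast
      qed
      then show ?thesis
        unfolding q_def[symmetric] G_def using \<beta>(3)[OF t(1)]
        by (simp add: bilinear_lmul[OF \<beta>(1)] bilinear_rmul[OF \<beta>(1)])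
    qed
    ultimately show thesis using that by blast
  next
    case plane
    define n where "n = cross3 (b t1) (b t2)"
    have "\<exists>\<kappa> \<mu>. \<forall>t. a t = \<kappa> *\<^sub>R cross3 n (b t) + \<mu> t *\<^sub>R n"
      by (rule skew_family_cross_plane[OF skew plane(2,1), folded n_def]) metis
    then obtain \<kappa> \<mu> where am: "\<And>t. a t = \<kappa> *\<^sub>R cross3 n (b t) + \<mu> t *\<^sub>R n" by blast
    \<comment> \<open>The zero set is the preimage of the plane orthogonal to \<open>n\<close> under
      the transformation with \<open>K = \<kappa> *\<^sub>R im_quat n\<close>.\<close>
    define G where "G x = n \<bullet> x - (x \<bullet> x) *\<^sub>R (\<kappa> * (n \<bullet> n))" for x
    have "darboux_form G" unfolding G_def[abs_def]
      by (intro darboux_form_lin_lift lin_lift_diff lin_lift_scaleR lin_lift_sq lin_lift_linear)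
         (simp add: linear_iff inner_add_right)
    moreover have "G n \<noteq> 0 \<or> G (- n) \<noteq> 0"
    proof (rule ccontr)
      assume "\<not> (G n \<noteq> 0 \<or> G (- n) \<noteq> 0)"
      then have "n \<bullet> n = 0" unfolding G_def by auto
      then show False using plane(1) by (simp add: n_def)
    qed
    moreover have "G (im_part (inverse (A t) * B t)) = 0"
      if t: "segre t = 0" "A t \<noteq> 0" "qre (inverse (A t) * B t) = 0" for t
    proof -
      define q where "q = inverse (A t) * B t"
      define K where "K = \<kappa> *\<^sub>R im_quat n"
      define m where "m = qre (A t) *\<^sub>R 1 + \<mu> t *\<^sub>R im_quat n"
      define N where "N = (1 + q * K) \<bullet> (1 + q * K)"
      have K: "qre K = 0" by (simp add: K_def)
      have q: "im_quat (im_part q) = q" using t(3) by (simp add: q_def im_quat_im_part)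
      have Aq: "A t * q = B t" using quot[OF t(2)] by (simp add: q_def)
      have bn: "b t \<bullet> n = 0" using plane(2) by (simp add: n_def)
      have "A t * (1 + q * K) = A t + B t * K"
        by (simp add: distrib_left mult.assoc[symmetric] Aq)
      also have "\<dots> = m"
      proof -
        have "B t * K = \<kappa> *\<^sub>R im_quat (cross3 (b t) n)"
          by (simp add: Bb K_def im_quat_mult bn)
        also have "\<dots> = - im_quat (\<kappa> *\<^sub>R cross3 n (b t))"
          by (simp add: quat_eq_iff im_quat_def cross3_def algebra_simps)
        finally have "A t + B t * K = (qre (A t) *\<^sub>R 1 + im_quat (a t)) - im_quat (\<kappa> *\<^sub>R cross3 n (b t))"
          by (simp only: Aa[symmetric] diff_conv_add_uminus)
        then show ?thesis
          unfolding am m_def by (simp add: linear_add[OF linear_im_quat] linear_scale[OF linear_im_quat])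
      qed
      finally have Am: "A t * (1 + q * K) = m" .
      from pole_shift[OF _ K this] have sh: "N *\<^sub>R B t = m * (q - (q \<bullet> q) *\<^sub>R K)"
        using t(3) by (simp add: q_def[symmetric] Aq N_def)
      have "im_quat n \<bullet> (q - (q \<bullet> q) *\<^sub>R K) = 0"
      proof (cases "m = 0")
        case True
        then have z: "1 + q * K = 0" using Am t(2) by simp
        then show ?thesis using pole_shift_0[OF _ z] t(3) by (simp add: q_def[symmetric])
      next
        case False
        have "(m \<bullet> m) * (im_quat n \<bullet> (q - (q \<bullet> q) *\<^sub>R K)) = (m * im_quat n) \<bullet> (m * (q - (q \<bullet> q) *\<^sub>R K))"
          by (simp add: inner_mult_same_left)
        also have "\<dots> = N * ((m * im_quat n) \<bullet> B t)" unfolding sh[symmetric] by simp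
        \<comment> \<open>\<open>m\<close> and \<open>im_quat n\<close> lie in the commutative field
          spanned by 1 and \<open>im_quat n\<close>, to which \<open>B t\<close> is
          orthogonal.\<close>
        also have "(m * im_quat n) \<bullet> B t = 0"
        proof -
          have "m * im_quat n = qre (A t) *\<^sub>R im_quat n - (\<mu> t * (n \<bullet> n)) *\<^sub>R 1"
            unfolding m_def using im_quat_mult[of n n] by (simp add: distrib_right cross_refl linear_0[OF linear_im_quat])
          moreover have "1 \<bullet> B t = 0" by (simp add: inner_quat_def reB)
          moreover have "im_quat n \<bullet> B t = 0" using bn by (simp add: Bb inner_im_quat inner_commute)
          ultimately show ?thesis by (simp add: inner_diff_left)
        qed
        finally show ?thesis using False by simp
      qed
      then have "im_quat n \<bullet> im_quat (im_part q)
          - (im_quat (im_part q) \<bullet> im_quat (im_part q)) * (\<kappa> * (im_quat n \<bullet> im_quat n)) = 0"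
        unfolding q by (simp add: inner_diff_right K_def)
      then show ?thesis
        unfolding q_def[symmetric] G_def inner_im_quat by simp
    qed
    ultimately show thesis using that by blast
  next
    case line
    define c where "c = B t1"
    have c0: "c \<noteq> 0" using line(1) by (auto simp: c_def ab linear_0[OF linear_im_part])
    define \<phi> where "\<phi> t = (b t \<bullet> b t1) / (b t1 \<bullet> b t1)" for t
    have B\<phi>: "B t = \<phi> t *\<^sub>R c" for t
    proof -
      have "(b t1 \<bullet> b t1) *\<^sub>R b t = (b t \<bullet> b t1) *\<^sub>R b t1 + cross3 (cross3 (b t1) (b t)) (b t1)"
        by (simp add: cross3_def vec_eq_iff forall_3 inner_vec_def sum_3 algebra_simps)
      then have "(b t1 \<bullet> b t1) *\<^sub>R b t = (b t \<bullet> b t1) *\<^sub>R b t1" by (simp add: line(2))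
      then have "b t = \<phi> t *\<^sub>R b t1"
        using line(1) unfolding \<phi>_def
        by (metis inner_eq_zero_iff divide_inverse mult.commute scaleR_scaleR scaleR_one left_inverse)
      then show ?thesis by (simp add: c_def Bb linear_scale[OF linear_im_quat])
    qed
    \<comment> \<open>Here \<open>inverse q\<close> is \<open>inverse c * A t\<close> over the real
      form \<open>\<phi> t\<close>; both \<open>L t\<close> and the vector \<open>V\<close> below
      are homogeneous coordinates of \<open>1 + inverse q\<close>.\<close>
    define L where "L t = \<phi> t *\<^sub>R 1 + inverse c * A t" for t
    have "linear L"
      unfolding L_def \<phi>_def ab
      by (intro linearI) (simp_all add: linear_add[OF A] linear_add[OF B] linear_scale[OF A]
        linear_scale[OF B] linear_add[OF linear_im_part] linear_scale[OF linear_im_part]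
        inner_add_left add_divide_distrib algebra_simps)
    then obtain \<beta> :: "quat \<Rightarrow> quat \<Rightarrow> real" and y where \<beta>: "bilinear \<beta>" "\<beta> y y \<noteq> 0" "\<And>t. segre t = 0 \<Longrightarrow> \<beta> (L t) (L t) = 0"
      using linear_image_segre by blast
    define V where "V x = (x \<bullet> x) *\<^sub>R 1 - im_quat x" for x
    define G where "G x = \<beta> (V x) (V x)" for x
    have "darboux_form G" unfolding G_def[abs_def] V_def
      by (intro darboux_form_bilinear \<beta> lin_lift_diff lin_lift_scaleR lin_lift_sq lin_lift_im_quat)
    moreover have "\<exists>x. G x \<noteq> 0"
    proof (rule ccontr)
      assume G0: "\<not> (\<exists>x. G x \<noteq> 0)"
      have "\<beta> (1 + z) (1 + z) = 0" if z: "qre z = 0" "z \<noteq> 0" for z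
      proof -
        have zz: "z \<bullet> z \<noteq> 0" using z by simp
        \<comment> \<open>The argument is the inverse of the imaginary quaternion
          \<open>z\<close>.\<close>
        have "V (im_part (- (1 / (z \<bullet> z)) *\<^sub>R z)) = (1 / (z \<bullet> z)) *\<^sub>R (1 + z)"
          using zz z(1) unfolding V_def
          by (simp add: inner_im_part im_quat_im_part scaleR_add_right)
        then have "\<beta> ((1 / (z \<bullet> z)) *\<^sub>R (1 + z)) ((1 / (z \<bullet> z)) *\<^sub>R (1 + z)) = 0"
          using G0 unfolding G_def by metis
        then show ?thesis using zz by (simp only: bilinear_lmul[OF \<beta>(1)] bilinear_rmul[OF \<beta>(1)]) auto
      qed
      then have "\<beta> y y = 0"
        by (intro bilinear_eq_0_near_1[OF \<beta>(1)] exI[of _ 1]) auto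
      then show False using \<beta>(2) by simp
    qed
    moreover have "G (im_part (inverse (A t) * B t)) = 0"
      if t: "segre t = 0" "A t \<noteq> 0" "qre (inverse (A t) * B t) = 0" for t
    proof -
      define q where "q = inverse (A t) * B t"
      have q: "im_quat (im_part q) = q" using t(3) by (simp add: q_def im_quat_im_part)
      have Aq: "A t * q = \<phi> t *\<^sub>R c" using quot[OF t(2)] B\<phi> by (simp add: q_def)
      have "\<phi> t *\<^sub>R V (im_part q) = (q \<bullet> q) *\<^sub>R L t"
      proof -
        have "(q \<bullet> q) *\<^sub>R (inverse c * A t) = - (inverse c * (A t * q) * q)"
          using quat_imag_sq[of q] t(3) by (simp add: q_def[symmetric] mult.assoc)
        also have "\<dots> = - (\<phi> t *\<^sub>R q)" unfolding Aq using c0 by simp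
        finally show ?thesis
          unfolding V_def L_def q inner_im_part using t(3)
          by (simp add: q_def[symmetric] algebra_simps)
      qed
      moreover have "V (im_part q) = 0" if "\<phi> t = 0"
      proof -
        have "q = 0" using Aq that t(2) by simp
        then show ?thesis by (simp add: V_def linear_0[OF linear_im_part] linear_0[OF linear_im_quat])
      qed
      ultimately obtain r where "V (im_part q) = r *\<^sub>R L t"
      proof (cases "\<phi> t = 0")
        case True
        then show ?thesis using \<open>\<phi> t = 0 \<Longrightarrow> V (im_part q) = 0\<close> that[of 0] by simp
      next
        case False
        have "V (im_part q) = (1 / \<phi> t) *\<^sub>R (\<phi> t *\<^sub>R V (im_part q))" using False by simp
        also have "\<dots> = ((q \<bullet> q) / \<phi> t) *\<^sub>R L t"
          unfolding \<open>\<phi> t *\<^sub>R V (im_part q) = (q \<bullet> q) *\<^sub>R L t\<close> by simp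
        finally show ?thesis using that by blast
      qed
      then show ?thesis
        unfolding q_def[symmetric] G_def using \<beta>(3)[OF t(1)]
        by (simp add: bilinear_lmul[OF \<beta>(1)] bilinear_rmul[OF \<beta>(1)])
    qed
    ultimately show thesis using that by blast
  next
    case zero
    \<comment> \<open>The fraction is identically 0, so any plane through the origin will
      do.\<close>
    define G where "G x = x $ 1" for x :: "real ^ 3"
    have "darboux_form G" unfolding G_def[abs_def]
      by (intro darboux_form_lin_lift lin_lift_linear) (simp add: linear_iff)
    moreover have "G (axis 1 1) \<noteq> 0" by (simp add: G_def axis_def)
    moreover have "G (im_part (inverse (A t) * B t)) = 0" for t
      by (simp add: G_def Bb zero linear_0[OF linear_im_quat] linear_0[OF linear_im_part])
    ultimately show thesis using that by blast
  qed
qed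

lemma left_fraction_imaginary:
  fixes A B :: "quat \<Rightarrow> quat"
  assumes A: "linear A" and B: "linear B" and "open D" "D \<noteq> {}"
    and nz: "\<And>p. p \<in> D \<Longrightarrow> A (uv p) \<noteq> 0"
    and im: "\<And>p. p \<in> D \<Longrightarrow> qre (inverse (A (uv p)) * B (uv p)) = 0"
  shows "classified D (\<lambda>p. inverse (A (uv p)) * B (uv p))"
proof -
  have "A (uv p) \<bullet> B (uv p) = 0" if "p \<in> D" for p
    using im[OF that] nz[OF that] unfolding qre_inverse_mult by simp
  then obtain l where l: "\<And>t. A t \<bullet> B t = l * segre t"
    using segre_multiple[OF A B assms(3,4)] by blast
  show ?thesis
  proof (cases "l = 0")
    case False
    then show ?thesis using imaginary_left_fraction_nondegenerate[OF A B l] nz im by blast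
  next
    case True
    obtain p0 where p0: "p0 \<in> D" using assms(4) by blast
    define \<alpha> where "\<alpha> = A (uv p0)"
    define q0 where "q0 = inverse \<alpha> * B (uv p0)"
    have \<alpha>: "\<alpha> \<noteq> 0" using nz[OF p0] by (simp add: \<alpha>_def)
    have q0: "qre q0 = 0" using im[OF p0] by (simp add: q0_def \<alpha>_def)
    \<comment> \<open>Left multiplication by \<open>inverse \<alpha>\<close> and subtraction of the
      value \<open>q0\<close> at the base point give \<open>A1 = 1\<close> and \<open>B1 = 0\<close>
      there. Orthogonality survives because \<open>q0\<close> is imaginary.\<close>
    define A1 where "A1 t = inverse \<alpha> * A t" for t
    define B1 where "B1 t = inverse \<alpha> * (B t - A t * q0)" for t
    have lin: "linear A1" "linear B1"
      unfolding A1_def B1_def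
      by (intro linearI, simp_all add: linear_add[OF A] linear_add[OF B] linear_scale[OF A] linear_scale[OF B]
        algebra_simps)+
    have orth: "A1 t \<bullet> B1 t = 0" for t
    proof -
      have "A t \<bullet> (A t * q0) = 0"
        using inner_mult_same_left[of "A t" 1 q0] q0 by (simp add: inner_quat_def)
      then show ?thesis
        using l[of t] True by (simp add: A1_def B1_def inner_mult_same_left inner_diff_right)
    qed
    have base: "A1 (uv p0) = 1" "B1 (uv p0) = 0"
      using \<alpha> by (simp_all add: A1_def B1_def q0_def \<alpha>_def mult.assoc[symmetric])
    have quot: "inverse (A1 (uv p)) * B1 (uv p) = inverse (A (uv p)) * B (uv p) - q0" if "p \<in> D" for p
    proof -
      have "inverse (A1 (uv p)) = inverse (A (uv p)) * \<alpha>"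
        using \<alpha> nz[OF that] by (simp add: A1_def nonzero_inverse_mult_distrib)
      then have "inverse (A1 (uv p)) * B1 (uv p)
        = inverse (A (uv p)) * (\<alpha> * inverse \<alpha>) * (B (uv p) - A (uv p) * q0)"
        by (simp only: B1_def mult.assoc)
      also have "\<dots> = inverse (A (uv p)) * B (uv p) - (inverse (A (uv p)) * A (uv p)) * q0"
        using \<alpha> by (simp add: right_diff_distrib mult.assoc)
      finally show ?thesis using nz[OF that] by simp
    qed
    obtain G y where G: "darboux_form G" "G y \<noteq> 0"
      "\<And>t. segre t = 0 \<Longrightarrow> A1 t \<noteq> 0 \<Longrightarrow> qre (inverse (A1 t) * B1 t) = 0 \<Longrightarrow>
       G (im_part (inverse (A1 t) * B1 t)) = 0"
      using degenerate_darboux_form[OF lin orth base] by metis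
    have "classified D (\<lambda>p. inverse (A1 (uv p)) * B1 (uv p))"
    proof (rule classified_darboux[where G = G and y = y])
      show re: "qre (inverse (A1 (uv p)) * B1 (uv p)) = 0" if "p \<in> D" for p
        using quot[OF that] im[OF that] q0 by simp
      show "G (im_part (inverse (A1 (uv p)) * B1 (uv p))) = 0" if "p \<in> D" for p
        by (rule G(3)) (use re[OF that] nz[OF that] \<alpha> in \<open>simp_all add: A1_def\<close>)
    qed (rule G)+
    moreover have "conf_eq D (\<lambda>p. inverse (A (uv p)) * B (uv p)) (\<lambda>p. inverse (A1 (uv p)) * B1 (uv p))"
      using conf_eq_mult_add[of 1 1 D "\<lambda>p. inverse (A (uv p)) * B (uv p)" "- q0"]
      by (subst conf_eq_cong[OF refl quot]) auto
    ultimately show ?thesis by (rule classified_conf_eq[rotated])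
  qed
qed

section \<open>Spheres and hyperplanes\<close>

text \<open>Stereographic projection from the pole 1 (see \<open>im_part_cayley\<close>), written as
  a fractional linear map so that left fractions stay left fractions.\<close>

definition cayley :: "quat \<Rightarrow> quat" where
  "cayley z = inverse (1 - z) * (1 + z)"

lemma qre_cayley: "norm z = 1 \<Longrightarrow> qre (cayley z) = 0"
  unfolding cayley_def qre_inverse_mult
  by (simp add: norm_eq_1 inner_diff_left inner_add_right inner_commute[of z 1]) (simp add: inner_quat_def)

lemma conf_eq_cayley:
  assumes "\<And>p. p \<in> D \<Longrightarrow> z p \<noteq> 1"
  shows "conf_eq D z (\<lambda>p. cayley (z p))"
proof -
  have e: "cayley w = 2 * inverse (1 - w) * 1 + (- 1)" if "w \<noteq> 1" for w
  proof -
    have "inverse (1 - w) * (1 + w) = inverse (1 - w) * (2 - (1 - w))" by simp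
    also have "\<dots> = inverse (1 - w) * 2 - 1"
    proof -
      have "inverse (1 - w) * (1 - w) = 1" using that by (intro left_inverse) simp
      then show ?thesis by (simp only: right_diff_distrib[of _ 2 "1 - w"])
    qed
    also have "inverse (1 - w) * 2 = 2 * inverse (1 - w)" by (simp add: mult_2 mult_2_right)
    finally show ?thesis by (simp add: cayley_def)
  qed
  have "conf_eq D z (\<lambda>p. 1 - z p)"
    using conf_eq_mult_add[of "-1" 1 D z 1] by (simp add: add.commute[of _ 1])
  moreover have "conf_eq D (\<lambda>p. 1 - z p) (\<lambda>p. inverse (1 - z p))"
    by (rule conf_eq_inverse) (use assms in auto)
  moreover have "conf_eq D (\<lambda>p. inverse (1 - z p)) (\<lambda>p. cayley (z p))"
    using conf_eq_mult_add[of 2 1 D "\<lambda>p. inverse (1 - z p)" "-1"]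
    by (subst conf_eq_cong[OF refl e[OF assms]]) auto
  ultimately show ?thesis by (blast intro: conf_eq_trans)
qed

text \<open>The inverse map \<open>(X - 1) * inverse (X + 1)\<close> with its denominator cleared;
  for imaginary \<open>X\<close> the conjugate of \<open>X + 1\<close> is
  \<open>1 - X\<close>.\<close>

lemma cayley_eq:
  assumes "norm z = 1" "z \<noteq> 1"
  defines "x \<equiv> im_part (cayley z)"
  shows "(1 + x \<bullet> x) *\<^sub>R z = (x \<bullet> x - 1) *\<^sub>R 1 + 2 *\<^sub>R im_quat x"
proof -
  define X where "X = cayley z"
  have X0: "qre X = 0" using qre_cayley[OF assms(1)] by (simp add: X_def)
  have X: "im_quat x = X" using X0 by (simp add: x_def X_def im_quat_im_part)
  have xx: "X * X = - ((x \<bullet> x) *\<^sub>R 1)"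
    using quat_imag_sq[OF X0] X inner_im_quat[of x x] by simp
  have "(1 - z) * X = 1 + z"
    using assms(2) by (simp add: X_def cayley_def mult.assoc[symmetric])
  then have "X - 1 = z * (X + 1)" by (simp add: algebra_simps)
  then have "(X - 1) * (1 - X) = z * ((X + 1) * (1 - X))" by (simp add: mult.assoc)
  moreover have "(X + 1) * (1 - X) = (1 + x \<bullet> x) *\<^sub>R 1"
    using xx by (simp add: algebra_simps)
  moreover have "(X - 1) * (1 - X) = (x \<bullet> x - 1) *\<^sub>R 1 + 2 *\<^sub>R X"
    using xx by (simp add: algebra_simps scaleR_2)
  ultimately show ?thesis using X by simp
qed

text \<open>An affine map takes the sphere to the unit sphere and a direction missed by the surface
  to the pole 1. It multiplies on the right to respect left fractions, and it also keeps
  \<open>z0\<close>, a future witness of nontriviality, off the pole.\<close>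

lemma sphere_chart:
  fixes f :: "real \<times> real \<Rightarrow> quat"
  assumes "f differentiable_on D" "open D" "\<kappa> \<noteq> 0" "n \<bullet> n - 4 * \<kappa> * m > 0"
  shows "\<exists>c a. a \<noteq> 0 \<and> (\<forall>x. on_sphere \<kappa> n m x \<longrightarrow> norm ((x - c) * a) = 1) \<and>
    (\<forall>p\<in>D. (f p - c) * a \<noteq> 1) \<and> (z0 - c) * a \<noteq> 1"
proof -
  define c where "c = (- 1 / (2 * \<kappa>)) *\<^sub>R n"
  define R where "R = sqrt (n \<bullet> n - 4 * \<kappa> * m) / (2 * \<bar>\<kappa>\<bar>)"
  have R: "R > 0" using assms by (simp add: R_def)
  have RR: "R\<^sup>2 = (n \<bullet> n - 4 * \<kappa> * m) / (4 * \<kappa>\<^sup>2)"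
    using assms(4) by (simp add: R_def power_divide power_mult_distrib)
  have "(\<lambda>p. f p - c) differentiable_on D"
    using assms(1) by (intro differentiable_on_diff differentiable_on_const)
  then obtain e where e: "norm e = 1" "\<And>p r. p \<in> D \<Longrightarrow> r > 0 \<Longrightarrow> f p - c \<noteq> r *\<^sub>R e"
    "\<And>r. r > 0 \<Longrightarrow> z0 - c \<noteq> r *\<^sub>R e"
    using exists_missed_direction[of "\<lambda>p. f p - c" D "z0 - c"] assms(2) by blast
  define a where "a = inverse (R *\<^sub>R e)"
  have Re: "R *\<^sub>R e \<noteq> 0" "norm (R *\<^sub>R e) = R" using R e(1) by auto
  have ne: "(x - c) * a \<noteq> 1" if "x - c \<noteq> R *\<^sub>R e" for x
  proof
    assume "(x - c) * a = 1"
    then have "(x - c) * (a * (R *\<^sub>R e)) = R *\<^sub>R e" by (simp only: mult.assoc[symmetric] mult_1)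
    moreover have "a * (R *\<^sub>R e) = 1" unfolding a_def by (rule left_inverse) (rule Re(1))
    ultimately have "(x - c) * 1 = R *\<^sub>R e" by (simp only:)
    then show False using that by simp
  qed
  show ?thesis
  proof (rule exI[of _ c], rule exI[of _ a], intro conjI allI impI ballI)
    show "a \<noteq> 0" using Re by (simp add: a_def)
    show "(f p - c) * a \<noteq> 1" if "p \<in> D" for p using e(2)[OF that R] by (rule ne)
    show "(z0 - c) * a \<noteq> 1" using e(3)[OF R] by (rule ne)
    fix x assume "on_sphere \<kappa> n m x"
    then have s: "\<kappa> * (x \<bullet> x) + n \<bullet> x + m = 0" by (simp add: on_sphere_def)
    have "(norm (x - c))\<^sup>2 = x \<bullet> x + (n \<bullet> x) / \<kappa> + (n \<bullet> n) / (4 * \<kappa>\<^sup>2)"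
      unfolding power2_norm_eq_inner using assms(3)
      by (simp add: c_def inner_add_left inner_add_right inner_commute[of x n] power2_eq_square field_simps)
    also have "\<dots> = (\<kappa> * (x \<bullet> x) + n \<bullet> x + m) / \<kappa> + (n \<bullet> n - 4 * \<kappa> * m) / (4 * \<kappa>\<^sup>2)"
      using assms(3) by (simp add: power2_eq_square field_simps)
    also have "\<dots> = R\<^sup>2" unfolding s RR by simp
    finally have "norm (x - c) = R" using R by (simp add: power2_eq_iff_nonneg)
    then show "norm ((x - c) * a) = 1"
      using R unfolding a_def norm_mult norm_inverse Re by simp
  qed
qed

text \<open>Right multiplication by \<open>quat_cnj n\<close> turns the normal into the real
  axis.\<close>

lemma hyperplane_chart:
  fixes n :: quat
  assumes "n \<noteq> 0" "\<And>p. p \<in> D \<Longrightarrow> on_sphere 0 n m (f p)"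
  shows "conf_eq D f (\<lambda>p. f p * quat_cnj n + m *\<^sub>R 1)"
    and "\<And>p. p \<in> D \<Longrightarrow> qre (f p * quat_cnj n + m *\<^sub>R 1) = 0"
proof -
  show "conf_eq D f (\<lambda>p. f p * quat_cnj n + m *\<^sub>R 1)"
    using conf_eq_mult_add[of 1 "quat_cnj n" D f "m *\<^sub>R 1"] assms(1) by simp
  show "qre (f p * quat_cnj n + m *\<^sub>R 1) = 0" if "p \<in> D" for p
    using assms(2)[OF that] inner_eq_qre_mult_cnj[of "f p" n]
    by (simp add: on_sphere_def inner_commute[of n])
qed

lemma classified_left_fraction:
  fixes A B :: "quat \<Rightarrow> quat"
  assumes A: "linear A" and B: "linear B" and "open D" "D \<noteq> {}"
    and nz: "\<And>p. p \<in> D \<Longrightarrow> A (uv p) \<noteq> 0"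
    and f: "\<And>p. p \<in> D \<Longrightarrow> f p = inverse (A (uv p)) * B (uv p)"
    and "f differentiable_on D" "n \<bullet> n - 4 * \<kappa> * m > 0"
    and sph: "\<And>p. p \<in> D \<Longrightarrow> on_sphere \<kappa> n m (f p)"
  shows "classified D f"
proof (cases "\<kappa> = 0")
  case True
  then have n: "n \<noteq> 0" using assms(8) by auto
  have hc: "conf_eq D f (\<lambda>p. f p * quat_cnj n + m *\<^sub>R 1)"
    using hyperplane_chart(1)[of n D m f] n sph True by blast
  have hc2: "qre (f p * quat_cnj n + m *\<^sub>R 1) = 0" if "p \<in> D" for p
    using hyperplane_chart(2)[of n D m f p] n sph True that by blast
  define B' where "B' t = B t * quat_cnj n + m *\<^sub>R A t" for t
  have lin: "linear B'"
    unfolding B'_def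
    by (intro linearI) (simp_all add: linear_add[OF A] linear_add[OF B] linear_scale[OF A] linear_scale[OF B]
        algebra_simps)
  have e: "f p * quat_cnj n + m *\<^sub>R 1 = inverse (A (uv p)) * B' (uv p)" if "p \<in> D" for p
    unfolding f[OF that] using nz[OF that] by (simp add: B'_def distrib_left mult.assoc)
  have "classified D (\<lambda>p. inverse (A (uv p)) * B' (uv p))"
    using left_fraction_imaginary[OF A lin assms(3,4) nz] hc2 unfolding e by (simp only: e)
  moreover have "conf_eq D f (\<lambda>p. inverse (A (uv p)) * B' (uv p))"
    using hc by (subst conf_eq_cong[OF refl e[symmetric]])
  ultimately show ?thesis by (rule classified_conf_eq[rotated])
next
  case False
  obtain c a where a: "a \<noteq> 0" "\<And>x. on_sphere \<kappa> n m x \<Longrightarrow> norm ((x - c) * a) = 1"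
    "\<And>p. p \<in> D \<Longrightarrow> (f p - c) * a \<noteq> 1"
    using sphere_chart[OF assms(7,3) False assms(8), of 0] by blast
  define z where "z p = (f p - c) * a" for p
  \<comment> \<open>Along the surface \<open>z\<close> is \<open>inverse A * B2\<close>, so
    \<open>cayley z\<close> is the fraction of the linear maps \<open>A - B2\<close> and
    \<open>A + B2\<close>.\<close>
  define B2 where "B2 t = (B t - A t * c) * a" for t
  define A' where "A' t = A t - B2 t" for t
  define B' where "B' t = A t + B2 t" for t
  have lin: "linear A'" "linear B'"
    unfolding A'_def B'_def B2_def
    by (intro linearI, simp_all add: linear_add[OF A] linear_add[OF B] linear_scale[OF A] linear_scale[OF B]
        algebra_simps)+
  have z: "A (uv p) * z p = B2 (uv p)" if "p \<in> D" for p
  proof -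
    have "A (uv p) * z p = ((A (uv p) * inverse (A (uv p))) * B (uv p) - A (uv p) * c) * a"
      unfolding z_def f[OF that] by (simp add: right_diff_distrib left_diff_distrib mult.assoc)
    then show ?thesis using nz[OF that] by (simp add: B2_def)
  qed
  have A'z: "A' (uv p) = A (uv p) * (1 - z p)" "B' (uv p) = A (uv p) * (1 + z p)" if "p \<in> D" for p
    by (simp_all add: A'_def B'_def z[OF that, symmetric] algebra_simps)
  have z1: "1 - z p \<noteq> 0" if "p \<in> D" for p using a(3)[OF that] by (simp add: z_def)
  have A'nz: "A' (uv p) \<noteq> 0" if "p \<in> D" for p
    using A'z[OF that] nz[OF that] z1[OF that] by simp
  have cay: "cayley (z p) = inverse (A' (uv p)) * B' (uv p)" if "p \<in> D" for p
  proof -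
    have "inverse (A' (uv p)) * B' (uv p)
      = inverse (1 - z p) * (inverse (A (uv p)) * A (uv p)) * (1 + z p)"
      unfolding A'z[OF that] nonzero_inverse_mult_distrib[OF nz[OF that] z1[OF that]]
      by (simp only: mult.assoc)
    then show ?thesis using nz[OF that] by (simp add: cayley_def)
  qed
  have "classified D (\<lambda>p. inverse (A' (uv p)) * B' (uv p))"
  proof (rule left_fraction_imaginary[OF lin assms(3,4) A'nz])
    fix p assume p: "p \<in> D"
    show "qre (inverse (A' (uv p)) * B' (uv p)) = 0"
      unfolding cay[OF p, symmetric] z_def by (rule qre_cayley[OF a(2)[OF sph[OF p]]])
  qed
  moreover have "conf_eq D f (\<lambda>p. inverse (A' (uv p)) * B' (uv p))"
  proof (rule conf_eq_trans)
    show "conf_eq D f z"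
      using conf_eq_mult_add[of 1 a D f "- c * a"] a(1) by (simp add: z_def[abs_def] left_diff_distrib)
    show "conf_eq D z (\<lambda>p. inverse (A' (uv p)) * B' (uv p))"
      using conf_eq_cayley[of D z] a(3) by (subst conf_eq_cong[OF refl cay[symmetric]]) (auto simp: z_def)
  qed
  ultimately show ?thesis by (rule classified_conf_eq[rotated])
qed

text \<open>By \<open>cayley_eq\<close>, homogeneous coordinates of points of the sphere are linear
  in \<open>lift3\<close>, so a second quadric through the surface becomes a Darboux form. The point
  \<open>z0\<close> says that this quadric does not contain the sphere.\<close>

lemma classified_quadric:
  fixes f :: "real \<times> real \<Rightarrow> quat" and \<beta> :: "quat \<Rightarrow> quat \<Rightarrow> real"
  assumes "f differentiable_on D" "open D" "\<kappa> \<noteq> 0" "n \<bullet> n - 4 * \<kappa> * m > 0"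
    and sph: "\<And>p. p \<in> D \<Longrightarrow> on_sphere \<kappa> n m (f p)"
    and \<beta>: "bilinear \<beta>" and l: "linear l"
    and quad: "\<And>p. p \<in> D \<Longrightarrow> \<beta> (f p) (f p) + l (f p) + \<mu> = 0"
    and z0: "on_sphere \<kappa> n m z0" "\<beta> z0 z0 + l z0 + \<mu> \<noteq> 0"
  shows "classified D f"
proof -
  obtain c a where a: "a \<noteq> 0" "\<And>x. on_sphere \<kappa> n m x \<Longrightarrow> norm ((x - c) * a) = 1"
    "\<And>p. p \<in> D \<Longrightarrow> (f p - c) * a \<noteq> 1" "(z0 - c) * a \<noteq> 1"
    using sphere_chart[OF assms(1-4), of z0] by blast
  \<comment> \<open>\<open>V x\<close> equals \<open>(1 + x \<bullet> x) *\<^sub>R y\<close> for the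
    point \<open>y\<close> of the sphere with projection \<open>x\<close>.\<close>
  define V where "V x = c + (x \<bullet> x) *\<^sub>R c + ((x \<bullet> x) *\<^sub>R inverse a - inverse a + 2 * im_quat x * inverse a)" for x
  define G where "G x = \<beta> (V x) (V x) + l (V x) * (1 + x \<bullet> x) + (1 + x \<bullet> x) * ((1 + x \<bullet> x) *\<^sub>R \<mu>)" for x
  have lin: "lin_lift V" "lin_lift (\<lambda>x. 1 + x \<bullet> x)"
    unfolding V_def[abs_def]
    by (intro lin_lift_add lin_lift_diff lin_lift_const lin_lift_scaleR lin_lift_sq lin_lift_mult lin_lift_im_quat)+
  have "darboux_form G"
    unfolding G_def[abs_def]
    by (intro darboux_form_add darboux_form_bilinear[OF \<beta>] darboux_form_bilinear[OF bilinear_times]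
      lin_lift_scaleR lin_lift_compose[OF l] lin)
  have val: "G (im_part (cayley ((y - c) * a))) = 0 \<longleftrightarrow> \<beta> y y + l y + \<mu> = 0"
    if y: "norm ((y - c) * a) = 1" "(y - c) * a \<noteq> 1" for y
  proof -
    define x where "x = im_part (cayley ((y - c) * a))"
    have e: "(1 + x \<bullet> x) *\<^sub>R ((y - c) * a) = (x \<bullet> x - 1) *\<^sub>R 1 + 2 *\<^sub>R im_quat x"
      using cayley_eq[OF y] by (simp only: x_def)
    have "(1 + x \<bullet> x) *\<^sub>R ((y - c) * (a * inverse a)) = ((x \<bullet> x - 1) *\<^sub>R 1 + 2 *\<^sub>R im_quat x) * inverse a"
      unfolding e[symmetric] by (simp add: mult.assoc)
    then have "(1 + x \<bullet> x) *\<^sub>R y = V x"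
      using a(1) by (simp add: V_def algebra_simps scaleR_2 mult_2)
    moreover define N where "N = 1 + x \<bullet> x"
    ultimately have V: "V x = N *\<^sub>R y" by simp
    have "N > 0" by (simp add: N_def add_pos_nonneg)
    have "G x = N * N * (\<beta> y y + l y + \<mu>)"
      unfolding G_def V N_def[symmetric]
      by (simp add: bilinear_lmul[OF \<beta>] bilinear_rmul[OF \<beta>] linear_scale[OF l] algebra_simps)
    then show ?thesis using \<open>N > 0\<close> by (simp add: x_def)
  qed
  define h where "h p = cayley ((f p - c) * a)" for p
  have "classified D h"
  proof (rule classified_darboux[where G = G and y = "im_part (cayley ((z0 - c) * a))"])
    show "qre (h p) = 0" if "p \<in> D" for p
      unfolding h_def using qre_cayley a(2)[OF sph[OF that]] by blast
    show "G (im_part (cayley ((z0 - c) * a))) \<noteq> 0" using val[OF a(2)[OF z0(1)] a(4)] z0(2) by simp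
    show "G (im_part (h p)) = 0" if "p \<in> D" for p
      unfolding h_def using val[OF a(2)[OF sph[OF that]] a(3)[OF that]] quad[OF that] by simp
  qed fact
  moreover have "conf_eq D f h"
  proof (rule conf_eq_trans)
    show "conf_eq D f (\<lambda>p. (f p - c) * a)"
      using conf_eq_mult_add[of 1 a D f "- c * a"] a(1) by (simp add: left_diff_distrib)
    show "conf_eq D (\<lambda>p. (f p - c) * a) h"
      using conf_eq_cayley[of D "\<lambda>p. (f p - c) * a"] a(3) by (simp add: h_def[abs_def])
  qed
  ultimately show ?thesis by (rule classified_conf_eq[rotated])
qed

section \<open>Products and sums of two circles\<close>

text \<open>Differentiability is included because the choice of a pole off the surface rests on
  it.\<close>

definition spherical :: "(real \<times> real) set \<Rightarrow> (real \<times> real \<Rightarrow> quat) \<Rightarrow> bool" where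
  "spherical D f \<longleftrightarrow> f differentiable_on D \<and>
     (\<exists>\<kappa> n m. n \<bullet> n - 4 * \<kappa> * m > 0 \<and> (\<forall>p\<in>D. on_sphere \<kappa> n m (f p)))"

lemma spherical_add:
  assumes "spherical D f" shows "spherical D (\<lambda>p. f p + c)"
proof -
  obtain \<kappa> n m where s: "n \<bullet> n - 4 * \<kappa> * m > 0" "\<And>p. p \<in> D \<Longrightarrow> on_sphere \<kappa> n m (f p)"
    using assms by (auto simp: spherical_def)
  have "on_sphere \<kappa> n m (- c + (f p + c))" if "p \<in> D" for p using s(2)[OF that] by simp
  then have "on_sphere \<kappa> (n + (2 * \<kappa>) *\<^sub>R - c) (\<kappa> * (- c \<bullet> - c) + n \<bullet> - c + m) (f p + c)" if "p \<in> D" for p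
    unfolding on_sphere_shift using that by blast
  moreover have "(\<lambda>p. f p + c) differentiable_on D"
    using assms by (intro differentiable_on_add differentiable_on_const) (simp add: spherical_def)
  ultimately show ?thesis
    unfolding spherical_def using s(1) disc_shift[of n \<kappa> "- c" m] by metis
qed

lemma spherical_mult:
  assumes "spherical D f" "a \<noteq> 0" "b \<noteq> 0" shows "spherical D (\<lambda>p. a * f p * b)"
proof -
  obtain \<kappa> n m where s: "n \<bullet> n - 4 * \<kappa> * m > 0" "\<And>p. p \<in> D \<Longrightarrow> on_sphere \<kappa> n m (f p)"
    using assms by (auto simp: spherical_def)
  define N where "N = (a \<bullet> a) * (b \<bullet> b)"
  have N: "N > 0" using assms by (simp add: N_def)
  have i: "(a * x * b) \<bullet> (a * y * b) = N * (x \<bullet> y)" for x y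
    by (simp add: inner_mult_same_left inner_mult_same_right N_def)
  have "on_sphere \<kappa> (a * n * b) (N * m) (a * f p * b)" if "p \<in> D" for p
  proof -
    have "\<kappa> * ((a * f p * b) \<bullet> (a * f p * b)) + (a * n * b) \<bullet> (a * f p * b) + N * m
       = N * (\<kappa> * (f p \<bullet> f p) + n \<bullet> f p + m)"
      unfolding i by (simp add: algebra_simps)
    then show ?thesis using s(2)[OF that] by (simp add: on_sphere_def)
  qed
  moreover have "(a * n * b) \<bullet> (a * n * b) - 4 * \<kappa> * (N * m) > 0"
  proof -
    have "(a * n * b) \<bullet> (a * n * b) - 4 * \<kappa> * (N * m) = N * (n \<bullet> n - 4 * \<kappa> * m)"
      unfolding i by (simp add: algebra_simps)
    then show ?thesis using N s(1) by simp
  qed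
  moreover have "(\<lambda>p. a * f p * b) differentiable_on D"
    using assms by (intro differentiable_on_mult differentiable_on_const) (simp add: spherical_def)
  ultimately show ?thesis unfolding spherical_def by blast
qed

lemma classified_mult_add:
  fixes f :: "'p \<Rightarrow> quat"
  assumes "classified D (\<lambda>p. a * f p * b + c)" "a \<noteq> 0" "b \<noteq> 0" shows "classified D f"
  using classified_conf_eq[OF conf_eq_mult_add[OF assms(2,3)] assms(1)] .

lemma on_sphere_point:
  fixes n :: "'a::real_inner"
  assumes "\<kappa> \<noteq> 0" "n \<bullet> n - 4 * \<kappa> * m > 0"
  obtains c R where "c = (- 1 / (2 * \<kappa>)) *\<^sub>R n" "R > 0" "\<And>v. v \<bullet> v = 1 \<Longrightarrow> on_sphere \<kappa> n m (c + R *\<^sub>R v)"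
proof -
  define c where "c = (- 1 / (2 * \<kappa>)) *\<^sub>R n"
  define R where "R = sqrt (n \<bullet> n - 4 * \<kappa> * m) / (2 * \<bar>\<kappa>\<bar>)"
  have R: "R > 0" using assms by (simp add: R_def)
  have RR: "R * R = (n \<bullet> n - 4 * \<kappa> * m) / (4 * \<kappa> * \<kappa>)"
    using assms(2) by (simp add: R_def)
  have "on_sphere \<kappa> n m (c + R *\<^sub>R v)" if "v \<bullet> v = 1" for v
  proof -
    have 1: "n + (2 * \<kappa>) *\<^sub>R c = 0" using assms(1) by (simp add: c_def)
    have 2: "\<kappa> * (c \<bullet> c) + n \<bullet> c + m = - (n \<bullet> n - 4 * \<kappa> * m) / (4 * \<kappa>)"
      using assms(1) by (simp add: c_def field_simps)
    show ?thesis
      unfolding on_sphere_shift 1 2 using that assms(1)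
      by (simp add: on_sphere_def RR) (simp add: field_simps)
  qed
  then show ?thesis using that R c_def by blast
qed

section \<open>Independence of functions on two circles\<close>

text \<open>Linear independence of the nine products of 1, \<open>X1\<close>, \<open>X2\<close> with
  1, \<open>Y1\<close>, \<open>Y2\<close>. Stated abstractly, it can be transported under rotations
  of either circle.\<close>

definition circle_indep :: "'p set \<Rightarrow> ('p \<Rightarrow> real) \<Rightarrow> ('p \<Rightarrow> real) \<Rightarrow> ('p \<Rightarrow> real) \<Rightarrow> ('p \<Rightarrow> real) \<Rightarrow> bool" where
  "circle_indep D X1 X2 Y1 Y2 \<longleftrightarrow> (\<forall>c00 c01 c02 c10 c11 c12 c20 c21 c22.
     (\<forall>p\<in>D. c00 + c01 * Y1 p + c02 * Y2 p + X1 p * (c10 + c11 * Y1 p + c12 * Y2 p)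
        + X2 p * (c20 + c21 * Y1 p + c22 * Y2 p) = 0) \<longrightarrow>
     c00 = 0 \<and> c01 = 0 \<and> c02 = 0 \<and> c10 = 0 \<and> c11 = 0 \<and> c12 = 0 \<and> c20 = 0 \<and> c21 = 0 \<and> c22 = 0)"

lemma circle_indepD:
  assumes "circle_indep D X1 X2 Y1 Y2"
    and "\<And>p. p \<in> D \<Longrightarrow> c00 + c01 * Y1 p + c02 * Y2 p + X1 p * (c10 + c11 * Y1 p + c12 * Y2 p)
        + X2 p * (c20 + c21 * Y1 p + c22 * Y2 p) = 0"
  shows "c00 = 0" "c01 = 0" "c02 = 0" "c10 = 0" "c11 = 0" "c12 = 0" "c20 = 0" "c21 = 0" "c22 = 0"
  using assms unfolding circle_indep_def by blast+

lemma circle_indep_swap: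
  assumes "circle_indep D X1 X2 Y1 Y2" shows "circle_indep D Y1 Y2 X1 X2"
  unfolding circle_indep_def
proof (intro allI impI)
  fix c00 c01 c02 c10 c11 c12 c20 c21 c22
  assume *: "\<forall>p\<in>D. c00 + c01 * X1 p + c02 * X2 p + Y1 p * (c10 + c11 * X1 p + c12 * X2 p)
        + Y2 p * (c20 + c21 * X1 p + c22 * X2 p) = 0"
  have "c00 + c10 * Y1 p + c20 * Y2 p + X1 p * (c01 + c11 * Y1 p + c21 * Y2 p)
        + X2 p * (c02 + c12 * Y1 p + c22 * Y2 p) = 0" if "p \<in> D" for p
    using *[rule_format, OF that] by (simp add: algebra_simps)
  from circle_indepD[OF assms this]
  show "c00 = 0 \<and> c01 = 0 \<and> c02 = 0 \<and> c10 = 0 \<and> c11 = 0 \<and> c12 = 0 \<and> c20 = 0 \<and> c21 = 0 \<and> c22 = 0"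
    by simp
qed

lemma circle_indep_rotate:
  assumes "circle_indep D X1 X2 Y1 Y2" "a\<^sup>2 + b\<^sup>2 = (1::real)"
  shows "circle_indep D (\<lambda>p. a * X1 p - b * X2 p) (\<lambda>p. b * X1 p + a * X2 p) Y1 Y2"
  unfolding circle_indep_def
proof (intro allI impI)
  fix c00 c01 c02 c10 c11 c12 c20 c21 c22
  assume *: "\<forall>p\<in>D. c00 + c01 * Y1 p + c02 * Y2 p + (a * X1 p - b * X2 p) * (c10 + c11 * Y1 p + c12 * Y2 p)
        + (b * X1 p + a * X2 p) * (c20 + c21 * Y1 p + c22 * Y2 p) = 0"
  have "c00 + c01 * Y1 p + c02 * Y2 p
      + X1 p * ((a * c10 + b * c20) + (a * c11 + b * c21) * Y1 p + (a * c12 + b * c22) * Y2 p)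
      + X2 p * ((a * c20 - b * c10) + (a * c21 - b * c11) * Y1 p + (a * c22 - b * c12) * Y2 p) = 0"
    if "p \<in> D" for p
    using *[rule_format, OF that] by (simp add: algebra_simps)
  note z = circle_indepD[OF assms(1) this]
  have "x = 0 \<and> y = 0" if "a * x + b * y = 0" "a * y - b * x = 0" for x y
  proof -
    have "x = a * (a * x + b * y) - b * (a * y - b * x)" "y = b * (a * x + b * y) + a * (a * y - b * x)"
      using assms(2) by algebra+
    then show ?thesis unfolding that by simp
  qed
  then show "c00 = 0 \<and> c01 = 0 \<and> c02 = 0 \<and> c10 = 0 \<and> c11 = 0 \<and> c12 = 0 \<and> c20 = 0 \<and> c21 = 0 \<and> c22 = 0"
    using z by blast
qed

text \<open>The rational parametrisation of the unit circle coming from the real and imaginary part of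
  \<open>(t + \<i>)\<^sup>-\<^sup>1\<close>.\<close>

definition cos_par :: "real \<Rightarrow> real" where "cos_par t = 2 * t / (t\<^sup>2 + 1)"
definition sin_par :: "real \<Rightarrow> real" where "sin_par t = (t\<^sup>2 - 1) / (t\<^sup>2 + 1)"

lemma par_nonzero: "(t::real)\<^sup>2 + 1 \<noteq> 0"
  using zero_le_power2[of t] by linarith

lemma cos_sin_par: "(cos_par t)\<^sup>2 + (sin_par t)\<^sup>2 = 1"
proof -
  have "(2 * t)\<^sup>2 + (t\<^sup>2 - 1)\<^sup>2 = (t\<^sup>2 + 1)\<^sup>2" by (simp add: power2_eq_square algebra_simps)
  then show ?thesis
    using par_nonzero[of t]
    by (simp add: cos_par_def sin_par_def power_divide add_divide_distrib[symmetric])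
qed

text \<open>Multiplication by \<open>t\<^sup>2 + 1\<close> turns the relation into a quadratic
  polynomial with coefficients \<open>c0 - c2\<close>, \<open>2 * c1\<close>,
  \<open>c0 + c2\<close>.\<close>

lemma par_indep:
  assumes "open U" "x \<in> U" "b \<noteq> 0"
    and z: "\<And>u. u \<in> U \<Longrightarrow> c0 + cos_par ((u + a) / b) * c1 + sin_par ((u + a) / b) * c2 = 0"
  shows "c0 = 0" "c1 = 0" "c2 = 0"
proof -
  let ?V = "(\<lambda>t. b * t - a) -` U"
  have "open ?V" using assms(1) by (intro open_vimage continuous_intros)
  moreover have "(x + a) / b \<in> ?V" using assms(2,3) by simp
  moreover have "(c0 - c2) + (2 * c1) * t + (c0 + c2) * t\<^sup>2 = 0" if "t \<in> ?V" for t
  proof -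
    have "c0 + cos_par t * c1 + sin_par t * c2 = 0"
      using z[of "b * t - a"] that assms(3) by simp
    then have "(t\<^sup>2 + 1) * (c0 + cos_par t * c1 + sin_par t * c2) = 0" by simp
    moreover have "(t\<^sup>2 + 1) * cos_par t = 2 * t" "(t\<^sup>2 + 1) * sin_par t = t\<^sup>2 - 1"
      using par_nonzero[of t] by (simp_all add: cos_par_def sin_par_def)
    ultimately have "(t\<^sup>2 + 1) * c0 + 2 * t * c1 + (t\<^sup>2 - 1) * c2 = 0"
      by (simp only: distrib_left mult.assoc[symmetric])
    then show ?thesis by (simp add: algebra_simps)
  qed
  ultimately have "c0 - c2 = 0 \<and> 2 * c1 = 0 \<and> c0 + c2 = 0"
    using quadratic_eq_0[of ?V "(x + a) / b" "c0 - c2" "2 * c1" "c0 + c2"] by blast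
  then show "c0 = 0" "c1 = 0" "c2 = 0" by auto
qed

lemma circle_indep_par:
  assumes "open D" "D \<noteq> {}" "b \<noteq> 0" "b' \<noteq> 0"
  shows "circle_indep D (\<lambda>p. cos_par ((fst p + a) / b)) (\<lambda>p. sin_par ((fst p + a) / b))
    (\<lambda>p. cos_par ((snd p + a') / b')) (\<lambda>p. sin_par ((snd p + a') / b'))"
  unfolding circle_indep_def
proof (intro allI impI)
  fix c00 c01 c02 c10 c11 c12 c20 c21 c22
  let ?Y1 = "\<lambda>v. cos_par ((v + a') / b')" and ?Y2 = "\<lambda>v. sin_par ((v + a') / b')"
  assume *: "\<forall>p\<in>D. c00 + c01 * ?Y1 (snd p) + c02 * ?Y2 (snd p)
      + cos_par ((fst p + a) / b) * (c10 + c11 * ?Y1 (snd p) + c12 * ?Y2 (snd p))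
      + sin_par ((fst p + a) / b) * (c20 + c21 * ?Y1 (snd p) + c22 * ?Y2 (snd p)) = 0"
  obtain p where p: "p \<in> D" using assms(2) by blast
  obtain U V where UV: "open U" "open V" "p \<in> U \<times> V" "U \<times> V \<subseteq> D"
    using assms(1) p open_prod_elim by blast
  have pU: "fst p \<in> U" "snd p \<in> V" using UV(3) by (auto simp: mem_Times_iff)
  have z: "c00 + ?Y1 v * c01 + ?Y2 v * c02 = 0" "c10 + ?Y1 v * c11 + ?Y2 v * c12 = 0"
    "c20 + ?Y1 v * c21 + ?Y2 v * c22 = 0" if v: "v \<in> V" for v
  proof -
    have e: "(c00 + ?Y1 v * c01 + ?Y2 v * c02) + cos_par ((u + a) / b) * (c10 + ?Y1 v * c11 + ?Y2 v * c12)
      + sin_par ((u + a) / b) * (c20 + ?Y1 v * c21 + ?Y2 v * c22) = 0" if "u \<in> U" for u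
    proof -
      have "(u, v) \<in> D" using UV(4) that v by blast
      from *[rule_format, OF this] show ?thesis by (simp add: mult.commute[of _ c01]
        mult.commute[of _ c02] mult.commute[of _ c11] mult.commute[of _ c12] mult.commute[of _ c21]
        mult.commute[of _ c22])
    qed
    show "c00 + ?Y1 v * c01 + ?Y2 v * c02 = 0" "c10 + ?Y1 v * c11 + ?Y2 v * c12 = 0"
    "c20 + ?Y1 v * c21 + ?Y2 v * c22 = 0"
      using par_indep[OF UV(1) pU(1) assms(3) e] by auto
  qed
  show "c00 = 0 \<and> c01 = 0 \<and> c02 = 0 \<and> c10 = 0 \<and> c11 = 0 \<and> c12 = 0 \<and> c20 = 0 \<and> c21 = 0 \<and> c22 = 0"
    using par_indep[OF UV(2) pU(2) assms(4) z(1)] par_indep[OF UV(2) pU(2) assms(4) z(2)]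
      par_indep[OF UV(2) pU(2) assms(4) z(3)] by auto
qed

section \<open>Circles in quaternionic planes, their products and sums\<close>

definition unit_imag :: "quat \<Rightarrow> bool" where
  "unit_imag I \<longleftrightarrow> qre I = 0 \<and> I \<bullet> I = 1"

lemma unit_imag_sq: "unit_imag I \<Longrightarrow> I * I = - 1"
  by (simp add: unit_imag_def quat_imag_sq)

lemma inner_one_quat: "1 \<bullet> x = qre x" "x \<bullet> 1 = qre x"
  by (simp_all add: inner_quat_def)

text \<open>The reciprocal of a line in the plane of 1 and \<open>I\<close> is a circle through 0,
  with centre \<open>(- 1 / (2 * b)) *\<^sub>R I\<close> and radius
  \<open>1 / (2 * \<bar>b\<bar>)\<close>.\<close>

lemma inverse_affine:
  assumes "unit_imag I" "b \<noteq> 0"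
  shows "inverse ((u + a) *\<^sub>R 1 + b *\<^sub>R I)
    = (1 / (2 * b)) *\<^sub>R (cos_par ((u + a) / b) *\<^sub>R 1 + (sin_par ((u + a) / b) - 1) *\<^sub>R I)"
proof (rule inverse_unique)
  define t where "t = (u + a) / b"
  have e: "(u + a) *\<^sub>R 1 + b *\<^sub>R I = b *\<^sub>R (t *\<^sub>R 1 + I)" using assms(2) by (simp add: t_def scaleR_add_right)
  have "cos_par t *\<^sub>R 1 + (sin_par t - 1) *\<^sub>R I = (2 / (t\<^sup>2 + 1)) *\<^sub>R (t *\<^sub>R 1 - I)"
  proof -
    have "sin_par t - 1 = - 2 / (t\<^sup>2 + 1)" using par_nonzero[of t] by (simp add: sin_par_def field_simps)
    then show ?thesis by (simp add: cos_par_def scaleR_diff_right mult.commute)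
  qed
  moreover have "(t *\<^sub>R 1 + I) * (t *\<^sub>R 1 - I) = (t\<^sup>2 + 1) *\<^sub>R 1"
    using unit_imag_sq[OF assms(1)] by (simp add: algebra_simps power2_eq_square)
  ultimately show "((u + a) *\<^sub>R 1 + b *\<^sub>R I) * ((1 / (2 * b)) *\<^sub>R (cos_par ((u + a) / b) *\<^sub>R 1 + (sin_par ((u + a) / b) - 1) *\<^sub>R I)) = 1"
    unfolding t_def[symmetric] e using assms(2) par_nonzero[of t] by simp
qed

lemma im_part_cayley: "norm z = 1 \<Longrightarrow> z \<noteq> 1 \<Longrightarrow> im_part (cayley z) = stereographic z"
proof -
  assume z: "norm z = 1" "z \<noteq> 1"
  have "(1 - z) \<bullet> (1 - z) = 2 * (1 - qre z)"
    using z(1) by (simp add: norm_eq_1 inner_diff_left inner_diff_right inner_one_quat)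
  then have "cayley z = (1 / (2 * (1 - qre z))) *\<^sub>R (quat_cnj (1 - z) * (1 + z))"
    unfolding cayley_def quat_inverse by simp
  moreover have "im_part (quat_cnj (1 - z) * (1 + z)) = 2 *\<^sub>R im_part z"
    by (simp add: vec_eq_iff forall_3 quat_cnj_def algebra_simps)
  ultimately have "im_part (cayley z) = (1 / (2 * (1 - qre z))) *\<^sub>R (2 *\<^sub>R im_part z)"
    by (simp only: linear_scale[OF linear_im_part])
  then show ?thesis by (simp add: stereographic_def del: right_diff_distrib_numeral)
qed

lemma unit_circle_mult:
  fixes p0 :: quat
  assumes "unit_imag I" "X\<^sup>2 + Y\<^sup>2 = 1"
  shows "(p0 + X *\<^sub>R 1 + Y *\<^sub>R I) \<bullet> (p0 + X *\<^sub>R 1 + Y *\<^sub>R I)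
    = p0 \<bullet> p0 + 1 + 2 * X * qre p0 + 2 * Y * (p0 \<bullet> I)"
proof -
  have I: "qre I = 0" "I \<bullet> I = 1" using assms(1) by (auto simp: unit_imag_def)
  have "(p0 + X *\<^sub>R 1 + Y *\<^sub>R I) \<bullet> (p0 + X *\<^sub>R 1 + Y *\<^sub>R I)
    = p0 \<bullet> p0 + (X\<^sup>2 + Y\<^sup>2) + 2 * X * qre p0 + 2 * Y * (p0 \<bullet> I)"
    by (simp add: inner_add_left inner_add_right inner_one_quat I inner_commute[of I p0]
      power2_eq_square algebra_simps)
  then show ?thesis using assms(2) by simp
qed

text \<open>The conditions on \<open>p0\<close> and \<open>q0\<close> say that both factors have constant norm.\<close>

lemma classified_clifford:
  assumes sph: "spherical D f" and "open D" and I: "unit_imag I" and J: "unit_imag J"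
    and f: "\<And>p. p \<in> D \<Longrightarrow> f p = (p0 + X1 p *\<^sub>R 1 + X2 p *\<^sub>R I) * (q0 + Y1 p *\<^sub>R 1 + Y2 p *\<^sub>R J)"
    and X: "\<And>p. p \<in> D \<Longrightarrow> (X1 p)\<^sup>2 + (X2 p)\<^sup>2 = 1" and Y: "\<And>p. p \<in> D \<Longrightarrow> (Y1 p)\<^sup>2 + (Y2 p)\<^sup>2 = 1"
    and p0: "qre p0 = 0" "p0 \<bullet> I = 0" and q0: "qre q0 = 0" "q0 \<bullet> J = 0"
  shows "classified D f"
proof -
  have IJ: "qre I = 0" "I \<bullet> I = 1" "qre J = 0" "J \<bullet> J = 1" using I J by (auto simp: unit_imag_def)
  have nI: "norm I = 1" using IJ by (simp add: norm_eq_1)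
  define r1 where "r1 = sqrt (p0 \<bullet> p0 + 1)"
  define r2 where "r2 = sqrt (q0 \<bullet> q0 + 1)"
  have r: "r1 > 0" "r2 > 0" by (simp_all add: r1_def r2_def add_nonneg_pos)
  have nP: "norm (p0 + a *\<^sub>R 1 + b *\<^sub>R I) = r1" if "a\<^sup>2 + b\<^sup>2 = 1" for a b
    unfolding norm_eq_sqrt_inner unit_circle_mult[OF I that] by (simp add: p0 r1_def)
  have nQ: "norm (q0 + a *\<^sub>R 1 + b *\<^sub>R J) = r2" if "a\<^sup>2 + b\<^sup>2 = 1" for a b
    unfolding norm_eq_sqrt_inner unit_circle_mult[OF J that] by (simp add: q0 r2_def)
  have nf: "norm (f p) = r1 * r2" if "p \<in> D" for p
    unfolding f[OF that] norm_mult nP[OF X[OF that]] nQ[OF Y[OF that]] ..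
  have diff: "f differentiable_on D" using sph by (simp add: spherical_def)
  \<comment> \<open>Right multiplication by \<open>inverse e\<close> moves the missed direction to
    the pole 1; the second circle absorbs this factor.\<close>
  obtain e where e: "norm e = 1" "\<And>p t. p \<in> D \<Longrightarrow> t > 0 \<Longrightarrow> f p \<noteq> t *\<^sub>R e"
    using exists_missed_direction[OF diff assms(2), of 0] by metis
  define e' where "e' = inverse e"
  have e': "e' \<noteq> 0" "norm e' = 1" "e' * e = 1"
  proof -
    have "e \<noteq> 0" using e(1) by auto
    then show "e' \<noteq> 0" "norm e' = 1" "e' * e = 1" using e(1) by (auto simp: e'_def norm_inverse)
  qed
  define z where "z p = (1 / (r1 * r2)) *\<^sub>R (f p * e')" for p
  have nz: "norm (z p) = 1" if "p \<in> D" for p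
    using nf[OF that] r e'(2) by (simp add: z_def norm_mult)
  have z1: "z p \<noteq> 1" if "p \<in> D" for p
  proof
    assume "z p = 1"
    then have "(r1 * r2) *\<^sub>R (z p * e) = (r1 * r2) *\<^sub>R e" by simp
    then have "f p = (r1 * r2) *\<^sub>R e" using r e'(3) by (simp add: z_def mult.assoc)
    then show False using e(2)[OF that, of "r1 * r2"] r by simp
  qed
  define \<alpha> where "\<alpha> = {(1 / r1) *\<^sub>R p0 + a *\<^sub>R ((1 / r1) *\<^sub>R 1) + b *\<^sub>R ((1 / r1) *\<^sub>R I) | a b. a\<^sup>2 + b\<^sup>2 = 1}"
  define \<beta> where "\<beta> = {(1 / r2) *\<^sub>R (q0 * e') + a *\<^sub>R ((1 / r2) *\<^sub>R e') + b *\<^sub>R ((1 / r2) *\<^sub>R (J * e')) | a b. a\<^sup>2 + b\<^sup>2 = 1}"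
  have \<alpha>_el: "(1 / r1) *\<^sub>R p0 + a *\<^sub>R ((1 / r1) *\<^sub>R 1) + b *\<^sub>R ((1 / r1) *\<^sub>R I) = (1 / r1) *\<^sub>R (p0 + a *\<^sub>R 1 + b *\<^sub>R I)" for a b
    by (simp add: scaleR_add_right mult.commute)
  have \<beta>_el: "(1 / r2) *\<^sub>R (q0 * e') + a *\<^sub>R ((1 / r2) *\<^sub>R e') + b *\<^sub>R ((1 / r2) *\<^sub>R (J * e'))
     = (1 / r2) *\<^sub>R ((q0 + a *\<^sub>R 1 + b *\<^sub>R J) * e')" for a b
    by (simp add: scaleR_add_right distrib_right mult.commute)
  have "circle \<alpha>"
    unfolding \<alpha>_def
    by (rule circle_param[of _ _ "1 / r1"]) (use r IJ nI in \<open>simp_all add: inner_one_quat\<close>)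
  moreover have "circle \<beta>"
  proof -
    have "e' \<bullet> (J * e') = 0" using inner_mult_same_right[of 1 e' J] IJ by (simp add: inner_one_quat)
    moreover have "norm (J * e') = 1" using e'(2) IJ by (simp add: norm_mult norm_eq_1[symmetric])
    ultimately show ?thesis
      unfolding \<beta>_def by (intro circle_param[of _ _ "1 / r2"]) (use r e' in simp_all)
  qed
  moreover have "\<alpha> \<subseteq> sphere 0 1"
    unfolding \<alpha>_def \<alpha>_el using nP r by auto
  moreover have "\<beta> \<subseteq> sphere 0 1"
    unfolding \<beta>_def \<beta>_el using nQ r e' by (auto simp: norm_mult)
  ultimately have cl: "clifford_translational (stereographic ` ({p * q | p q. p \<in> \<alpha> \<and> q \<in> \<beta>} - {1}))"
    unfolding clifford_translational_def by blast
  have zin: "z p \<in> {p * q | p q. p \<in> \<alpha> \<and> q \<in> \<beta>} - {1}" if "p \<in> D" for p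
  proof -
    have "z p = ((1 / r1) *\<^sub>R (p0 + X1 p *\<^sub>R 1 + X2 p *\<^sub>R I)) * ((1 / r2) *\<^sub>R ((q0 + Y1 p *\<^sub>R 1 + Y2 p *\<^sub>R J) * e'))"
      unfolding z_def f[OF that] by (simp add: mult.assoc)
    moreover have "(1 / r1) *\<^sub>R (p0 + X1 p *\<^sub>R 1 + X2 p *\<^sub>R I) \<in> \<alpha>"
      unfolding \<alpha>_def \<alpha>_el using X[OF that] by blast
    moreover have "(1 / r2) *\<^sub>R ((q0 + Y1 p *\<^sub>R 1 + Y2 p *\<^sub>R J) * e') \<in> \<beta>"
      unfolding \<beta>_def \<beta>_el using Y[OF that] by blast
    ultimately show ?thesis using z1[OF that] by blast
  qed
  have "conf_eq D f z"
    using conf_eq_mult_add[of "(1 / (r1 * r2)) *\<^sub>R 1" e' D f 0] r e' by (simp add: z_def[abs_def])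
  moreover have "conf_eq D z (\<lambda>p. cayley (z p))" by (rule conf_eq_cayley) (rule z1)
  moreover have "conf_eq D (\<lambda>p. cayley (z p)) (\<lambda>p. im_part (cayley (z p)))"
    by (rule conf_eq_im_part) (rule qre_cayley[OF nz])
  ultimately have "conf_eq D f (\<lambda>p. im_part (cayley (z p)))" by (blast intro: conf_eq_trans)
  moreover have "conf_eq D f (\<lambda>p. im_part (cayley (z p))) \<longleftrightarrow> conf_eq D f (\<lambda>p. stereographic (z p))"
    by (rule conf_eq_cong) (simp_all add: im_part_cayley nz z1)
  ultimately have "conf_eq D f (\<lambda>p. stereographic (z p))" by simp
  moreover have "(\<lambda>p. stereographic (z p)) ` D \<subseteq> stereographic ` ({p * q | p q. p \<in> \<alpha> \<and> q \<in> \<beta>} - {1})"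
    using zin by blast
  ultimately show ?thesis unfolding classified_def using cl by blast
qed

text \<open>In the sphere equation the mixed coefficients are \<open>2 * \<kappa>\<close> times
  inner products between the planes of the circles. If \<open>\<kappa> = 0\<close>, the linear
  coefficients make both planes parallel to the hyperplane, and the surface is Euclidean
  translational. Otherwise the planes are orthogonal, and the surface lies on a quadric cylinder
  over the first circle.\<close>

lemma classified_sum:
  assumes sph: "spherical D f" and "open D" "D \<noteq> {}" and I: "unit_imag I" and J: "unit_imag J"
    and f: "\<And>s. s \<in> D \<Longrightarrow> f s = k + (X1 s *\<^sub>R 1 + X2 s *\<^sub>R I) * q + p * (Y1 s *\<^sub>R 1 + Y2 s *\<^sub>R J)"
    and X: "\<And>s. s \<in> D \<Longrightarrow> (X1 s)\<^sup>2 + (X2 s)\<^sup>2 = 1" and Y: "\<And>s. s \<in> D \<Longrightarrow> (Y1 s)\<^sup>2 + (Y2 s)\<^sup>2 = 1"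
    and ind: "circle_indep D X1 X2 Y1 Y2" and pq: "p \<noteq> 0" "q \<noteq> 0"
  shows "classified D f"
proof -
  have IJ: "qre I = 0" "I \<bullet> I = 1" "qre J = 0" "J \<bullet> J = 1" using I J by (auto simp: unit_imag_def)
  obtain \<kappa> n m where disc: "n \<bullet> n - 4 * \<kappa> * m > 0" and on: "\<And>s. s \<in> D \<Longrightarrow> on_sphere \<kappa> n m (f s)"
    and diff: "f differentiable_on D"
    using sph by (auto simp: spherical_def)
  define q' p' where qp': "q' = I * q" "p' = p * J"
  have f': "f s = k + X1 s *\<^sub>R q + X2 s *\<^sub>R q' + Y1 s *\<^sub>R p + Y2 s *\<^sub>R p'" if "s \<in> D" for s
    by (simp add: f[OF that] qp' distrib_left distrib_right)
  have orth: "q \<bullet> q' = 0" "q' \<bullet> q' = q \<bullet> q" "p \<bullet> p' = 0" "p' \<bullet> p' = p \<bullet> p"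
    using inner_mult_same_right[of 1 q I] inner_mult_same_right[of I q I]
      inner_mult_same_left[of p 1 J] inner_mult_same_left[of p J J] IJ
    by (simp_all add: qp' inner_one_quat)
  let ?K = "\<kappa> * (k \<bullet> k + q \<bullet> q + p \<bullet> p) + n \<bullet> k + m"
  have z: "?K + (2 * \<kappa> * (k \<bullet> p) + n \<bullet> p) * Y1 s + (2 * \<kappa> * (k \<bullet> p') + n \<bullet> p') * Y2 s
    + X1 s * ((2 * \<kappa> * (k \<bullet> q) + n \<bullet> q) + (2 * \<kappa> * (q \<bullet> p)) * Y1 s + (2 * \<kappa> * (q \<bullet> p')) * Y2 s)
    + X2 s * ((2 * \<kappa> * (k \<bullet> q') + n \<bullet> q') + (2 * \<kappa> * (q' \<bullet> p)) * Y1 s + (2 * \<kappa> * (q' \<bullet> p')) * Y2 s) = 0"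
    if s: "s \<in> D" for s
  proof -
    have ff: "f s \<bullet> f s = k \<bullet> k + ((X1 s)\<^sup>2 + (X2 s)\<^sup>2) * (q \<bullet> q) + ((Y1 s)\<^sup>2 + (Y2 s)\<^sup>2) * (p \<bullet> p)
      + 2 * (X1 s * (k \<bullet> q) + X2 s * (k \<bullet> q') + Y1 s * (k \<bullet> p) + Y2 s * (k \<bullet> p'))
      + 2 * (X1 s * Y1 s * (q \<bullet> p) + X1 s * Y2 s * (q \<bullet> p') + X2 s * Y1 s * (q' \<bullet> p) + X2 s * Y2 s * (q' \<bullet> p'))"
      unfolding f'[OF s]
      by (simp add: inner_add_left inner_add_right orth inner_commute[of q k] inner_commute[of q' k]
        inner_commute[of p k] inner_commute[of p' k] inner_commute[of q' q] inner_commute[of p' p]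
        inner_commute[of p q] inner_commute[of p' q] inner_commute[of p q'] inner_commute[of p' q']
        power2_eq_square algebra_simps)
    have nf: "n \<bullet> f s = n \<bullet> k + X1 s * (n \<bullet> q) + X2 s * (n \<bullet> q') + Y1 s * (n \<bullet> p) + Y2 s * (n \<bullet> p')"
      unfolding f'[OF s] by (simp add: inner_add_right)
    show ?thesis
      using on[OF s] unfolding on_sphere_def ff nf X[OF s] Y[OF s] by (simp add: algebra_simps)
  qed
  note c = circle_indepD[OF ind z]
  show ?thesis
  proof (cases "\<kappa> = 0")
    case True
    then have n0: "n \<noteq> 0" using disc by auto
    have n: "n \<bullet> p = 0" "n \<bullet> p' = 0" "n \<bullet> q = 0" "n \<bullet> q' = 0" "n \<bullet> k + m = 0"
      using c True by auto
    define h where "h s = f s * quat_cnj n + m *\<^sub>R 1" for s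
    have hc: "conf_eq D f h" "\<And>s. s \<in> D \<Longrightarrow> qre (h s) = 0"
      unfolding h_def using hyperplane_chart[OF n0, of D m f] on True by auto
    \<comment> \<open>On the orthogonal complement of \<open>n\<close> this is a similarity onto R^3
      with factor \<open>norm n\<close>.\<close>
    define g where "g x = im_part (x * quat_cnj n)" for x
    have g_inner: "g x \<bullet> g y = (n \<bullet> n) * (x \<bullet> y)" if "n \<bullet> x = 0" for x y
      using that inner_mult_same_right[of x "quat_cnj n" y] inner_eq_qre_mult_cnj[of x n]
      by (simp add: g_def inner_im_part inner_quat_cnj inner_commute[of x n])
    have g_lin: "g (x + y) = g x + g y" "g (r *\<^sub>R x) = r *\<^sub>R g x" for x y r
      by (simp_all add: g_def distrib_right linear_add[OF linear_im_part] linear_scale[OF linear_im_part])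
    define \<alpha> where "\<alpha> = {0 + a *\<^sub>R g q + b *\<^sub>R g q' | a b. a\<^sup>2 + b\<^sup>2 = 1}"
    define \<beta> where "\<beta> = {g k + a *\<^sub>R g p + b *\<^sub>R g p' | a b. a\<^sup>2 + b\<^sup>2 = 1}"
    have "circle \<alpha>"
      unfolding \<alpha>_def
      by (rule circle_param[of _ _ "sqrt ((n \<bullet> n) * (q \<bullet> q))"])
         (use n0 pq in \<open>simp_all add: norm_eq_sqrt_inner g_inner n orth\<close>)
    moreover have "circle \<beta>"
      unfolding \<beta>_def
      by (rule circle_param[of _ _ "sqrt ((n \<bullet> n) * (p \<bullet> p))"])
         (use n0 pq in \<open>simp_all add: norm_eq_sqrt_inner g_inner n orth\<close>)
    ultimately have eu: "euclidean_translational {x + y | x y. x \<in> \<alpha> \<and> y \<in> \<beta>}"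
      unfolding euclidean_translational_def by blast
    have "im_part (h s) \<in> {x + y | x y. x \<in> \<alpha> \<and> y \<in> \<beta>}" if s: "s \<in> D" for s
    proof -
      have "im_part (h s) = g (f s)"
        by (simp add: h_def g_def linear_add[OF linear_im_part]) (simp add: vec_eq_iff forall_3)
      also have "\<dots> = (0 + X1 s *\<^sub>R g q + X2 s *\<^sub>R g q') + (g k + Y1 s *\<^sub>R g p + Y2 s *\<^sub>R g p')"
        unfolding f'[OF s] g_lin by simp
      finally show ?thesis unfolding \<alpha>_def \<beta>_def using X[OF s] Y[OF s] by blast
    qed
    moreover have "conf_eq D f (\<lambda>s. im_part (h s))"
      using conf_eq_trans[OF hc(1) conf_eq_im_part[OF hc(2)]] by simp
    moreover from calculation have "(\<lambda>s. im_part (h s)) ` D \<subseteq> {x + y | x y. x \<in> \<alpha> \<and> y \<in> \<beta>}" by blast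
    ultimately show ?thesis unfolding classified_def using eu by blast
  next
    case False
    then have qp: "q \<bullet> p = 0" "q \<bullet> p' = 0" "q' \<bullet> p = 0" "q' \<bullet> p' = 0" using c by auto
    \<comment> \<open>The equation of the cylinder: the orthogonal projection of
      \<open>x - k\<close> to the plane of \<open>q\<close> and \<open>q'\<close> lies on the first
      circle.\<close>
    define \<beta> where "\<beta> x y = (x \<bullet> q) * (y \<bullet> q) + (x \<bullet> q') * (y \<bullet> q')" for x y
    define l where "l x = - 2 * (k \<bullet> q) * (x \<bullet> q) - 2 * (k \<bullet> q') * (x \<bullet> q')" for x
    define \<mu> where "\<mu> = (k \<bullet> q)\<^sup>2 + (k \<bullet> q')\<^sup>2 - (q \<bullet> q)\<^sup>2"
    have quad: "\<beta> x x + l x + \<mu> = ((x - k) \<bullet> q)\<^sup>2 + ((x - k) \<bullet> q')\<^sup>2 - (q \<bullet> q)\<^sup>2" for x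
      by (simp add: \<beta>_def l_def \<mu>_def inner_diff_left power2_eq_square algebra_simps)
    have b: "bilinear \<beta>" "linear l"
      unfolding bilinear_def linear_iff \<beta>_def l_def by (simp_all add: inner_add_left algebra_simps)
    obtain c0 R where R: "R > 0" and pt: "\<And>v. v \<bullet> v = 1 \<Longrightarrow> on_sphere \<kappa> n m (c0 + R *\<^sub>R v)"
      using on_sphere_point[OF False disc] by metis
    have nn: "norm q > 0" "norm p > 0" "q \<bullet> q = (norm q)\<^sup>2" "p \<bullet> p = (norm p)\<^sup>2"
      using pq by (simp_all add: dot_square_norm)
    define v where "v = (1 / norm q) *\<^sub>R q"
    define w where "w = (1 / norm p) *\<^sub>R p"
    have vw: "v \<bullet> v = 1" "w \<bullet> w = 1" "v \<bullet> q = norm q" "v \<bullet> q' = 0" "w \<bullet> q = 0" "w \<bullet> q' = 0"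
      using nn qp orth by (simp_all add: v_def w_def inner_commute[of p q] inner_commute[of p q'] power2_eq_square)
    have "\<exists>z0. on_sphere \<kappa> n m z0 \<and> \<beta> z0 z0 + l z0 + \<mu> \<noteq> 0"
    proof (rule ccontr)
      assume "\<not> (\<exists>z0. on_sphere \<kappa> n m z0 \<and> \<beta> z0 z0 + l z0 + \<mu> \<noteq> 0)"
      then have *: "((c0 + R *\<^sub>R x - k) \<bullet> q)\<^sup>2 + ((c0 + R *\<^sub>R x - k) \<bullet> q')\<^sup>2 - (q \<bullet> q)\<^sup>2 = 0" if "x \<bullet> x = 1" for x
        using pt[OF that] quad by metis
      define a where "a = (c0 - k) \<bullet> q"
      define b where "b = (c0 - k) \<bullet> q'"
      have e: "(c0 + R *\<^sub>R x - k) \<bullet> y = (c0 - k) \<bullet> y + R * (x \<bullet> y)" for x y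
        by (simp add: inner_add_left inner_diff_left)
      \<comment> \<open>A second difference along the diameter in direction \<open>q\<close>. The
        point in direction \<open>w\<close> gives the same value as the centre, because
        \<open>w\<close> is orthogonal to \<open>q\<close> and \<open>q'\<close>.\<close>
      have "(a + R * norm q)\<^sup>2 + b\<^sup>2 - (q \<bullet> q)\<^sup>2 = 0" "(a - R * norm q)\<^sup>2 + b\<^sup>2 - (q \<bullet> q)\<^sup>2 = 0"
        "a\<^sup>2 + b\<^sup>2 - (q \<bullet> q)\<^sup>2 = 0"
        using *[of v] *[of "- v"] *[of w] unfolding e by (simp_all add: vw a_def b_def)
      moreover have "2 * (R * norm q)\<^sup>2 = ((a + R * norm q)\<^sup>2 + b\<^sup>2 - (q \<bullet> q)\<^sup>2)
        + ((a - R * norm q)\<^sup>2 + b\<^sup>2 - (q \<bullet> q)\<^sup>2) - 2 * (a\<^sup>2 + b\<^sup>2 - (q \<bullet> q)\<^sup>2)"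
        by (simp add: power2_eq_square algebra_simps)
      ultimately have "(R * norm q)\<^sup>2 = 0" by simp
      then show False using R nn by simp
    qed
    then obtain z0 where z0: "on_sphere \<kappa> n m z0" "\<beta> z0 z0 + l z0 + \<mu> \<noteq> 0" by blast
    show ?thesis
    proof (rule classified_quadric[OF diff assms(2) False disc])
      show "on_sphere \<kappa> n m (f s)" if "s \<in> D" for s by (rule on[OF that])
      show "bilinear \<beta>" "linear l" "on_sphere \<kappa> n m z0" "\<beta> z0 z0 + l z0 + \<mu> \<noteq> 0" by fact+
      fix s assume s: "s \<in> D"
      have "(f s - k) \<bullet> q = X1 s * (q \<bullet> q)" "(f s - k) \<bullet> q' = X2 s * (q \<bullet> q)"
        unfolding f'[OF s] using orth qp
        by (simp_all add: inner_add_left inner_commute[of p q] inner_commute[of p' q] inner_commute[of p q']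
          inner_commute[of p' q'] inner_commute[of q' q])
      then have "((f s - k) \<bullet> q)\<^sup>2 + ((f s - k) \<bullet> q')\<^sup>2 - (q \<bullet> q)\<^sup>2 = ((X1 s)\<^sup>2 + (X2 s)\<^sup>2 - 1) * (q \<bullet> q)\<^sup>2"
        by (simp add: power_mult_distrib algebra_simps)
      then show "\<beta> (f s) (f s) + l (f s) + \<mu> = 0" unfolding quad X[OF s] by simp
    qed
  qed
qed

text \<open>The centre of the sphere lies in the plane of j and k, so the values of the cone
  equation at the ends of the diameter in direction j have a positive sum; one of them is
  nonzero.\<close>

lemma classified_cone:
  fixes f :: "real \<times> real \<Rightarrow> quat"
  assumes sph: "f differentiable_on D" "open D" "\<kappa> \<noteq> 0" "n \<bullet> n - 4 * \<kappa> * m > 0"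
    and on: "\<And>p. p \<in> D \<Longrightarrow> on_sphere \<kappa> n m (f p)"
    and n: "qre n = 0" "qi n = 0"
    and cone: "\<And>p. p \<in> D \<Longrightarrow> (qj (f p))\<^sup>2 + (qk (f p))\<^sup>2 = r * ((qre (f p))\<^sup>2 + (qi (f p))\<^sup>2)"
  shows "classified D f"
proof -
  define \<beta> where "\<beta> x y = qj x * qj y + qk x * qk y - r * (qre x * qre y + qi x * qi y)" for x y
  have b: "bilinear \<beta>" "linear (\<lambda>x :: quat. 0 :: real)"
    by (simp_all add: bilinear_def linear_iff \<beta>_def algebra_simps)
  obtain c0 R where c0: "c0 = (- 1 / (2 * \<kappa>)) *\<^sub>R n" and R: "R > 0"
    and pt: "\<And>v. v \<bullet> v = 1 \<Longrightarrow> on_sphere \<kappa> n m (c0 + R *\<^sub>R v)"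
    using on_sphere_point[OF sph(3,4)] by metis
  let ?j = "Quat 0 0 1 0"
  have jj: "?j \<bullet> ?j = 1" "(- ?j) \<bullet> (- ?j) = 1" by (simp_all add: inner_quat_def)
  have "\<beta> (c0 + R *\<^sub>R ?j) (c0 + R *\<^sub>R ?j) + \<beta> (c0 + R *\<^sub>R (- ?j)) (c0 + R *\<^sub>R (- ?j))
    = 2 * ((qj c0)\<^sup>2 + (qk c0)\<^sup>2 + R\<^sup>2)"
    using n by (simp add: \<beta>_def c0 power2_eq_square algebra_simps)
  also have "\<dots> > 0" using R by (simp add: add_nonneg_pos)
  finally have "\<beta> (c0 + R *\<^sub>R ?j) (c0 + R *\<^sub>R ?j) \<noteq> 0 \<or> \<beta> (c0 + R *\<^sub>R (- ?j)) (c0 + R *\<^sub>R (- ?j)) \<noteq> 0"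
    by auto
  then obtain z0 where z0: "on_sphere \<kappa> n m z0" "\<beta> z0 z0 + 0 + 0 \<noteq> 0"
    using pt jj by (metis add.right_neutral)
  show ?thesis
  proof (rule classified_quadric[OF sph])
    show "on_sphere \<kappa> n m (f p)" if "p \<in> D" for p by (rule on[OF that])
    show "bilinear \<beta>" "linear (\<lambda>x :: quat. 0 :: real)" "on_sphere \<kappa> n m z0" "\<beta> z0 z0 + 0 + 0 \<noteq> 0" by fact+
    show "\<beta> (f p) (f p) + 0 + 0 = 0" if "p \<in> D" for p
      using cone[OF that] by (simp add: \<beta>_def power2_eq_square)
  qed
qed

text \<open>The values lie in the span of 1 and i, the normal in that of j and k; hence their
  product in the hyperplane chart has no i-component.\<close>

lemma classified_plane:
  assumes n: "n \<noteq> 0" and on: "\<And>p. p \<in> D \<Longrightarrow> on_sphere 0 n m (f p)"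
    and n12: "qre n = 0" "qi n = 0" and pl: "\<And>p. p \<in> D \<Longrightarrow> qj (f p) = 0 \<and> qk (f p) = 0"
  shows "classified D f"
proof (rule classified_conf_eq)
  show "conf_eq D f (\<lambda>p. f p * quat_cnj n + m *\<^sub>R 1)" using hyperplane_chart(1)[of n D m f] n on by blast
  define G where "G x = x $ 1" for x :: "real ^ 3"
  show "classified D (\<lambda>p. f p * quat_cnj n + m *\<^sub>R 1)"
  proof (rule classified_darboux[where G = G and y = "axis 1 1"])
    show "qre (f p * quat_cnj n + m *\<^sub>R 1) = 0" if "p \<in> D" for p
      using hyperplane_chart(2)[of n D m f p] n on that by blast
    show "darboux_form G" unfolding G_def[abs_def]
      by (intro darboux_form_lin_lift lin_lift_linear) (simp add: linear_iff)
    show "G (axis 1 1) \<noteq> 0" by (simp add: G_def axis_def)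
    show "G (im_part (f p * quat_cnj n + m *\<^sub>R 1)) = 0" if "p \<in> D" for p
      using pl[OF that] n12 by (simp add: G_def quat_cnj_def)
  qed
qed

text \<open>\<open>ZI\<close>, \<open>ZJ\<close> and \<open>w0\<close> are coordinates in the skew basis \<open>1, I, J, I \<times> J\<close>, in which the two angles
  can be eliminated from the product by a quadratic relation.\<close>

lemma classified_product_skew:
  fixes f :: "real \<times> real \<Rightarrow> quat" and x y c s \<tau> \<sigma> :: real
  assumes sph: "f differentiable_on D" "open D" "\<kappa> \<noteq> 0" "n \<bullet> n - 4 * \<kappa> * m > 0"
    and on: "\<And>p. p \<in> D \<Longrightarrow> on_sphere \<kappa> n m (f p)"
    and n: "qi n = 0" "qj n = 0" and cs: "c\<^sup>2 + s\<^sup>2 = 1" "s \<noteq> 0"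
    and f: "\<And>p. p \<in> D \<Longrightarrow> f p = Quat (x + X1 p) (X2 p) 0 (s * \<tau>)
      * Quat (y + Y1 p) (c * Y2 p) (s * Y2 p) (s * \<sigma>)"
    and X: "\<And>p. p \<in> D \<Longrightarrow> (X1 p)\<^sup>2 + (X2 p)\<^sup>2 = 1" and Y: "\<And>p. p \<in> D \<Longrightarrow> (Y1 p)\<^sup>2 + (Y2 p)\<^sup>2 = 1"
    and k1: "x\<^sup>2 + (s * \<tau>)\<^sup>2 + 1 = 2 * x * (x + c * \<tau>)"
    and k2: "y\<^sup>2 + (s * \<sigma>)\<^sup>2 + 1 = 2 * y * (y + c * \<sigma>)"
  shows "classified D f"
proof -
  \<comment> \<open>Eliminating the squares of \<open>X2\<close> and \<open>Y2\<close> from the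
    product of the \<open>ZI\<close> and \<open>ZJ\<close> coordinates leaves \<open>2 * M\<close>
    as the coefficient at \<open>u0 z + \<tau> * \<sigma>\<close>.\<close>
  define M where "M = \<sigma> * (x + c * \<tau>) + \<tau> * (y + c * \<sigma>)"
  define ZI where "ZI z = qi z - c / s * qj z" for z
  define ZJ where "ZJ z = qj z / s" for z
  define u0 where "u0 z = qre z + c / s * qk z" for z
  define w0 where "w0 z = qk z / s" for z
  define \<beta> where "\<beta> z w = ZI z * ZJ w - u0 z * w0 w" for z w
  define l where "l z = (2 * M - 2 * \<tau> * \<sigma> * c) * u0 z - 2 * \<tau> * \<sigma> * w0 z" for z
  define \<mu> where "\<mu> = 2 * M * (\<tau> * \<sigma>) - 4 * (\<tau> * \<sigma>)\<^sup>2 * c"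
  have lin: "linear ZI" "linear ZJ" "linear u0" "linear w0"
    by (simp_all add: linear_iff ZI_def ZJ_def u0_def w0_def algebra_simps add_divide_distrib)
  have b: "bilinear \<beta>" "linear l"
    unfolding bilinear_def linear_iff \<beta>_def l_def
    by (simp_all add: linear_add[OF lin(1)] linear_add[OF lin(2)] linear_add[OF lin(3)] linear_add[OF lin(4)]
      linear_scale[OF lin(1)] linear_scale[OF lin(2)] linear_scale[OF lin(3)] linear_scale[OF lin(4)] algebra_simps)
  have quad: "\<beta> z z + l z + \<mu> = ZI z * ZJ z - (u0 z + 2 * (\<tau> * \<sigma>)) * (w0 z + 2 * (\<tau> * \<sigma>) * c)
      + 2 * M * (u0 z + \<tau> * \<sigma>)" for z
    by (simp add: \<beta>_def l_def \<mu>_def power2_eq_square algebra_simps)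
  obtain c0 R where c0: "c0 = (- 1 / (2 * \<kappa>)) *\<^sub>R n" and R: "R > 0"
    and pt: "\<And>v. v \<bullet> v = 1 \<Longrightarrow> on_sphere \<kappa> n m (c0 + R *\<^sub>R v)"
    using on_sphere_point[OF sph(3,4)] by metis
  have "\<exists>z0. on_sphere \<kappa> n m z0 \<and> \<beta> z0 z0 + l z0 + \<mu> \<noteq> 0"
  proof (rule ccontr)
    assume "\<not> (\<exists>z0. on_sphere \<kappa> n m z0 \<and> \<beta> z0 z0 + l z0 + \<mu> \<noteq> 0)"
    then have 0: "\<beta> (c0 + R *\<^sub>R v) (c0 + R *\<^sub>R v) + l (c0 + R *\<^sub>R v) + \<mu> = 0" if "v \<bullet> v = 1" for v
      using pt[OF that] by blast
    define h where "h = 2 * M * (u0 c0 + \<tau> * \<sigma>) - (u0 c0 + 2 * (\<tau> * \<sigma>)) * (w0 c0 + 2 * (\<tau> * \<sigma>) * c)"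
    \<comment> \<open>The centre has no i- and j-components, while \<open>u0\<close> and
      \<open>w0\<close> use just the other two. So on the circle of the sphere in these directions
      the equation takes this form; three points of the circle refute it.\<close>
    have e: "R\<^sup>2 * ((a - c / s * b) * (b / s)) + h = 0" if "a\<^sup>2 + b\<^sup>2 = 1" for a b
    proof -
      have "Quat 0 a b 0 \<bullet> Quat 0 a b 0 = 1" using that by (simp add: inner_quat_def power2_eq_square)
      from 0[OF this] show ?thesis
        unfolding quad h_def using n
        by (simp add: ZI_def ZJ_def u0_def w0_def c0 power2_eq_square algebra_simps)
    qed
    have h0: "h = 0" using e[of 1 0] by simp
    have "c = 0" using e[of 0 1] h0 R cs(2) by simp
    then have "R\<^sup>2 * (3 / 5 * (4 / 5 / s)) = 0" using e[of "3/5" "4/5"] h0 by (simp add: power2_eq_square)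
    then show False using R cs(2) by simp
  qed
  then obtain z0 where z0: "on_sphere \<kappa> n m z0" "\<beta> z0 z0 + l z0 + \<mu> \<noteq> 0" by blast
  show ?thesis
  proof (rule classified_quadric[OF sph])
    show "on_sphere \<kappa> n m (f p)" if "p \<in> D" for p by (rule on[OF that])
    show "bilinear \<beta>" "linear l" "on_sphere \<kappa> n m z0" "\<beta> z0 z0 + l z0 + \<mu> \<noteq> 0" by fact+
    fix p assume p: "p \<in> D"
    define A where "A = x + X1 p + c * \<tau>"
    define B where "B = X2 p"
    define A' where "A' = y + Y1 p + c * \<sigma>"
    define B' where "B' = Y2 p"
    have fp: "f p = Quat (A - c * \<tau>) B 0 (s * \<tau>) * Quat (A' - c * \<sigma>) (c * B') (s * B') (s * \<sigma>)"
      using f[OF p] by (simp add: A_def B_def A'_def B'_def)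
    have s2: "s * s = 1 - c * c" using cs(1) by (simp add: power2_eq_square algebra_simps)
    have i: "qi (f p) = A' * B - \<tau> * B' + c * (A * B' - \<sigma> * B)"
    proof -
      have "qi (f p) = (A - c * \<tau>) * (c * B') + B * (A' - c * \<sigma>) - (s * s) * (\<tau> * B')"
        by (simp add: fp algebra_simps)
      then show ?thesis unfolding s2 by (simp add: algebra_simps)
    qed
    have j: "qj (f p) = s * (A * B' - \<sigma> * B)" by (simp add: fp algebra_simps)
    have k: "qk (f p) = s * (B * B' + \<sigma> * A + \<tau> * A' - 2 * (\<tau> * \<sigma>) * c)" by (simp add: fp algebra_simps)
    have r: "qre (f p) = A * A' - \<tau> * \<sigma> - c * (B * B' + \<sigma> * A + \<tau> * A' - 2 * (\<tau> * \<sigma>) * c)"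
    proof -
      have "qre (f p) = (A - c * \<tau>) * (A' - c * \<sigma>) - B * (c * B') - (s * s) * (\<tau> * \<sigma>)"
        by (simp add: fp algebra_simps)
      then show ?thesis unfolding s2 by (simp add: algebra_simps)
    qed
    have v: "ZJ (f p) = A * B' - \<sigma> * B" "ZI (f p) = A' * B - \<tau> * B'"
      "w0 (f p) = B * B' + \<sigma> * A + \<tau> * A' - 2 * (\<tau> * \<sigma>) * c" "u0 (f p) = A * A' - \<tau> * \<sigma>"
      using cs(2) by (simp_all add: ZI_def ZJ_def u0_def w0_def i j k r)
    \<comment> \<open>Since \<open>c\<^sup>2 + s\<^sup>2 = 1\<close>, the condition
      \<open>k1\<close> amounts to \<open>(x + c * \<tau>)\<^sup>2 = 1 + \<tau>\<^sup>2\<close>,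
      which produces the constant term.\<close>
    have BB: "B * B = 2 * (x + c * \<tau>) * A - A * A - \<tau> * \<tau>"
      using X[OF p] k1 cs(1) unfolding A_def B_def by algebra
    have BB': "B' * B' = 2 * (y + c * \<sigma>) * A' - A' * A' - \<sigma> * \<sigma>"
      using Y[OF p] k2 cs(1) unfolding A'_def B'_def by algebra
    show "\<beta> (f p) (f p) + l (f p) + \<mu> = 0"
      unfolding quad v M_def using BB BB' by algebra
  qed
qed

text \<open>The coefficients of the sphere equation give \<open>n2 = 0\<close>,
  \<open>n1 = - 4 * \<kappa> * x * y\<close>, \<open>s * n3 = 0\<close> and
  \<open>s * n4 = c * n1\<close>. The cases are a hyperplane (planar surface), factors of constant
  norm (Clifford), skew axes with \<open>s \<noteq> 0\<close> (a further quadric), and parallel axes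
  (a quadric cone).\<close>

lemma classified_product_normal:
  fixes f :: "real \<times> real \<Rightarrow> quat" and x y c s p3 p4 q2 q3 q4 :: real
  assumes sph: "spherical D f" and "open D"
    and f: "\<And>p. p \<in> D \<Longrightarrow> f p = (Quat x 0 p3 p4 + X1 p *\<^sub>R 1 + X2 p *\<^sub>R Quat 0 1 0 0)
      * (Quat y q2 q3 q4 + Y1 p *\<^sub>R 1 + Y2 p *\<^sub>R Quat 0 c s 0)"
    and X: "\<And>p. p \<in> D \<Longrightarrow> (X1 p)\<^sup>2 + (X2 p)\<^sup>2 = 1" and Y: "\<And>p. p \<in> D \<Longrightarrow> (Y1 p)\<^sup>2 + (Y2 p)\<^sup>2 = 1"
    and ind: "circle_indep D X1 X2 Y1 Y2"
    and cs: "c\<^sup>2 + s\<^sup>2 = 1" and q0J: "c * q2 + s * q3 = 0"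
  shows "classified D f"
proof -
  obtain \<kappa> n m where disc: "n \<bullet> n - 4 * \<kappa> * m > 0" and on: "\<And>p. p \<in> D \<Longrightarrow> on_sphere \<kappa> n m (f p)"
    and diff: "f differentiable_on D"
    using sph by (auto simp: spherical_def)
  define I where "I = Quat 0 1 0 0"
  define J where "J = Quat 0 c s 0"
  define p0 where "p0 = Quat x 0 p3 p4"
  define q0 where "q0 = Quat y q2 q3 q4"
  define k1 where "k1 = p0 \<bullet> p0 + 1"
  define k2 where "k2 = q0 \<bullet> q0 + 1"
  have UI: "unit_imag I" "unit_imag J"
    using cs by (simp_all add: unit_imag_def I_def J_def inner_quat_def power2_eq_square)
  have perp: "p0 \<bullet> I = 0" "q0 \<bullet> J = 0"
    using q0J by (simp_all add: p0_def q0_def I_def J_def inner_quat_def algebra_simps)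
  have f': "f p = (p0 + X1 p *\<^sub>R 1 + X2 p *\<^sub>R I) * (q0 + Y1 p *\<^sub>R 1 + Y2 p *\<^sub>R J)" if "p \<in> D" for p
    unfolding f[OF that] p0_def q0_def I_def J_def ..
  have kpos: "k1 > 0" "k2 > 0" by (simp_all add: k1_def k2_def add_nonneg_pos)
  have z: "(\<kappa> * k1 * k2 + n \<bullet> (p0 * q0) + m) + (2 * \<kappa> * k1 * y + n \<bullet> p0) * Y1 p + (n \<bullet> (p0 * J)) * Y2 p
    + X1 p * ((2 * \<kappa> * k2 * x + n \<bullet> q0) + (4 * \<kappa> * x * y + qre n) * Y1 p + (n \<bullet> J) * Y2 p)
    + X2 p * (n \<bullet> (I * q0) + (n \<bullet> I) * Y1 p + (n \<bullet> (I * J)) * Y2 p) = 0" if p: "p \<in> D" for p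
  proof -
    have ff: "f p \<bullet> f p = (k1 + 2 * X1 p * x) * (k2 + 2 * Y1 p * y)"
      unfolding f'[OF p] inner_mult_same_left unit_circle_mult[OF UI(1) X[OF p]] unit_circle_mult[OF UI(2) Y[OF p]] perp
      by (simp add: k1_def k2_def p0_def q0_def)
    have nf: "n \<bullet> f p = n \<bullet> (p0 * q0) + (n \<bullet> p0) * Y1 p + (n \<bullet> (p0 * J)) * Y2 p
      + X1 p * (n \<bullet> q0 + qre n * Y1 p + (n \<bullet> J) * Y2 p) + X2 p * (n \<bullet> (I * q0) + (n \<bullet> I) * Y1 p + (n \<bullet> (I * J)) * Y2 p)"
      unfolding f'[OF p] by (simp add: distrib_left distrib_right inner_add_right inner_one_quat algebra_simps)
    show ?thesis
      using on[OF p] unfolding on_sphere_def ff nf by (simp add: algebra_simps)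
  qed
  note e = circle_indepD[OF ind z]
  define n1 n2 n3 n4 where nn: "n1 = qre n" "n2 = qi n" "n3 = qj n" "n4 = qk n"
  have c01: "2 * \<kappa> * k1 * y + n1 * x + n3 * p3 + n4 * p4 = 0"
    using e(2) by (simp add: p0_def inner_quat_def nn)
  have c02: "- s * p3 * n1 + (c * x - s * p4) * n2 + (s * x + c * p4) * n3 - c * p3 * n4 = 0"
    using e(3) by (simp add: p0_def J_def inner_quat_def nn algebra_simps)
  have c10: "2 * \<kappa> * k2 * x + n1 * y + n2 * q2 + n3 * q3 + n4 * q4 = 0"
    using e(4) by (simp add: q0_def inner_quat_def nn)
  have c11: "n1 = - 4 * \<kappa> * x * y" using e(5) by (simp add: nn)
  have c12: "c * n2 + s * n3 = 0" using e(6) by (simp add: J_def inner_quat_def nn algebra_simps)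
  have c20: "- q2 * n1 + y * n2 - q4 * n3 + q3 * n4 = 0"
    using e(7) by (simp add: q0_def I_def inner_quat_def nn algebra_simps)
  have c21: "n2 = 0" using e(8) by (simp add: I_def inner_quat_def nn)
  have c22: "s * n4 = c * n1" using e(9) by (simp add: I_def J_def inner_quat_def nn algebra_simps)
  have sn3: "s * n3 = 0" using c12 c21 by simp
  \<comment> \<open>The equations are the real and imaginary part of
    \<open>(n3 - \<i> * n4) * (u + \<i> * v) = 0\<close>.\<close>
  have complex_zero: "u = 0 \<and> v = 0" if "n3 * u + n4 * v = 0" "n3 * v - n4 * u = 0" "n3 \<noteq> 0 \<or> n4 \<noteq> 0" for u v
  proof -
    have "(n3 * n3 + n4 * n4) * u = n3 * (n3 * u + n4 * v) - n4 * (n3 * v - n4 * u)"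
      "(n3 * n3 + n4 * n4) * v = n4 * (n3 * u + n4 * v) + n3 * (n3 * v - n4 * u)" by algebra+
    moreover have "n3 * n3 + n4 * n4 \<noteq> 0" using that(3) by (simp add: sum_squares_eq_zero_iff)
    ultimately show ?thesis using that by auto
  qed
  have flat_s: "q2 = 0 \<and> c \<noteq> 0" if "s = 0"
    using that cs q0J by auto
  consider (hyper) "\<kappa> = 0" | (cliff) "x = 0" "y = 0"
    | (skew) "\<kappa> \<noteq> 0" "s \<noteq> 0" "x \<noteq> 0 \<or> y \<noteq> 0"
    | (flat1) "\<kappa> \<noteq> 0" "s = 0" "x \<noteq> 0" | (flat2) "\<kappa> \<noteq> 0" "s = 0" "y \<noteq> 0"
    by blast
  then show ?thesis
  proof cases
    case hyper
    have n0: "n \<noteq> 0" using disc hyper by auto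
    have n1: "n1 = 0" using c11 hyper by simp
    have "s = 0"
    proof (rule ccontr)
      assume "s \<noteq> 0"
      then have "n3 = 0" "n4 = 0" using sn3 c22 n1 by auto
      then show False using n0 n1 c21 by (simp add: nn quat_eq_iff)
    qed
    have n34: "n3 \<noteq> 0 \<or> n4 \<noteq> 0" using n0 n1 c21 by (auto simp: nn quat_eq_iff)
    have "q3 = 0 \<and> q4 = 0"
      using complex_zero[of q3 q4] c10 c20 hyper n1 c21 n34 by (simp add: mult.commute)
    moreover have "p3 = 0 \<and> p4 = 0"
      using complex_zero[of p3 p4] c01 c02 hyper n1 c21 n34 \<open>s = 0\<close> flat_s
      by (simp add: mult.left_commute[of c] right_diff_distrib[symmetric] mult.commute)
    ultimately have pl: "qj (f p) = 0 \<and> qk (f p) = 0" if "p \<in> D" for p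
      using f[OF that] \<open>s = 0\<close> by simp
    show ?thesis
      by (rule classified_plane[OF n0, of D m f]) (use on hyper n1 c21 pl in \<open>auto simp: nn\<close>)
  next
    case cliff
    show ?thesis
      by (rule classified_clifford[OF sph assms(2) UI f' X Y])
         (use perp cliff in \<open>simp_all add: p0_def q0_def\<close>)
  next
    case skew
    have n3: "n3 = 0" using sn3 skew by simp
    have "p3 * n1 = 0"
    proof -
      have "p3 * n1 = (c\<^sup>2 + s\<^sup>2) * (p3 * n1)" using cs by simp
      also have "\<dots> = c * p3 * (c * n1) + s * (s * p3 * n1)" by (simp add: power2_eq_square algebra_simps)
      also have "\<dots> = - s * (- s * p3 * n1 - c * p3 * n4)" unfolding c22[symmetric] by (simp add: algebra_simps)
      also have "\<dots> = 0" using c02 c21 n3 by simp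
      finally show ?thesis .
    qed
    have q2n: "q2 * n1 = q3 * n4" using c20 c21 n3 by simp
    have "q3 * n1 = 0"
    proof -
      have "q3 * n1 = (c\<^sup>2 + s\<^sup>2) * (q3 * n1)" using cs by simp
      also have "\<dots> = c * q3 * (c * n1) + s * n1 * (s * q3)" by (simp add: power2_eq_square algebra_simps)
      also have "\<dots> = c * s * (q3 * n4) + s * n1 * (s * q3)" unfolding c22[symmetric] by (simp add: algebra_simps)
      also have "\<dots> = s * n1 * (c * q2 + s * q3)" unfolding q2n[symmetric] by (simp add: algebra_simps)
      finally show ?thesis using q0J by simp
    qed
    have n1: "n1 \<noteq> 0"
    proof
      assume n1: "n1 = 0"
      then have "n4 = 0" using c22 skew by simp
      then have "\<kappa> * k2 * x = 0" "\<kappa> * k1 * y = 0" using c10 c01 n1 c21 n3 by auto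
      then show False using skew kpos by auto
    qed
    have zero: "p3 = 0" "q3 = 0" using \<open>p3 * n1 = 0\<close> \<open>q3 * n1 = 0\<close> n1 by auto
    then have zero': "q2 = 0" using q2n n1 by simp
    have xy: "x \<noteq> 0" "y \<noteq> 0" using n1 c11 by auto
    have k: "k1 = x\<^sup>2 + p4\<^sup>2 + 1" "k2 = y\<^sup>2 + q4\<^sup>2 + 1"
      by (simp_all add: k1_def k2_def p0_def q0_def inner_quat_def zero zero' power2_eq_square)
    \<comment> \<open>The conditions on \<open>p4 / s\<close> and \<open>q4 / s\<close> are the
      linear coefficients \<open>c01\<close> and \<open>c10\<close>, multiplied by \<open>s\<close>
      and cancelled by \<open>2 * \<kappa> * y\<close> and \<open>2 * \<kappa> * x\<close>.\<close>
    have "k1 = 2 * x * (x + c * (p4 / s))"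
    proof -
      have "0 = s * (2 * \<kappa> * k1 * y + n1 * x + n4 * p4)" using c01 n3 by simp
      also have "\<dots> = 2 * \<kappa> * k1 * y * s + n1 * x * s + (s * n4) * p4" by (simp add: algebra_simps)
      also have "\<dots> = 2 * \<kappa> * y * (k1 * s - 2 * x * (x * s + c * p4))"
        unfolding c22 c11 by (simp add: algebra_simps)
      finally have "k1 * s - 2 * x * (x * s + c * p4) = 0"
        using skew xy by (metis mult_eq_0_iff zero_neq_numeral)
      then show ?thesis using skew(2) by (simp add: field_simps)
    qed
    moreover have "k2 = 2 * y * (y + c * (q4 / s))"
    proof -
      have "0 = s * (2 * \<kappa> * k2 * x + n1 * y + n4 * q4)" using c10 n3 c21 by simp
      also have "\<dots> = 2 * \<kappa> * k2 * x * s + n1 * y * s + (s * n4) * q4" by (simp add: algebra_simps)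
      also have "\<dots> = 2 * \<kappa> * x * (k2 * s - 2 * y * (y * s + c * q4))"
        unfolding c22 c11 by (simp add: algebra_simps)
      finally have "k2 * s - 2 * y * (y * s + c * q4) = 0"
        using skew xy by (metis mult_eq_0_iff zero_neq_numeral)
      then show ?thesis using skew(2) by (simp add: field_simps)
    qed
    ultimately have kk: "x\<^sup>2 + (s * (p4 / s))\<^sup>2 + 1 = 2 * x * (x + c * (p4 / s))"
      "y\<^sup>2 + (s * (q4 / s))\<^sup>2 + 1 = 2 * y * (y + c * (q4 / s))"
      using k skew(2) by simp_all
    show ?thesis
    proof (rule classified_product_skew[OF diff assms(2) skew(1) disc _ _ _ cs skew(2) _ X Y kk])
      show "on_sphere \<kappa> n m (f p)" if "p \<in> D" for p by (rule on[OF that])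
      show "qi n = 0" "qj n = 0" using c21 n3 by (simp_all add: nn)
      show "f p = Quat (x + X1 p) (X2 p) 0 (s * (p4 / s)) * Quat (y + Y1 p) (c * Y2 p) (s * Y2 p) (s * (q4 / s))"
        if "p \<in> D" for p
        unfolding f[OF that] using skew(2) by (intro arg_cong2[of _ _ _ _ times]) (simp_all add: quat_eq_iff zero zero')
    qed
  next
    case flat1
    have n1: "n1 = 0" using c22 flat1 flat_s by simp
    then have y0: "y = 0" using c11 flat1 by simp
    have q2: "q2 = 0" using flat_s flat1 by simp
    have "n3 \<noteq> 0 \<or> n4 \<noteq> 0" using c10 n1 c21 flat1 kpos by auto
    then have "p3 = 0 \<and> p4 = 0"
      using complex_zero[of p3 p4] c01 c02 y0 n1 c21 flat1 flat_s
      by (simp add: mult.left_commute[of c] right_diff_distrib[symmetric] mult.commute)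
    then have p34: "p3 = 0" "p4 = 0" by auto
    show ?thesis
    proof (rule classified_cone[OF diff assms(2) flat1(1) disc])
      show "on_sphere \<kappa> n m (f p)" if "p \<in> D" for p by (rule on[OF that])
      show "qre n = 0" "qi n = 0" using n1 c21 by (simp_all add: nn)
      fix p assume p: "p \<in> D"
      \<comment> \<open>The left factor is a complex number and scales both complex halves of the
        right factor alike; the first half has norm 1 and the second is constant.\<close>
      define a where "a = x + X1 p"
      have "(Y1 p)\<^sup>2 + (c * Y2 p)\<^sup>2 = 1" using Y[OF p] cs flat1(2) by (simp add: power_mult_distrib)
      moreover have "(qre (f p))\<^sup>2 + (qi (f p))\<^sup>2 = (a\<^sup>2 + (X2 p)\<^sup>2) * ((Y1 p)\<^sup>2 + (c * Y2 p)\<^sup>2)"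
        unfolding f[OF p] using p34 y0 q2 flat1(2) by (simp add: a_def power2_eq_square algebra_simps)
      moreover have "(qj (f p))\<^sup>2 + (qk (f p))\<^sup>2 = (a\<^sup>2 + (X2 p)\<^sup>2) * (q3\<^sup>2 + q4\<^sup>2)"
        unfolding f[OF p] using p34 y0 q2 flat1(2) by (simp add: a_def power2_eq_square algebra_simps)
      ultimately show "(qj (f p))\<^sup>2 + (qk (f p))\<^sup>2 = (q3\<^sup>2 + q4\<^sup>2) * ((qre (f p))\<^sup>2 + (qi (f p))\<^sup>2)" by simp
    qed
  next
    case flat2
    have n1: "n1 = 0" using c22 flat2 flat_s by simp
    then have x0: "x = 0" using c11 flat2 by simp
    have q2: "q2 = 0" using flat_s flat2 by simp
    have "n3 \<noteq> 0 \<or> n4 \<noteq> 0" using c01 n1 c21 flat2 kpos by auto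
    then have "q3 = 0 \<and> q4 = 0"
      using complex_zero[of q3 q4] c10 c20 x0 n1 c21 by (simp add: mult.commute)
    then have q34: "q3 = 0" "q4 = 0" by auto
    show ?thesis
    proof (rule classified_cone[OF diff assms(2) flat2(1) disc])
      show "on_sphere \<kappa> n m (f p)" if "p \<in> D" for p by (rule on[OF that])
      show "qre n = 0" "qi n = 0" using n1 c21 by (simp_all add: nn)
      fix p assume p: "p \<in> D"
      \<comment> \<open>The mirror image: here the right factor is complex.\<close>
      define a where "a = y + Y1 p"
      define b where "b = c * Y2 p"
      have "(qre (f p))\<^sup>2 + (qi (f p))\<^sup>2 = ((X1 p)\<^sup>2 + (X2 p)\<^sup>2) * (a\<^sup>2 + b\<^sup>2)"
        unfolding f[OF p] using q34 x0 q2 flat2(2) by (simp add: a_def b_def power2_eq_square algebra_simps)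
      moreover have "(qj (f p))\<^sup>2 + (qk (f p))\<^sup>2 = (p3\<^sup>2 + p4\<^sup>2) * (a\<^sup>2 + b\<^sup>2)"
        unfolding f[OF p] using q34 x0 q2 flat2(2) by (simp add: a_def b_def power2_eq_square algebra_simps)
      ultimately show "(qj (f p))\<^sup>2 + (qk (f p))\<^sup>2 = (p3\<^sup>2 + p4\<^sup>2) * ((qre (f p))\<^sup>2 + (qi (f p))\<^sup>2)"
        unfolding X[OF p] by simp
    qed
  qed
qed

section \<open>Normal position of the two axes\<close>

lemma rotate_perp:
  fixes u v :: real
  obtains a b where "a\<^sup>2 + b\<^sup>2 = (1::real)" "a * u + b * v = 0"
proof (cases "u = 0 \<and> v = 0")
  case True
  then show ?thesis by (intro that[of 1 0]) auto
next
  case False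
  define r where "r = sqrt (u\<^sup>2 + v\<^sup>2)"
  have "u\<^sup>2 + v\<^sup>2 > 0" using False by (auto simp: sum_power2_gt_zero_iff)
  then have r: "r > 0" "r\<^sup>2 = u\<^sup>2 + v\<^sup>2" by (simp_all add: r_def)
  show ?thesis
    by (rule that[of "v / r" "- u / r"])
       (use r False in \<open>auto simp add: power_divide add_divide_distrib[symmetric] add.commute\<close>)
qed

lemma unit_imag_conj:
  assumes "unit_imag I" "g \<noteq> 0" shows "unit_imag (g * I * inverse g)"
proof -
  have e: "g * I * inverse g = (1 / (g \<bullet> g)) *\<^sub>R (g * I * quat_cnj g)" by (simp add: quat_inverse)
  have re: "qre (g * I * quat_cnj g) = 0"
    unfolding inner_eq_qre_mult_cnj[of "g * I" g, symmetric]
    using assms(1) inner_mult_same_left[of g I 1] by (simp add: inner_one_quat unit_imag_def)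
  have "qre (r *\<^sub>R w) = 0" if "qre w = 0" for r w using that by simp
  then have "qre (g * I * inverse g) = 0" unfolding e using re by blast
  moreover have "norm (g * I * inverse g) = 1"
    using assms by (simp add: norm_mult norm_inverse unit_imag_def norm_eq_1[symmetric])
  ultimately show ?thesis by (simp only: unit_imag_def norm_eq_1)
qed

text \<open>Conjugation by \<open>?i + I\<close> takes \<open>I\<close> to \<open>?i\<close>,
  because \<open>(?i + I) * I = ?i * (?i + I)\<close>; if the sum is 0, then j replaces it.
  Conjugation by complex numbers afterwards fixes \<open>?i\<close> and turns the plane of j and
  k.\<close>

lemma rotate_to_axes:
  assumes I: "unit_imag I" and J: "unit_imag J"
  obtains g c s where "g \<noteq> 0" "g * I * inverse g = Quat 0 1 0 0" "g * J * inverse g = Quat 0 c s 0"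
    "c\<^sup>2 + s\<^sup>2 = 1"
proof -
  let ?i = "Quat 0 1 0 0"
  have "\<exists>g. g \<noteq> 0 \<and> g * I = ?i * g"
  proof (cases "?i + I = 0")
    case True
    then have "I = - ?i" by (simp add: add_eq_0_iff)
    then have "Quat 0 0 1 0 * I = ?i * Quat 0 0 1 0" by (simp add: quat_eq_iff)
    moreover have "Quat 0 0 1 0 \<noteq> 0" by (simp add: quat_eq_iff)
    ultimately show ?thesis by blast
  next
    case False
    have "?i * ?i = - 1" by (simp add: quat_eq_iff)
    then have "(?i + I) * I = ?i * (?i + I)"
      using unit_imag_sq[OF I] by (simp add: distrib_left distrib_right)
    then show ?thesis using False by blast
  qed
  then obtain g where g: "g \<noteq> 0" "g * I = ?i * g" by blast
  define K where "K = g * J * inverse g"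
  have K: "unit_imag K" unfolding K_def using unit_imag_conj[OF J g(1)] .
  define \<rho> where "\<rho> = sqrt ((qj K)\<^sup>2 + (qk K)\<^sup>2)"
  have \<rho>: "\<rho>\<^sup>2 = (qj K)\<^sup>2 + (qk K)\<^sup>2" by (simp add: \<rho>_def)
  \<comment> \<open>Conjugation by a complex number turns the plane of j and k by twice its
    argument, so the witness comes from the half-angle formula; it could vanish when
    \<open>qk K = 0\<close>.\<close>
  obtain a b where ab: "a \<noteq> 0 \<or> b \<noteq> 0" "(a\<^sup>2 - b\<^sup>2) * qk K + 2 * a * b * qj K = 0"
  proof (cases "qk K = 0")
    case True
    then show ?thesis by (intro that[of 1 0]) auto
  next
    case False
    have "((qj K + \<rho>)\<^sup>2 - (- qk K)\<^sup>2) * qk K + 2 * (qj K + \<rho>) * (- qk K) * qj K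
      = qk K * (\<rho>\<^sup>2 - (qj K)\<^sup>2 - (qk K)\<^sup>2)" by (simp add: power2_eq_square algebra_simps)
    then show ?thesis using \<rho> False by (intro that[of "qj K + \<rho>" "- qk K"]) auto
  qed
  define z where "z = Quat a b 0 0"
  have z: "z \<noteq> 0" using ab by (auto simp: z_def quat_eq_iff)
  have zi: "z * ?i = ?i * z" by (simp add: z_def quat_eq_iff)
  define L where "L = z * K * inverse z"
  have L: "unit_imag L" unfolding L_def using unit_imag_conj[OF K z] .
  have "L = (1 / (z \<bullet> z)) *\<^sub>R (z * K * quat_cnj z)" by (simp add: L_def quat_inverse)
  moreover have "qk (z * K * quat_cnj z) = (a\<^sup>2 - b\<^sup>2) * qk K + 2 * a * b * qj K"
    by (simp add: z_def quat_cnj_def power2_eq_square algebra_simps)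
  ultimately have Lk: "qk L = 0" using ab(2) by simp
  have inv: "inverse (z * g) = inverse g * inverse z" using z g by (simp add: nonzero_inverse_mult_distrib)
  show ?thesis
  proof (rule that[of "z * g" "qi L" "qj L"])
    show "z * g \<noteq> 0" using z g by simp
    have "z * g * I * inverse (z * g) = z * (g * I) * inverse g * inverse z" unfolding inv by (simp add: mult.assoc)
    also have "\<dots> = (z * ?i) * (g * inverse g) * inverse z" unfolding g(2) by (simp add: mult.assoc)
    also have "\<dots> = ?i" using g(1) z by (simp add: zi mult.assoc)
    finally show "z * g * I * inverse (z * g) = ?i" .
    have "z * g * J * inverse (z * g) = L" unfolding inv L_def K_def by (simp add: mult.assoc)
    then show "z * g * J * inverse (z * g) = Quat 0 (qi L) (qj L) 0"
      using L Lk by (simp add: quat_eq_iff unit_imag_def)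
    show "(qi L)\<^sup>2 + (qj L)\<^sup>2 = 1" using L Lk by (auto simp add: unit_imag_def inner_quat_def power2_eq_square)
  qed
qed

lemma classified_product:
  fixes f :: "real \<times> real \<Rightarrow> quat"
  assumes sph: "spherical D f" and "open D" and I: "unit_imag I" and J: "unit_imag J"
    and f: "\<And>p. p \<in> D \<Longrightarrow> f p = (p0 + X1 p *\<^sub>R 1 + X2 p *\<^sub>R I) * (q0 + Y1 p *\<^sub>R 1 + Y2 p *\<^sub>R J)"
    and X: "\<And>p. p \<in> D \<Longrightarrow> (X1 p)\<^sup>2 + (X2 p)\<^sup>2 = 1" and Y: "\<And>p. p \<in> D \<Longrightarrow> (Y1 p)\<^sup>2 + (Y2 p)\<^sup>2 = 1"
    and ind: "circle_indep D X1 X2 Y1 Y2"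
  shows "classified D f"
proof -
  obtain g c s where g: "g \<noteq> 0" "g * I * inverse g = Quat 0 1 0 0" "g * J * inverse g = Quat 0 c s 0"
    "c\<^sup>2 + s\<^sup>2 = 1" using rotate_to_axes[OF I J] by metis
  let ?i = "Quat 0 1 0 0" and ?j = "Quat 0 c s 0"
  define p1 where "p1 = g * p0 * inverse g"
  define q1 where "q1 = g * q0 * inverse g"
  \<comment> \<open>Multiplication by \<open>z\<close> on the left rotates the parameter of the
    first circle, and by \<open>w\<close> on the right that of the second. The angles remove the
    component of each constant term along the axis of its circle.\<close>
  obtain a b where ab: "a\<^sup>2 + b\<^sup>2 = 1" "a * qi p1 + b * qre p1 = 0" using rotate_perp by blast
  obtain a' b' where ab': "a'\<^sup>2 + b'\<^sup>2 = 1" "a' * (q1 \<bullet> ?j) + b' * qre q1 = 0" using rotate_perp by blast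
  define z where "z = a *\<^sub>R 1 + b *\<^sub>R ?i"
  define w where "w = a' *\<^sub>R 1 + b' *\<^sub>R ?j"
  have z0: "z \<noteq> 0" using ab(1) by (auto simp: z_def quat_eq_iff)
  have w0: "w \<noteq> 0" using ab'(1) g(4) by (auto simp: w_def quat_eq_iff)
  have ii: "?i * ?i = - 1" "?j * ?j = - 1" using g(4) by (simp_all add: quat_eq_iff power2_eq_square)
  define U1 where "U1 p = a * X1 p - b * X2 p" for p
  define U2 where "U2 p = b * X1 p + a * X2 p" for p
  define V1 where "V1 p = a' * Y1 p - b' * Y2 p" for p
  define V2 where "V2 p = b' * Y1 p + a' * Y2 p" for p
  have UV: "(U1 p)\<^sup>2 + (U2 p)\<^sup>2 = 1" "(V1 p)\<^sup>2 + (V2 p)\<^sup>2 = 1" if "p \<in> D" for p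
  proof -
    have rot: "(a * x - b * y)\<^sup>2 + (b * x + a * y)\<^sup>2 = (a\<^sup>2 + b\<^sup>2) * (x\<^sup>2 + y\<^sup>2)" for a b x y :: real
      by (simp add: power2_eq_square algebra_simps)
    show "(U1 p)\<^sup>2 + (U2 p)\<^sup>2 = 1" "(V1 p)\<^sup>2 + (V2 p)\<^sup>2 = 1"
      unfolding U1_def U2_def V1_def V2_def rot ab(1) ab'(1) X[OF that] Y[OF that] by simp_all
  qed
  have ind': "circle_indep D U1 U2 V1 V2"
    unfolding U1_def[abs_def] U2_def[abs_def] V1_def[abs_def] V2_def[abs_def]
    by (intro circle_indep_rotate[OF _ ab(1)] circle_indep_swap[OF circle_indep_rotate[OF circle_indep_swap ab'(1)]] ind)
  define h where "h p = (z * g) * f p * (inverse g * w)" for p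
  have P: "z * (g * (p0 + X1 p *\<^sub>R 1 + X2 p *\<^sub>R I) * inverse g) = z * p1 + U1 p *\<^sub>R 1 + U2 p *\<^sub>R ?i" for p
  proof -
    have "g * (p0 + X1 p *\<^sub>R 1 + X2 p *\<^sub>R I) * inverse g = p1 + X1 p *\<^sub>R 1 + X2 p *\<^sub>R ?i"
      unfolding p1_def g(2)[symmetric] using g(1) by (simp add: distrib_left distrib_right)
    then show ?thesis
      by (simp add: z_def distrib_left distrib_right ii U1_def U2_def algebra_simps)
  qed
  have Q: "(g * (q0 + Y1 p *\<^sub>R 1 + Y2 p *\<^sub>R J) * inverse g) * w = q1 * w + V1 p *\<^sub>R 1 + V2 p *\<^sub>R ?j" for p
  proof -
    have "g * (q0 + Y1 p *\<^sub>R 1 + Y2 p *\<^sub>R J) * inverse g = q1 + Y1 p *\<^sub>R 1 + Y2 p *\<^sub>R ?j"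
      unfolding q1_def g(3)[symmetric] using g(1) by (simp add: distrib_left distrib_right)
    then show ?thesis
      by (simp add: w_def distrib_left distrib_right ii V1_def V2_def algebra_simps)
  qed
  have hPQ: "h p = (z * p1 + U1 p *\<^sub>R 1 + U2 p *\<^sub>R ?i) * (q1 * w + V1 p *\<^sub>R 1 + V2 p *\<^sub>R ?j)" if "p \<in> D" for p
  proof -
    have "inverse g * g = 1" using g(1) by simp
    then have "h p = (z * (g * (p0 + X1 p *\<^sub>R 1 + X2 p *\<^sub>R I) * inverse g))
        * ((g * (q0 + Y1 p *\<^sub>R 1 + Y2 p *\<^sub>R J) * inverse g) * w)"
      unfolding h_def f[OF that] by (metis (no_types, lifting) mult.assoc mult_1_left)
    then show ?thesis unfolding P Q .
  qed
  have zp: "qi (z * p1) = 0" using ab(2) by (simp add: z_def)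
  have qw: "c * qi (q1 * w) + s * qj (q1 * w) = 0"
  proof -
    have "c * qi (q1 * w) + s * qj (q1 * w) = a' * (q1 \<bullet> ?j) + b' * ((c\<^sup>2 + s\<^sup>2) * qre q1)"
      by (simp add: w_def inner_quat_def power2_eq_square algebra_simps)
    then show ?thesis using ab'(2) g(4) by simp
  qed
  have "spherical D h"
    unfolding h_def[abs_def] using z0 w0 g(1) by (intro spherical_mult[OF sph]) auto
  then have "classified D h"
  proof (rule classified_product_normal[OF _ assms(2) _ UV(1) UV(2) ind' g(4) qw])
    have e: "z * p1 = Quat (qre (z * p1)) 0 (qj (z * p1)) (qk (z * p1))"
      "q1 * w = Quat (qre (q1 * w)) (qi (q1 * w)) (qj (q1 * w)) (qk (q1 * w))"
      using zp by (simp_all only: quat_eq_iff quat.sel)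
    show "h p = (Quat (qre (z * p1)) 0 (qj (z * p1)) (qk (z * p1)) + U1 p *\<^sub>R 1 + U2 p *\<^sub>R ?i)
      * (Quat (qre (q1 * w)) (qi (q1 * w)) (qj (q1 * w)) (qk (q1 * w)) + V1 p *\<^sub>R 1 + V2 p *\<^sub>R ?j)"
      if "p \<in> D" for p
      unfolding e[symmetric] by (rule hPQ[OF that])
  qed
  then show ?thesis
    using classified_mult_add[of D "z * g" f "inverse g * w" 0] z0 w0 g(1) by (simp add: h_def[abs_def])
qed

section \<open>Surfaces of the form \<open>A\<^sup>-\<^sup>1 B C\<^sup>-\<^sup>1\<close>\<close>

lemma classified_left:
  fixes A B :: "quat \<Rightarrow> quat"
  assumes "linear A" "linear B" "open D" "D \<noteq> {}" "spherical D f"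
    and "\<And>p. p \<in> D \<Longrightarrow> A (uv p) \<noteq> 0"
    and "\<And>p. p \<in> D \<Longrightarrow> f p = inverse (A (uv p)) * B (uv p)"
  shows "classified D f"
proof -
  obtain \<kappa> n m where "n \<bullet> n - 4 * \<kappa> * m > 0" "\<forall>p\<in>D. on_sphere \<kappa> n m (f p)" "f differentiable_on D"
    using assms(5) by (auto simp: spherical_def)
  then show ?thesis using classified_left_fraction[of A B D f n \<kappa> m] assms by blast
qed

text \<open>Conjugation reverses products and preserves inner products, so it exchanges right and
  left fractions.\<close>

lemma classified_right:
  fixes B C :: "quat \<Rightarrow> quat"
  assumes B: "linear B" and C: "linear C" and "open D" "D \<noteq> {}" and sph: "spherical D f"
    and nz: "\<And>p. p \<in> D \<Longrightarrow> C (uv p) \<noteq> 0"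
    and f: "\<And>p. p \<in> D \<Longrightarrow> f p = B (uv p) * inverse (C (uv p))"
  shows "classified D f"
proof -
  obtain \<kappa> n m where s: "n \<bullet> n - 4 * \<kappa> * m > 0" "\<And>p. p \<in> D \<Longrightarrow> on_sphere \<kappa> n m (f p)"
    and d: "f differentiable_on D"
    using sph by (auto simp: spherical_def)
  have "(\<lambda>p. quat_cnj (f p)) differentiable_on D"
    using d differentiable_chain_within[OF _ linear_imp_differentiable[OF linear_quat_cnj], of f]
    by (simp add: differentiable_on_def comp_def)
  moreover have "on_sphere \<kappa> (quat_cnj n) m (quat_cnj (f p))" if "p \<in> D" for p
    using s(2)[OF that] by (simp add: on_sphere_def inner_quat_cnj)
  moreover have "quat_cnj n \<bullet> quat_cnj n - 4 * \<kappa> * m > 0" using s(1) by (simp add: inner_quat_cnj)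
  ultimately have sph': "spherical D (\<lambda>p. quat_cnj (f p))" unfolding spherical_def by blast
  have "classified D (\<lambda>p. quat_cnj (f p))"
  proof (rule classified_left[OF _ _ assms(3,4) sph'])
    show "linear (\<lambda>t. quat_cnj (C t))" "linear (\<lambda>t. quat_cnj (B t))"
      using linear_compose[OF C linear_quat_cnj] linear_compose[OF B linear_quat_cnj] by (simp_all add: comp_def)
  qed (use nz f in \<open>simp_all add: quat_cnj_mult quat_cnj_inverse\<close>)
  then show ?thesis using classified_conf_eq[OF conf_eq_quat_cnj] by blast
qed

section \<open>Partial fractions for separated variables\<close>

lemma real_or_unit_imag:
  obtains a where "\<alpha> = a *\<^sub>R (1 :: quat)"
  | a b I where "\<alpha> = a *\<^sub>R 1 + b *\<^sub>R I" "b \<noteq> 0" "unit_imag I"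
proof -
  define w where "w = \<alpha> - qre \<alpha> *\<^sub>R 1"
  have \<alpha>: "\<alpha> = qre \<alpha> *\<^sub>R 1 + w" by (simp add: w_def)
  show ?thesis
  proof (cases "w = 0")
    case True
    then show ?thesis using \<alpha> that(1)[of "qre \<alpha>"] by simp
  next
    case False
    have "unit_imag ((1 / norm w) *\<^sub>R w)"
      using False by (simp add: unit_imag_def w_def[symmetric] dot_square_norm power2_eq_square) (simp add: w_def)
    moreover have "\<alpha> = qre \<alpha> *\<^sub>R 1 + norm w *\<^sub>R ((1 / norm w) *\<^sub>R w)" using \<alpha> False by simp
    ultimately show ?thesis using that(2)[of "qre \<alpha>" "norm w" "(1 / norm w) *\<^sub>R w"] False by simp
  qed
qed

text \<open>An open set contains a horizontal and a vertical segment through each of its points, and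
  a function of one variable is constant on one of them.\<close>

lemma inj_on_both_variables:
  fixes f :: "real \<times> real \<Rightarrow> 'a"
  assumes "open D" "D \<noteq> {}" "inj_on f D"
  shows "\<not> (\<forall>p\<in>D. f p = g (fst p))" "\<not> (\<forall>p\<in>D. f p = g (snd p))"
proof -
  obtain p where p: "p \<in> D" using assms(2) by blast
  obtain U V where UV: "open U" "open V" "p \<in> U \<times> V" "U \<times> V \<subseteq> D"
    using assms(1) p open_prod_elim by blast
  obtain e where e: "e > 0" "ball (fst p) e \<subseteq> U" using UV openE[of U "fst p"] by (auto simp: mem_Times_iff)
  obtain e' where e': "e' > 0" "ball (snd p) e' \<subseteq> V" using UV openE[of V "snd p"] by (auto simp: mem_Times_iff)
  have "fst p + e / 2 \<in> U" "snd p + e' / 2 \<in> V" using e e' by (auto simp: subset_iff dist_norm)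
  then have D: "(fst p + e / 2, snd p) \<in> D" "(fst p, snd p + e' / 2) \<in> D"
    using UV by (auto simp: mem_Times_iff)
  show "\<not> (\<forall>p\<in>D. f p = g (fst p))"
  proof
    assume "\<forall>p\<in>D. f p = g (fst p)"
    then have "f (fst p, snd p + e' / 2) = f p" using D p by (metis fst_conv)
    then have "(fst p, snd p + e' / 2) = p" using inj_onD[OF assms(3)] D p by blast
    then show False using e' by (metis snd_conv add_cancel_left_right divide_eq_0_iff less_irrefl zero_neq_numeral)
  qed
  show "\<not> (\<forall>p\<in>D. f p = g (snd p))"
  proof
    assume "\<forall>p\<in>D. f p = g (snd p)"
    then have "f (fst p + e / 2, snd p) = f p" using D p by (metis snd_conv)
    then have "(fst p + e / 2, snd p) = p" using inj_onD[OF assms(3)] D p by blast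
    then show False using e by (metis fst_conv add_cancel_left_right divide_eq_0_iff less_irrefl zero_neq_numeral)
  qed
qed

lemma classified_separated_imag:
  fixes \<alpha> \<gamma> :: quat
  assumes sph: "spherical D f" and "open D" "D \<noteq> {}" "inj_on f D"
    and \<alpha>: "\<alpha> = a *\<^sub>R 1 + b *\<^sub>R I" "b \<noteq> 0" "unit_imag I"
    and \<gamma>: "\<gamma> = a' *\<^sub>R 1 + b' *\<^sub>R J" "b' \<noteq> 0" "unit_imag J"
    and f: "\<And>p. p \<in> D \<Longrightarrow> f p = inverse (fst p *\<^sub>R 1 + \<alpha>)
      * (b0 + fst p *\<^sub>R b1 + snd p *\<^sub>R b2 + (fst p * snd p) *\<^sub>R b3) * inverse (snd p *\<^sub>R 1 + \<gamma>)"
  shows "classified D f"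
proof -
  define X1 where "X1 p = cos_par ((fst p + a) / b)" for p :: "real \<times> real"
  define X2 where "X2 p = sin_par ((fst p + a) / b)" for p :: "real \<times> real"
  define Y1 where "Y1 p = cos_par ((snd p + a') / b')" for p :: "real \<times> real"
  define Y2 where "Y2 p = sin_par ((snd p + a') / b')" for p :: "real \<times> real"
  define r1 where "r1 = 1 / (2 * b)"
  define r2 where "r2 = 1 / (2 * b')"
  have r: "r1 \<noteq> 0" "r2 \<noteq> 0" using \<alpha> \<gamma> by (simp_all add: r1_def r2_def)
  have circ: "(X1 p)\<^sup>2 + (X2 p)\<^sup>2 = 1" "(Y1 p)\<^sup>2 + (Y2 p)\<^sup>2 = 1" for p
    by (simp_all add: X1_def X2_def Y1_def Y2_def cos_sin_par)
  have ind: "circle_indep D X1 X2 Y1 Y2"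
    unfolding X1_def[abs_def] X2_def[abs_def] Y1_def[abs_def] Y2_def[abs_def]
    by (rule circle_indep_par[OF assms(2,3) \<alpha>(2) \<gamma>(2)])
  define U where "U p = fst p *\<^sub>R 1 + \<alpha>" for p :: "real \<times> real"
  define V where "V p = snd p *\<^sub>R 1 + \<gamma>" for p :: "real \<times> real"
  have U: "inverse (U p) = r1 *\<^sub>R (X1 p *\<^sub>R 1 + X2 p *\<^sub>R I - I)" for p
    using inverse_affine[OF \<alpha>(3,2), of "fst p" a]
    by (simp add: U_def \<alpha>(1) X1_def X2_def r1_def algebra_simps)
  have V: "inverse (V p) = r2 *\<^sub>R (Y1 p *\<^sub>R 1 + Y2 p *\<^sub>R J - J)" for p
    using inverse_affine[OF \<gamma>(3,2), of "snd p" a']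
    by (simp add: V_def \<gamma>(1) Y1_def Y2_def r2_def algebra_simps)
  have UVnz: "U p \<noteq> 0" "V p \<noteq> 0" for p
  proof -
    have "qre I = 0" "I \<noteq> 0" "qre J = 0" "J \<noteq> 0" using \<alpha>(3) \<gamma>(3) by (auto simp: unit_imag_def)
    then show "U p \<noteq> 0" "V p \<noteq> 0"
      using \<alpha>(2) \<gamma>(2) by (auto simp: U_def V_def \<alpha>(1) \<gamma>(1) quat_eq_iff)
  qed
  \<comment> \<open>The numerator is divided by \<open>U\<close> on the left and by \<open>V\<close>
    on the right; \<open>\<delta>\<close> is the remainder.\<close>
  define P where "P = b1 - b3 * \<gamma>"
  define Q where "Q = b2 - \<alpha> * b3"
  define \<delta> where "\<delta> = b0 - \<alpha> * b3 * \<gamma> - \<alpha> * P - Q * \<gamma>"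
  have f1: "f p = b3 + P * inverse (V p) + inverse (U p) * Q + inverse (U p) * \<delta> * inverse (V p)" if "p \<in> D" for p
  proof -
    have "b0 + fst p *\<^sub>R b1 + snd p *\<^sub>R b2 + (fst p * snd p) *\<^sub>R b3
      = U p * b3 * V p + U p * P + Q * V p + \<delta>"
      by (simp add: \<delta>_def P_def Q_def U_def V_def algebra_simps)
    then have "f p = inverse (U p) * (U p * b3 * V p + U p * P + Q * V p + \<delta>) * inverse (V p)"
      using f[OF that] by (simp add: U_def V_def)
    also have "\<dots> = (inverse (U p) * U p) * b3 * (V p * inverse (V p)) + (inverse (U p) * U p) * P * inverse (V p)
       + inverse (U p) * Q * (V p * inverse (V p)) + inverse (U p) * \<delta> * inverse (V p)"
      by (simp only: distrib_left distrib_right mult.assoc)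
    finally show ?thesis using UVnz[of p] by simp
  qed
  show ?thesis
  proof (cases "\<delta> = 0")
    case True
    have P: "P \<noteq> 0"
    proof
      assume "P = 0"
      then have "\<forall>p\<in>D. f p = b3 + inverse (fst p *\<^sub>R 1 + \<alpha>) * Q"
        using f1 True by (simp add: U_def)
      then show False
        using inj_on_both_variables(1)[OF assms(2-4), of "\<lambda>u. b3 + inverse (u *\<^sub>R 1 + \<alpha>) * Q"] by blast
    qed
    have Q: "Q \<noteq> 0"
    proof
      assume "Q = 0"
      then have "\<forall>p\<in>D. f p = b3 + P * inverse (snd p *\<^sub>R 1 + \<gamma>)"
        using f1 True by (simp add: V_def)
      then show False
        using inj_on_both_variables(2)[OF assms(2-4), of "\<lambda>v. b3 + P * inverse (v *\<^sub>R 1 + \<gamma>)"] by blast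
    qed
    have fPQ: "f p = (b3 - r2 *\<^sub>R (P * J) - r1 *\<^sub>R (I * Q)) + (X1 p *\<^sub>R 1 + X2 p *\<^sub>R I) * (r1 *\<^sub>R Q)
      + (r2 *\<^sub>R P) * (Y1 p *\<^sub>R 1 + Y2 p *\<^sub>R J)" if "p \<in> D" for p
      unfolding f1[OF that] U V using True by (simp add: algebra_simps)
    show ?thesis
      by (rule classified_sum[OF sph assms(2,3) \<alpha>(3) \<gamma>(3) fPQ circ ind]) (use r P Q in simp_all)
  next
    case False
    \<comment> \<open>Adding the constant \<open>c\<close> below completes the expansion to
      \<open>(inverse (U p) + P * inverse \<delta>) * \<delta> * (inverse (V p) + inverse \<delta> *
      Q)\<close>. Conjugating \<open>J\<close> moves the middle \<open>\<delta>\<close> to the right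
      end, where it is divided out.\<close>
    define J' where "J' = \<delta> * J * inverse \<delta>"
    have J': "unit_imag J'" unfolding J'_def by (rule unit_imag_conj[OF \<gamma>(3) False])
    define c where "c = P * inverse \<delta> * Q - b3"
    define h where "h p = ((1 / (r1 * r2)) *\<^sub>R 1) * (f p + c) * inverse \<delta>" for p
    have h: "h p = (((1 / r1) *\<^sub>R (P * inverse \<delta>) - I) + X1 p *\<^sub>R 1 + X2 p *\<^sub>R I)
      * (((1 / r2) *\<^sub>R (Q * inverse \<delta>) - J') + Y1 p *\<^sub>R 1 + Y2 p *\<^sub>R J')" if "p \<in> D" for p
    proof -
      define S where "S = X1 p *\<^sub>R 1 + X2 p *\<^sub>R I - I"
      define T where "T = Y1 p *\<^sub>R 1 + Y2 p *\<^sub>R J - J"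
      have T: "\<delta> * T * inverse \<delta> = Y1 p *\<^sub>R 1 + Y2 p *\<^sub>R J' - J'"
        using False by (simp add: T_def J'_def distrib_left distrib_right left_diff_distrib right_diff_distrib)
      have d: "inverse \<delta> * (\<delta> * w) = w" "\<delta> * (inverse \<delta> * w) = w" for w
        using False by (simp_all add: mult.assoc[symmetric])
      have "f p + c = (r1 *\<^sub>R S + P * inverse \<delta>) * \<delta> * (r2 *\<^sub>R T + inverse \<delta> * Q)"
        unfolding f1[OF that] U V S_def[symmetric] T_def[symmetric] c_def
        by (simp add: distrib_left distrib_right scaleR_add_right mult.assoc d mult.commute[of r1])
      then have "h p = ((1 / r1) *\<^sub>R (r1 *\<^sub>R S + P * inverse \<delta>)) * (\<delta> * ((1 / r2) *\<^sub>R (r2 *\<^sub>R T + inverse \<delta> * Q)) * inverse \<delta>)"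
        unfolding h_def by (simp add: mult.assoc)
      also have "(1 / r1) *\<^sub>R (r1 *\<^sub>R S + P * inverse \<delta>) = ((1 / r1) *\<^sub>R (P * inverse \<delta>) - I) + X1 p *\<^sub>R 1 + X2 p *\<^sub>R I"
        using r by (simp add: S_def scaleR_add_right)
      also have "\<delta> * ((1 / r2) *\<^sub>R (r2 *\<^sub>R T + inverse \<delta> * Q)) * inverse \<delta>
        = \<delta> * T * inverse \<delta> + (1 / r2) *\<^sub>R (Q * inverse \<delta>)"
        using r by (simp add: scaleR_add_right distrib_left distrib_right mult.assoc d)
      also have "\<dots> = ((1 / r2) *\<^sub>R (Q * inverse \<delta>) - J') + Y1 p *\<^sub>R 1 + Y2 p *\<^sub>R J'"
        unfolding T by simp
      finally show ?thesis .
    qed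
    have nz: "(1 / (r1 * r2)) *\<^sub>R (1 :: quat) \<noteq> 0" "inverse \<delta> \<noteq> 0" using r False by simp_all
    have "spherical D h"
      unfolding h_def[abs_def] by (intro spherical_mult spherical_add sph nz)
    then have "classified D h"
      by (rule classified_product[OF _ assms(2) \<alpha>(3) J' h circ ind])
    then show ?thesis
      using classified_mult_add[of D "(1 / (r1 * r2)) *\<^sub>R 1" f "inverse \<delta>" "((1 / (r1 * r2)) *\<^sub>R 1) * c * inverse \<delta>"] nz
      by (simp add: h_def[abs_def] distrib_left distrib_right)
  qed
qed

text \<open>After splitting off the leading coefficient, a denominator with real constant term is a
  real scalar. It commutes with everything and joins the other denominator, which keeps bidegree (1,
  1), so a one-sided fraction remains.\<close>

lemma classified_separated:
  fixes B :: "quat \<Rightarrow> quat"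
  assumes sph: "spherical D f" and D: "open D" "D \<noteq> {}" and inj: "inj_on f D" and B: "linear B"
    and nz: "\<And>p. p \<in> D \<Longrightarrow> a0 + fst p *\<^sub>R a1 \<noteq> 0 \<and> c0 + snd p *\<^sub>R c1 \<noteq> 0"
    and f: "\<And>p. p \<in> D \<Longrightarrow> f p = inverse (a0 + fst p *\<^sub>R a1) * B (uv p) * inverse (c0 + snd p *\<^sub>R c1)"
  shows "classified D f"
proof -
  define A where "A = comb4 a0 a1 0 0"
  define C where "C = comb4 c0 0 c1 0"
  have lin: "linear A" "linear C" by (simp_all add: A_def C_def linear_comb4)
  have AC: "A (uv p) = a0 + fst p *\<^sub>R a1" "C (uv p) = c0 + snd p *\<^sub>R c1" for p
    by (simp_all add: A_def C_def comb4_def uv_def)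
  have mult: "linear (\<lambda>t. a * B t * b)" for a b :: quat
    by (intro linearI) (simp_all add: linear_add[OF B] linear_scale[OF B] distrib_left distrib_right)
  show ?thesis
  proof (cases "a1 = 0 \<or> c1 = 0")
    case True
    then show ?thesis
    proof
      assume a1: "a1 = 0"
      show ?thesis
        by (rule classified_right[OF mult[of "inverse a0" 1] lin(2) D sph]) (use nz f a1 in \<open>auto simp: AC\<close>)
    next
      assume c1: "c1 = 0"
      show ?thesis
        by (rule classified_left[OF lin(1) mult[of 1 "inverse c0"] D sph])
           (use nz f c1 in \<open>auto simp: AC mult.assoc\<close>)
    qed
  next
    case False
    define \<alpha> where "\<alpha> = inverse a1 * a0"
    define \<gamma> where "\<gamma> = c0 * inverse c1"
    have a: "a0 + u *\<^sub>R a1 = a1 * (u *\<^sub>R 1 + \<alpha>)" for u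
      using False by (simp add: \<alpha>_def distrib_left mult.assoc[symmetric])
    have c: "c0 + u *\<^sub>R c1 = (u *\<^sub>R 1 + \<gamma>) * c1" for u
      using False by (simp add: \<gamma>_def distrib_right mult.assoc)
    consider (ra) r where "\<alpha> = r *\<^sub>R 1" | (rc) r where "\<gamma> = r *\<^sub>R 1"
      | (im) a b I a' b' J where "\<alpha> = a *\<^sub>R 1 + b *\<^sub>R I" "b \<noteq> 0" "unit_imag I"
        "\<gamma> = a' *\<^sub>R 1 + b' *\<^sub>R J" "b' \<noteq> 0" "unit_imag J"
      using real_or_unit_imag[of \<alpha>] real_or_unit_imag[of \<gamma>] by metis
    then show ?thesis
    proof cases
      case ra
      have e: "a0 + fst p *\<^sub>R a1 = (fst p + r) *\<^sub>R a1" for p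
        unfolding a ra by (simp add: scaleR_add_left distrib_left)
      define C' where "C' = comb4 (r *\<^sub>R c0) c0 (r *\<^sub>R c1) c1"
      have C': "C' (uv p) = (fst p + r) *\<^sub>R C (uv p)" for p
        by (simp add: C'_def C_def comb4_def uv_def algebra_simps)
      show ?thesis
      proof (rule classified_right[OF mult[of "inverse a1" 1] _ D sph])
        show "linear C'" by (simp add: C'_def linear_comb4)
        fix p assume p: "p \<in> D"
        have "fst p + r \<noteq> 0" "C (uv p) \<noteq> 0" using nz[OF p] e[of p] AC by auto
        then show "C' (uv p) \<noteq> 0" "f p = inverse a1 * B (uv p) * 1 * inverse (C' (uv p))"
          unfolding f[OF p] C' AC(2)[symmetric] e by (simp_all add: inverse_scaleR_distrib)
      qed
    next
      case rc
      have e: "c0 + snd p *\<^sub>R c1 = (snd p + r) *\<^sub>R c1" for p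
        unfolding c rc by (simp add: scaleR_add_left distrib_right)
      define A' where "A' = comb4 (r *\<^sub>R a0) (r *\<^sub>R a1) a0 a1"
      have A': "A' (uv p) = (snd p + r) *\<^sub>R A (uv p)" for p
        by (simp add: A'_def A_def comb4_def uv_def algebra_simps)
      show ?thesis
      proof (rule classified_left[OF _ mult[of 1 "inverse c1"] D sph])
        show "linear A'" by (simp add: A'_def linear_comb4)
        fix p assume p: "p \<in> D"
        have "snd p + r \<noteq> 0" "A (uv p) \<noteq> 0" using nz[OF p] e[of p] AC by auto
        then show "A' (uv p) \<noteq> 0" "f p = inverse (A' (uv p)) * (1 * B (uv p) * inverse c1)"
          unfolding f[OF p] A' AC(1)[symmetric] e by (simp_all add: inverse_scaleR_distrib mult.assoc)
      qed
    next
      case im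
      obtain b0 b1 b2 b3 where B4: "B = comb4 b0 b1 b2 b3" using linear_eq_comb4[OF B] by blast
      let ?m = "\<lambda>x. inverse a1 * x * inverse c1"
      show ?thesis
      proof (rule classified_separated_imag[OF sph D inj im])
        fix p assume p: "p \<in> D"
        have "fst p *\<^sub>R 1 + \<alpha> \<noteq> 0" "snd p *\<^sub>R 1 + \<gamma> \<noteq> 0" using nz[OF p] unfolding a c by auto
        then have "f p = inverse (fst p *\<^sub>R 1 + \<alpha>) * (?m (B (uv p))) * inverse (snd p *\<^sub>R 1 + \<gamma>)"
          unfolding f[OF p] a c using False by (simp add: nonzero_inverse_mult_distrib mult.assoc)
        also have "?m (B (uv p)) = ?m b0 + fst p *\<^sub>R ?m b1 + snd p *\<^sub>R ?m b2 + (fst p * snd p) *\<^sub>R ?m b3"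
          by (simp add: B4 comb4_def uv_def distrib_left distrib_right)
        finally show "f p = inverse (fst p *\<^sub>R 1 + \<alpha>) * (?m b0 + fst p *\<^sub>R ?m b1 + snd p *\<^sub>R ?m b2 + (fst p * snd p) *\<^sub>R ?m b3)
          * inverse (snd p *\<^sub>R 1 + \<gamma>)" .
      qed
    qed
  qed
qed

section \<open>From polynomials to the four shapes of the denominators\<close>

lemma classified_vimage:
  assumes "classified (\<phi> -` D) (\<lambda>x. f (\<phi> x))" "\<And>x. \<phi> (\<phi> x) = x"
  shows "classified D f"
proof -
  obtain h Y where h: "darboux_cyclide Y \<or> euclidean_translational Y \<or> clifford_translational Y"
    "h ` (\<phi> -` D) \<subseteq> Y" "conf_eq (\<phi> -` D) (\<lambda>x. f (\<phi> x)) (h :: 'a \<Rightarrow> real ^ 3)"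
    using assms(1) unfolding classified_def by blast
  obtain \<rho> where r: "\<And>x. x \<in> \<phi> -` D \<Longrightarrow> \<rho> x > 0"
    "\<And>x y. x \<in> \<phi> -` D \<Longrightarrow> y \<in> \<phi> -` D \<Longrightarrow> dist (h x) (h y) = \<rho> x * \<rho> y * dist (f (\<phi> x)) (f (\<phi> y))"
    using h(3) unfolding conf_eq_def by blast
  have "conf_eq D f (\<lambda>x. h (\<phi> x))"
    by (rule conf_eqI[where \<rho> = "\<lambda>x. \<rho> (\<phi> x)"]) (simp_all add: r assms(2))
  moreover have "(\<lambda>x. h (\<phi> x)) ` D \<subseteq> Y" using h(2) assms(2) by fastforce
  ultimately show ?thesis unfolding classified_def using h(1) by blast
qed

lemma quat_eval_comb4:
  assumes "P \<in> quat_polys 1 1"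
  shows "\<exists>a b c d. \<forall>p. quat_eval P p = comb4 a b c d (uv p)"
proof -
  let ?K = "{(0, 0), (1, 0), (0, 1), (1, 1)} :: (nat \<times> nat) set"
  let ?l = "Poly_Mapping.lookup P"
  have "Poly_Mapping.keys P \<subseteq> ?K"
  proof
    fix x assume "x \<in> Poly_Mapping.keys P"
    then have "fst x \<le> 1" "snd x \<le> 1" using assms by (auto simp: quat_polys_def)
    then show "x \<in> ?K" by (cases x) auto
  qed
  then have "quat_eval P (u, v) = comb4 (?l (0, 0)) (?l (1, 0)) (?l (0, 1)) (?l (1, 1)) (uv (u, v))" for u v
    by (subst quat_eval_superset[of ?K]) (simp_all add: comb4_uv)
  then have "\<forall>p. quat_eval P p = comb4 (?l (0, 0)) (?l (1, 0)) (?l (0, 1)) (?l (1, 1)) (uv p)" by simp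
  then show ?thesis by blast
qed

text \<open>The second difference in one variable at -1, 0, 1 is twice the quadratic coefficient,
  which is absent on the right for every value of the other variable.\<close>

lemma product_bilinear_coeffs:
  fixes a0 :: quat
  assumes "\<And>p. comb4 a0 a1 a2 a3 (uv p) * comb4 c0 c1 c2 c3 (uv p) = comb4 e0 e1 e2 e3 (uv p)"
  shows "a1 * c1 = 0" "a2 * c2 = 0" "a3 * c3 = 0" "a1 * c3 + a3 * c1 = 0" "a2 * c3 + a3 * c2 = 0"
proof -
  define F where "F u v = (a0 + u *\<^sub>R a1 + v *\<^sub>R a2 + (u * v) *\<^sub>R a3) * (c0 + u *\<^sub>R c1 + v *\<^sub>R c2 + (u * v) *\<^sub>R c3)"
    for u v
  have F: "F u v = e0 + u *\<^sub>R e1 + v *\<^sub>R e2 + (u * v) *\<^sub>R e3" for u v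
    using assms[of "(u, v)"] by (simp add: F_def comb4_uv)
  have double: "x = 0" if "x + x = 0" for x :: quat
    using that by (simp add: scaleR_2[symmetric])
  have 1: "F u 1 + F u (- 1) - (F u 0 + F u 0)
      = (a2 + u *\<^sub>R a3) * (c2 + u *\<^sub>R c3) + (a2 + u *\<^sub>R a3) * (c2 + u *\<^sub>R c3)" for u
    by (simp add: F_def algebra_simps)
  have 2: "F 1 v + F (- 1) v - (F 0 v + F 0 v)
      = (a1 + v *\<^sub>R a3) * (c1 + v *\<^sub>R c3) + (a1 + v *\<^sub>R a3) * (c1 + v *\<^sub>R c3)" for v
    by (simp add: F_def algebra_simps)
  have z1: "(a2 + u *\<^sub>R a3) * (c2 + u *\<^sub>R c3) = 0" for u
    by (rule double) (simp add: 1[symmetric] F)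
  have z2: "(a1 + v *\<^sub>R a3) * (c1 + v *\<^sub>R c3) = 0" for v
    by (rule double) (simp add: 2[symmetric] F)
  show a: "a2 * c2 = 0" "a1 * c1 = 0" using z1[of 0] z2[of 0] by simp_all
  have s: "(x + y) * (z + w) + (x - y) * (z - w) = 2 *\<^sub>R (x * z + y * w)"
    "(x + y) * (z + w) - (x - y) * (z - w) = 2 *\<^sub>R (x * w + y * z)" for x y z w :: quat
    by (simp_all add: algebra_simps scaleR_2)
  have pm: "(a2 + a3) * (c2 + c3) = 0" "(a2 - a3) * (c2 - c3) = 0"
    "(a1 + a3) * (c1 + c3) = 0" "(a1 - a3) * (c1 - c3) = 0"
    using z1[of 1] z1[of "- 1"] z2[of 1] z2[of "- 1"]
    by (simp_all only: scaleR_one scaleR_minus1_left add_uminus_conv_diff)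
  show "a3 * c3 = 0" using s(1)[of a2 a3 c2 c3, unfolded pm a] by simp
  show "a2 * c3 + a3 * c2 = 0" using s(2)[of a2 a3 c2 c3, unfolded pm] by simp
  show "a1 * c3 + a3 * c1 = 0" using s(2)[of a1 a3 c1 c3, unfolded pm] by simp
qed

lemma spherical_vimage_swap:
  assumes "spherical D f" "open D"
  shows "spherical (prod.swap -` D) (\<lambda>p. f (prod.swap p))"
proof -
  have lin: "linear (prod.swap :: real \<times> real \<Rightarrow> real \<times> real)" by (auto simp: linear_iff)
  have "(\<lambda>p. f (prod.swap p)) differentiable_on (prod.swap -` D)"
    unfolding differentiable_on_def
  proof
    fix p assume p: "p \<in> prod.swap -` D"
    then have "f differentiable (at (prod.swap p) within D)"
      using assms(1) by (simp add: spherical_def differentiable_on_def)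
    then have "f differentiable (at (prod.swap p))" using p at_within_open[OF _ assms(2)] by simp
    then have "(f \<circ> prod.swap) differentiable (at p)"
      by (rule differentiable_chain_at[OF linear_imp_differentiable[OF lin]])
    then show "(\<lambda>p. f (prod.swap p)) differentiable (at p within prod.swap -` D)"
      by (simp add: comp_def differentiable_at_withinI)
  qed
  then show ?thesis using assms(1) unfolding spherical_def by blast
qed

lemma classified_Phi:
  assumes "A \<in> quat_polys 1 1" "B \<in> quat_polys 1 1" "C \<in> quat_polys 1 1" "A * C \<in> quat_polys 1 1"
    and nz: "\<And>p. p \<in> D \<Longrightarrow> quat_eval A p \<noteq> 0 \<and> quat_eval C p \<noteq> 0"
    and D: "open D" "D \<noteq> {}" and inj: "inj_on (Phi A B C) D" and sph: "spherical D (Phi A B C)"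
  shows "classified D (Phi A B C)"
proof -
  obtain a0 a1 a2 a3 where A: "\<And>p. quat_eval A p = comb4 a0 a1 a2 a3 (uv p)"
    using quat_eval_comb4[OF assms(1)] by blast
  obtain b0 b1 b2 b3 where B: "\<And>p. quat_eval B p = comb4 b0 b1 b2 b3 (uv p)"
    using quat_eval_comb4[OF assms(2)] by blast
  obtain c0 c1 c2 c3 where C: "\<And>p. quat_eval C p = comb4 c0 c1 c2 c3 (uv p)"
    using quat_eval_comb4[OF assms(3)] by blast
  obtain e0 e1 e2 e3 where E: "\<And>p. quat_eval (A * C) p = comb4 e0 e1 e2 e3 (uv p)"
    using quat_eval_comb4[OF assms(4)] by blast
  let ?B = "comb4 b0 b1 b2 b3"
  note coeffs = product_bilinear_coeffs[OF E[unfolded quat_eval_mult A C]]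
  have Phi: "Phi A B C p = inverse (comb4 a0 a1 a2 a3 (uv p)) * ?B (uv p) * inverse (comb4 c0 c1 c2 c3 (uv p))" for p
    by (simp add: Phi_def A B C)
  have mult: "linear (\<lambda>t. a * ?B t * b)" for a b :: quat
    by (intro linearI) (simp_all add: linear_add[OF linear_comb4] linear_scale[OF linear_comb4] distrib_left distrib_right)
  \<comment> \<open>Quaternions have no zero divisors, so each vanishing product kills one
    coefficient; a nonzero \<open>a3\<close> already makes \<open>C\<close> constant, and a nonzero
    \<open>c3\<close> makes \<open>A\<close> constant.\<close>
  consider (A) "a1 = 0" "a2 = 0" "a3 = 0" | (C) "c1 = 0" "c2 = 0" "c3 = 0"
    | (uv) "a2 = 0" "a3 = 0" "c1 = 0" "c3 = 0" | (vu) "a1 = 0" "a3 = 0" "c2 = 0" "c3 = 0"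
  proof (cases "a3 = 0")
    case False
    then have "c3 = 0" "c1 = 0" "c2 = 0" using coeffs by auto
    show ?thesis by (rule that(2)) fact+
  next
    case a3: True
    show ?thesis
    proof (cases "c3 = 0")
      case False
      then have "a1 = 0" "a2 = 0" using coeffs a3 by auto
      show ?thesis by (rule that(1)) fact+
    next
      case True
      then have "a1 = 0 \<or> c1 = 0" "a2 = 0 \<or> c2 = 0" using coeffs by auto
      then show ?thesis using a3 True that by blast
    qed
  qed
  then show ?thesis
  proof cases
    case A
    have e: "comb4 a0 a1 a2 a3 (uv p) = a0" for p by (simp add: A comb4_def uv_def)
    show ?thesis
      by (rule classified_right[OF mult[of "inverse a0" 1] linear_comb4[of c0 c1 c2 c3] D sph])
         (use nz in \<open>simp_all add: Phi e C\<close>)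
  next
    case C
    have e: "comb4 c0 c1 c2 c3 (uv p) = c0" for p by (simp add: C comb4_def uv_def)
    show ?thesis
      by (rule classified_left[OF linear_comb4[of a0 a1 a2 a3] mult[of 1 "inverse c0"] D sph])
         (use nz in \<open>simp_all add: Phi e A mult.assoc\<close>)
  next
    case uv
    have e: "comb4 a0 a1 a2 a3 (uv p) = a0 + fst p *\<^sub>R a1" "comb4 c0 c1 c2 c3 (uv p) = c0 + snd p *\<^sub>R c2" for p
      by (simp_all add: uv comb4_def uv_def)
    show ?thesis
      by (rule classified_separated[OF sph D inj linear_comb4[of b0 b1 b2 b3]])
         (use nz in \<open>simp_all add: Phi e A C\<close>)
  next
    case vu
    have e: "comb4 a0 a1 a2 a3 (uv p) = a0 + snd p *\<^sub>R a2" "comb4 c0 c1 c2 c3 (uv p) = c0 + fst p *\<^sub>R c1" for p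
      by (simp_all add: vu comb4_def uv_def)
    have b: "?B (uv (prod.swap p)) = comb4 b0 b2 b1 b3 (uv p)" for p
      by (simp add: comb4_def uv_def algebra_simps)
    let ?D = "prod.swap -` D"
    have "open ?D" using D(1) by (intro open_vimage continuous_on_swap)
    moreover have "?D \<noteq> {}" using D(2) by (metis empty_iff equals0I swap_swap vimageI2)
    moreover have "inj_on (\<lambda>p. Phi A B C (prod.swap p)) ?D"
    proof (rule inj_onI)
      fix x y assume "x \<in> ?D" "y \<in> ?D" "Phi A B C (prod.swap x) = Phi A B C (prod.swap y)"
      then have "prod.swap x = prod.swap y" using inj_onD[OF inj, of "prod.swap x" "prod.swap y"] by simp
      then show "x = y" by (metis swap_swap)
    qed
    ultimately have "classified ?D (\<lambda>p. Phi A B C (prod.swap p))"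
      by (rule classified_separated[OF spherical_vimage_swap[OF sph D(1)] _ _ _ linear_comb4[of b0 b2 b1 b3]])
         (use nz in \<open>auto simp: Phi e A C b[symmetric]\<close>)
    then show ?thesis by (rule classified_vimage) simp
  qed
qed

theorem corollary1p4:
  fixes A B C :: quat_poly and D :: "(real \<times> real) set" and S :: "(real ^ 3) set"
  assumes "A \<in> quat_polys 1 1" and "B \<in> quat_polys 1 1" and "C \<in> quat_polys 1 1"
    and "A * C \<in> quat_polys 1 1"
    and "\<And>p. p \<in> D \<Longrightarrow> quat_eval A p \<noteq> 0 \<and> quat_eval C p \<noteq> 0"
    and "surface_param D (Phi A B C)"
    and "surface S"
    and "moebius_image_of (im_quat ` S) (Phi A B C ` D)"
  shows "\<exists>X Y. (darboux_cyclide Y \<or> euclidean_translational Y \<or> clifford_translational Y) \<and>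
           X \<subseteq> Y \<and> moebius_image_of S X"
proof -
  let ?f = "Phi A B C"
  obtain M where M: "moebius M" "Some ` im_quat ` S = M ` Some ` ?f ` D"
    using assms(8) unfolding moebius_image_of_def by blast
  have "\<exists>x\<in>S. M (Some (?f p)) = Some (im_quat x)" if "p \<in> D" for p
  proof -
    have "M (Some (?f p)) \<in> Some ` im_quat ` S" unfolding M(2) using that by blast
    then show ?thesis by auto
  qed
  \<comment> \<open>A parametrisation of \<open>S\<close> over \<open>D\<close> itself, to be
    compared with \<open>Phi A B C\<close> point by point.\<close>
  then obtain g where g: "\<And>p. p \<in> D \<Longrightarrow> g p \<in> S" "\<And>p. p \<in> D \<Longrightarrow> M (Some (?f p)) = Some (im_quat (g p))"
    by metis
  have gD: "g ` D = S"
  proof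
    show "g ` D \<subseteq> S" using g(1) by blast
    show "S \<subseteq> g ` D"
    proof
      fix x assume "x \<in> S"
      then have "Some (im_quat x) \<in> M ` Some ` ?f ` D" unfolding M(2)[symmetric] by blast
      then obtain p where p: "p \<in> D" "Some (im_quat x) = M (Some (?f p))" by blast
      then have "im_quat x = im_quat (g p)" using g(2) by simp
      then have "x = g p" using im_part_im_quat by metis
      then show "x \<in> g ` D" using p(1) by blast
    qed
  qed
  obtain \<rho> where \<rho>: "\<And>x. \<rho> x > 0" "\<And>x y. odist (M x) (M y) = \<rho> x * \<rho> y * odist x y"
    using odist_moebius[OF M(1)] by blast
  have fg: "conf_eq D ?f g"
  proof (rule conf_eqI[where \<rho> = "\<lambda>p. \<rho> (Some (?f p))"])
    show "dist (g s) (g t) = \<rho> (Some (?f s)) * \<rho> (Some (?f t)) * dist (?f s) (?f t)"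
      if "s \<in> D" "t \<in> D" for s t
      using \<rho>(2)[of "Some (?f s)" "Some (?f t)"] g(2)[OF that(1)] g(2)[OF that(2)]
      by (simp add: dist_im_quat)
  qed (rule \<rho>(1))
  \<comment> \<open>These coefficients describe the hyperplane of imaginary quaternions, whose
    preimage under \<open>M\<close> contains the surface.\<close>
  have "(1 :: quat) \<bullet> 1 - 4 * 0 * 0 > 0" by (simp add: inner_quat_def)
  then obtain \<kappa> n m where s: "n \<bullet> n - 4 * \<kappa> * m > 0"
    "\<And>x. on_osphere 0 1 0 (M x) \<Longrightarrow> on_osphere \<kappa> n m x"
    using on_osphere_moebius[OF M(1)] by blast
  have on: "on_sphere \<kappa> n m (?f p)" if "p \<in> D" for p
    using s(2)[of "Some (?f p)"] g(2)[OF that]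
    by (simp add: on_osphere_def) (simp add: on_sphere_def inner_one_quat)
  have D: "open D" "D \<noteq> {}" "inj_on ?f D" and "\<And>p. p \<in> D \<Longrightarrow> ?f differentiable (at p)"
    using assms(6) unfolding surface_param_def differentiable_def by blast+
  then have "?f differentiable_on D"
    by (simp add: differentiable_on_def differentiable_at_withinI)
  then have "spherical D ?f" unfolding spherical_def using s(1) on by blast
  then have "classified D ?f"
    using classified_Phi[OF assms(1-5) D] by blast
  then obtain h Y where h: "darboux_cyclide Y \<or> euclidean_translational Y \<or> clifford_translational Y"
    "h ` D \<subseteq> Y" "conf_eq D ?f (h :: real \<times> real \<Rightarrow> real ^ 3)"
    unfolding classified_def by blast
  have "moebius_image_of (g ` D) (h ` D)"
    by (rule moebius_image_of_conf_eq[OF conf_eq_trans[OF conf_eq_sym[OF h(3)] fg]])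
  then show ?thesis using h(1,2) gD by blast
qed

end
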